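(* Let $Y$ be a nonempty zero-dimensional Polish space without isolated points. Then $2^\omega$ is $Y$-partitionable and $Y$ is $2^\omega$-partitionable. Consequently: (1) If $X$ is a first countable Hausdorff space and $|X| \leq \mathfrak{c}$, then $X$ is $Y$-partitionable if and only if $X$ is $Y$-coverable. (2) If $X$ is a metrizable space and $|X| \leq \mathfrak{c}^{+\omega}$, then $X$ is $Y$-partitionable if and only if $X$ is $Y$-coverable. (3) If $X$ is a completely metrizable space, then $X$ is $Y$-partitionable if and only if $X$ is $Y$-coverable if and only if $X$ has no isolated points (that is, these three conditions are equivalent).
   Context: $2^\omega$ denotes the Cantor space. $\mathfrak{c} = 2^{\aleph_0}$; put $\mathfrak{c}^{+0} = \mathfrak{c}$, $\mathfrak{c}^{+(n+1)} = (\mathfrak{c}^{+n})^+$ (cardinal successor), and $\mathfrak{c}^{+\omega} = \sup_{n<\omega} \mathfrak{c}^{+n}$. A space is zero-dimensional if it has a basis of clopen sets. For topological spaces $X$ and $Y$: $X$ is $Y$-partitionable if there is a partition of $X$ (a family of pairwise disjoint subsets with union $X$) each member of which, with the subspace topology, is homeomorphic to $Y$; $X$ is $Y$-coverable if there is a family of subsets of $X$ with union $X$, each member of which, with the subspace topology, is homeomorphic to $Y$. *)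

theory Defs
  imports "HOL-Analysis.Analysis"
begin

unbundle cardinal_syntax

definition cantor_space :: "(nat \<Rightarrow> bool) topology" where
  "cantor_space = product_topology (\<lambda>_. discrete_topology UNIV) UNIV"

definition zero_dimensional_space :: "'a topology \<Rightarrow> bool" where
  "zero_dimensional_space X \<longleftrightarrow>
     (\<exists>\<B>. (\<forall>V\<in>\<B>. openin X V \<and> closedin X V) \<and>
          (\<forall>U x. openin X U \<and> x \<in> U \<longrightarrow> (\<exists>V\<in>\<B>. x \<in> V \<and> V \<subseteq> U)))"

definition polish_space :: "'a topology \<Rightarrow> bool" where
  "polish_space X \<longleftrightarrow> completely_metrizable_space X \<and> separable_space X"

definition no_isolated_points :: "'a topology \<Rightarrow> bool" where
  "no_isolated_points X \<longleftrightarrow> (\<forall>x\<in>topspace X. \<not> openin X {x})"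

definition partitionable :: "'a topology \<Rightarrow> 'b topology \<Rightarrow> bool" where
  "partitionable X Y \<longleftrightarrow>
     (\<exists>\<P>. \<Union>\<P> = topspace X \<and> disjoint \<P> \<and>
          (\<forall>A\<in>\<P>. subtopology X A homeomorphic_space Y))"

definition coverable :: "'a topology \<Rightarrow> 'b topology \<Rightarrow> bool" where
  "coverable X Y \<longleftrightarrow>
     (\<exists>\<C>. \<Union>\<C> = topspace X \<and> (\<forall>A\<in>\<C>. subtopology X A homeomorphic_space Y))"

abbreviation continuum :: "(nat \<Rightarrow> bool) rel" where
  "continuum \<equiv> ctwo ^c natLeq"

text \<open>
  No single type need contain all the iterated successors of the continuum (and
  \<open>cardSuc\<close> changes the type), so they are given as predicates on the cardinals
  available in a type: \<open>is_continuum_succ n r\<close> says that \<open>r\<close> is, up to order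
  isomorphism, the \<open>n\<close>-th cardinal successor of the continuum.  It holds for no \<open>r\<close>
  of type \<open>'a rel\<close> if that cardinal exceeds the cardinality of \<open>'a\<close>.
\<close>

fun is_continuum_succ :: "nat \<Rightarrow> 'a rel \<Rightarrow> bool" where
  "is_continuum_succ 0 r \<longleftrightarrow> r =o continuum"
| "is_continuum_succ (Suc n) r \<longleftrightarrow> (\<exists>s :: 'a rel. is_continuum_succ n s \<and> r =o cardSuc s)"

text \<open>
  The cardinality of \<open>A\<close> is at most the supremum of the iterated successors of the
  continuum, i.e. at most each of their upper bounds.  Quantifying over the upper bounds
  on the element type \<open>'a\<close> of \<open>A\<close> suffices: if the supremum is at most the cardinality
  of \<open>'a\<close>, it is itself one of these upper bounds; otherwise there are none, and every
  set of type \<open>'a set\<close> has smaller cardinality than the supremum.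
\<close>

definition card_le_continuum_succ_omega :: "'a set \<Rightarrow> bool" where
  "card_le_continuum_succ_omega A \<longleftrightarrow>
     (\<forall>r :: 'a rel. Card_order r \<and> (\<forall>n. \<exists>s :: 'a rel. is_continuum_succ n s \<and> s \<le>o r)
        \<longrightarrow> |A| \<le>o r)"

end

(*
  A disjoint family of copies of the Cantor space in X, each cut into continuum many copies, can be
  enlarged to a partition of X: a leftover point x is absorbed by a sequence of pieces converging
  to x, because the union of {x} with such a sequence is again a copy of the Cantor space.  All one
  needs is a choice of sequences for distinct leftover points that use distinct pieces.  It is a
  matter of cardinalities; in a metrizable space it is possible if, in each open set U, the
  leftover is no larger than continuum times the number of copies that meet U.

  In (1) and (2) every maximal family will do, in (2) because |U| is at most the countable power of
  a dense subset and countable powers of the successors of the continuum do not grow.  In (3) the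
  family has to be chosen: X is coded by a closed set F of sequences.  If F is a closed set with a
  smallest tree that admits no suitable family, remove from F all cylinders in which every closed
  subset does admit one.  In what remains all nodes have equally many descendants, so that it is a
  continuous bijective image of K^omega = (K x 2)^omega, which is a disjoint union of Cantor sets.

  The space Y has a nonempty compact open subset, which is a Cantor space by Brouwer's theorem, or
  it is homeomorphic to the set of binary sequences with infinitely many ones.  Both models
  are invariant under changes of finite initial segments, and therefore the absorption of points
  also works for copies of Y, which yields the partition of the Cantor space.
*)
theory Submission
  imports Defs
begin

subsection \<open>Embeddings of the Cantor space\<close>

text \<open>Absorption must serve both the Cantor space and \<open>Y\<close>, but of
  \<open>Y\<close> only a part is controlled: some compact open set, or else the whole space. Hence
  the pair \<open>R\<close>, \<open>T\<close>: the model \<open>T\<close> of \<open>Y\<close> is a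
  set of binary sequences whose half beginning with \<open>False\<close> is a copy of a tail
  invariant set \<open>R\<close>, while its other half is arbitrary. All rearrangements happen in
  the first half. If \<open>R\<close> is not everything, points inside the copies are left over too;
  this is affordable if the space has at most continuum many points. Larger spaces are cut into
  Cantor sets, and these into copies of \<open>Y\<close>. In large metrizable spaces, the demands of
  a point at all scales compete with those of its neighbours. Each piece therefore carries a label
  that reserves it for one scale; at a fixed scale the points fall into components along which the
  local size of the leftover is constant. The code of a complete space uses centres of balls that
  come first in a well-order. This keeps the set of codes closed, and it keeps the number of centres
  used in an open set small.\<close>

lemma topspace_cantor_space [simp]: "topspace cantor_space = UNIV"
  by (simp add: cantor_space_def)

lemma compact_space_cantor_space: "compact_space cantor_space"
  by (simp add: cantor_space_def compact_space_product_topology compact_space_discrete_topology)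

lemma Hausdorff_cantor_space: "Hausdorff_space cantor_space"
  by (simp add: cantor_space_def Hausdorff_space_product_topology)

text \<open>Replaces the product topology by agreement on initial segments, the form in which
  continuity is used from here on.\<close>

lemma openin_cantor_space:
  "openin cantor_space S \<longleftrightarrow> (\<forall>f\<in>S. \<exists>n. \<forall>g. (\<forall>m<n. g m = f m) \<longrightarrow> g \<in> S)"
proof -
  have "(\<exists>V. finite {i. V i \<noteq> UNIV} \<and> f \<in> Pi UNIV V \<and> Pi UNIV V \<subseteq> S) \<longleftrightarrow>
        (\<exists>n. \<forall>g. (\<forall>m<n. g m = f m) \<longrightarrow> g \<in> S)" (is "?L \<longleftrightarrow> ?R") for f :: "nat \<Rightarrow> bool"
  proof
    assume ?L
    then obtain V where V: "finite {i. V i \<noteq> UNIV}" "f \<in> Pi UNIV V" "Pi UNIV V \<subseteq> S" by blast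
    obtain n where "\<forall>i\<in>{i. V i \<noteq> UNIV}. i < n"
      using V(1) finite_nat_set_iff_bounded by meson
    then have n: "V i \<noteq> UNIV \<Longrightarrow> i < n" for i by simp
    have "g \<in> S" if "\<forall>m<n. g m = f m" for g
    proof -
      have "g i \<in> V i" for i
      proof (cases "V i = UNIV")
        case False
        then show ?thesis using n[of i] that Pi_mem[OF V(2), of i] by simp
      qed simp
      then show ?thesis using V(3) by blast
    qed
    then show ?R by blast
  next
    assume ?R
    then obtain n where n: "\<And>g. (\<forall>m<n. g m = f m) \<Longrightarrow> g \<in> S" by blast
    let ?V = "\<lambda>i. if i < n then {f i} else UNIV"
    have "finite {i. ?V i \<noteq> UNIV}" by (rule finite_subset[of _ "{..<n}"]) auto
    moreover have "f \<in> Pi UNIV ?V" by auto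
    moreover have "Pi UNIV ?V \<subseteq> S"
    proof
      fix g assume g: "g \<in> Pi UNIV ?V"
      have "g m = f m" if "m < n" for m
        using Pi_mem[OF g, of m] that by simp
      then show "g \<in> S" using n by blast
    qed
    ultimately show ?L by (intro exI[of _ ?V] conjI)
  qed
  then show ?thesis
    unfolding cantor_space_def openin_product_topology_alt by (simp add: PiE_UNIV_domain)
qed

text \<open>Continuity is stated through initial segments. Nothing more is needed of a copy: a
  continuous injection of a compact space into a Hausdorff space is an embedding.\<close>

definition cantor_map :: "'a topology \<Rightarrow> ((nat \<Rightarrow> bool) \<Rightarrow> 'a) \<Rightarrow> bool" where
  "cantor_map X h \<longleftrightarrow> inj h \<and> range h \<subseteq> topspace X \<and>
     (\<forall>U f. openin X U \<and> h f \<in> U \<longrightarrow> (\<exists>n. \<forall>g. (\<forall>m<n. g m = f m) \<longrightarrow> h g \<in> U))"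

lemma cantor_mapD:
  assumes "cantor_map X h"
  shows "inj h" and "h f \<in> topspace X"
    and "openin X U \<Longrightarrow> h f \<in> U \<Longrightarrow> \<exists>n. \<forall>g. (\<forall>m<n. g m = f m) \<longrightarrow> h g \<in> U"
  using assms unfolding cantor_map_def by blast+

lemma cantor_map_continuous_map: "cantor_map X h \<Longrightarrow> continuous_map cantor_space X h"
  unfolding cantor_map_def continuous_map_def openin_cantor_space by auto

lemma continuous_map_cantor_map:
  assumes "continuous_map cantor_space X h" "inj h"
  shows "cantor_map X h"
  unfolding cantor_map_def
proof (intro conjI allI impI)
  show "range h \<subseteq> topspace X" using assms(1) by (auto simp: continuous_map_def)
  fix U f assume "openin X U \<and> h f \<in> U"
  then have "openin cantor_space {x \<in> topspace cantor_space. h x \<in> U}"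
    using assms(1) by (auto simp: continuous_map_def)
  then show "\<exists>n. \<forall>g. (\<forall>m<n. g m = f m) \<longrightarrow> h g \<in> U"
    using \<open>openin X U \<and> h f \<in> U\<close> unfolding openin_cantor_space by auto
qed (rule assms)

lemma cantor_map_embedding:
  assumes "Hausdorff_space X" "cantor_map X h"
  shows "embedding_map cantor_space X h"
proof (rule injective_closed_imp_embedding_map)
  show c: "continuous_map cantor_space X h"
    using assms(2) by (rule cantor_map_continuous_map)
  show "closed_map cantor_space X h"
    by (rule continuous_imp_closed_map[OF c compact_space_cantor_space assms(1)])
  show "inj_on h (topspace cantor_space)"
    using cantor_mapD(1)[OF assms(2)] by simp
qed

text \<open>\<open>T\<close> is arbitrary, so that one map also yields copies of subspaces of the
  Cantor space; this is how copies of \<open>Y\<close> arise.\<close>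

lemma cantor_map_homeomorphic_space:
  assumes "Hausdorff_space X" "cantor_map X h"
  shows "subtopology X (h ` T) homeomorphic_space subtopology cantor_space T"
proof -
  have "homeomorphic_map cantor_space (subtopology X (range h)) h"
    using cantor_map_embedding[OF assms] by (simp add: embedding_map_def)
  then have "homeomorphic_map (subtopology cantor_space T) (subtopology (subtopology X (range h)) (h ` T)) h"
    by (rule homeomorphic_map_subtopologies)
      (use assms in \<open>auto simp: cantor_map_def\<close>)
  then have "subtopology cantor_space T homeomorphic_space subtopology X (h ` T)"
    by (simp add: subtopology_subtopology homeomorphic_map_imp_homeomorphic_space
        inf.absorb2 image_mono)
  then show ?thesis by (rule homeomorphic_space_sym[THEN iffD1])
qed

lemma homeomorphic_cantor_imp_cantor_map:
  assumes "subtopology X A homeomorphic_space cantor_space" "A \<subseteq> topspace X"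
  shows "\<exists>h. cantor_map X h \<and> range h = A"
proof -
  obtain h where h: "homeomorphic_map cantor_space (subtopology X A) h"
    using assms(1) homeomorphic_space homeomorphic_space_sym by blast
  have c: "continuous_map cantor_space X h"
    using h homeomorphic_imp_continuous_map continuous_map_into_fulltopology by blast
  have i: "inj h" using homeomorphic_imp_injective_map[OF h] by simp
  have "range h = A" using homeomorphic_imp_surjective_map[OF h] assms(2) by (simp add: inf.absorb2)
  then show ?thesis using continuous_map_cantor_map[OF c i] by blast
qed

section \<open>Absorbing leftover points into convergent sequences of copies\<close>

lemma partitionableI:
  assumes "\<Union>(S ` A) = topspace X"
    and "\<And>a b. a \<in> A \<Longrightarrow> b \<in> A \<Longrightarrow> a \<noteq> b \<Longrightarrow> S a \<inter> S b = {}"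
    and "\<And>a. a \<in> A \<Longrightarrow> subtopology X (S a) homeomorphic_space Y"
  shows "partitionable X Y"
  unfolding partitionable_def
  by (rule exI[of _ "S ` A"]) (use assms in \<open>auto simp: disjoint_def\<close>)

text \<open>The half 0t is pushed into 01t and the other half is kept, so the range omits exactly
  the cylinder 00. Hence a piece that has given away this cylinder is still a copy.\<close>

definition "shrink_map = (\<lambda>f::nat \<Rightarrow> bool. if f 0 then f else
  case_nat False (case_nat True (\<lambda>m. f (Suc m))))"

lemma cantor_map_shrink:
  assumes "cantor_map X h"
  shows "cantor_map X (h \<circ> shrink_map)"
proof -
  have "f = g" if "shrink_map f = shrink_map g" for f g
  proof (rule ext)
    fix m
    have a: "f 0 \<longleftrightarrow> g 0" using fun_cong[OF that, of 0] by (auto simp: shrink_map_def split: if_splits)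
    show "f m = g m"
    proof (cases "f 0")
      case True
      then show ?thesis using a fun_cong[OF that, of m] by (simp add: shrink_map_def)
    next
      case False
      then show ?thesis using a fun_cong[OF that, of "Suc m"]
        by (cases m) (auto simp: shrink_map_def)
    qed
  qed
  then have "inj shrink_map" by (simp add: injI)
  moreover have "\<exists>n. \<forall>g. (\<forall>m<n. g m = f m) \<longrightarrow> (h \<circ> shrink_map) g \<in> U"
    if U: "openin X U" "(h \<circ> shrink_map) f \<in> U" for U f
  proof -
    obtain n where n: "\<And>g. (\<forall>m<n. g m = shrink_map f m) \<Longrightarrow> h g \<in> U"
      using cantor_mapD(3)[OF assms, of U "shrink_map f"] U by auto
    have sh: "shrink_map g m = shrink_map f m" if "\<forall>m<Suc n. g m = f m" "m < n" for g m
      using that by (auto simp: shrink_map_def split: nat.splits)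
    have "(h \<circ> shrink_map) g \<in> U" if "\<forall>m<Suc n. g m = f m" for g
      unfolding o_def by (rule n) (use sh that in blast)
    then show ?thesis by (intro exI[of _ "Suc n"]) simp
  qed
  moreover have "range (h \<circ> shrink_map) \<subseteq> topspace X"
    using cantor_mapD(2)[OF assms] by auto
  moreover have "inj (h \<circ> shrink_map)"
    using cantor_mapD(1)[OF assms] \<open>inj shrink_map\<close> by (rule inj_compose)
  ultimately show ?thesis
    unfolding cantor_map_def by simp
qed

text \<open>
  Inserting a point \<open>x\<close> into the copy \<open>N 0\<close> of the Cantor space: the points
  \<open>0 1\<^sup>n 0 t\<close> with \<open>n \<ge> 1\<close> are sent into \<open>N n\<close>, and \<open>0 1\<^sup>\<omega>\<close> is sent to \<open>x\<close>.
\<close>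

definition absorb_map :: "'a \<Rightarrow> (nat \<Rightarrow> (nat \<Rightarrow> bool) \<Rightarrow> 'a) \<Rightarrow> (nat \<Rightarrow> bool) \<Rightarrow> 'a" where
  "absorb_map x N f =
     (if f 0 then N 0 f
      else if \<forall>n. f (Suc n) then x
      else let n = (LEAST n. \<not> f (Suc n)); t = (\<lambda>m. f (Suc (Suc (n + m))))
           in if n = 0 then N 0 (case_nat False t) else N n (case_nat False (case_nat False t)))"

text \<open>The point 0 1^n 0 t of the description above.\<close>

definition "ones_block n t = case_nat False (\<lambda>m. m < n \<or> (m > n \<and> t (m - Suc n)))"

lemma ones_block_simps [simp]: "ones_block n t 0 = False"
  "ones_block n t (Suc m) \<longleftrightarrow> m < n \<or> (m > n \<and> t (m - Suc n))"
  by (auto simp: ones_block_def)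

lemma cantor_cases:
  obtains "f (0::nat)" | "f = case_nat False (\<lambda>_. True)" | n t where "f = ones_block n t"
proof -
  consider "f 0" | "\<not> f 0" "\<forall>n. f (Suc n)" | "\<not> f 0" "\<exists>n. \<not> f (Suc n)" by blast
  then show thesis
  proof cases
    case 2
    then have "f = case_nat False (\<lambda>_. True)" by (auto simp: fun_eq_iff split: nat.splits)
    then show ?thesis using that by blast
  next
    case 3
    define n where "n = (LEAST n. \<not> f (Suc n))"
    have n: "\<not> f (Suc n)" unfolding n_def using 3(2) by (metis (mono_tags, lifting) LeastI)
    have l: "f (Suc m)" if "m < n" for m using not_less_Least that unfolding n_def by blast
    have "f m = ones_block n (\<lambda>m. f (Suc (Suc (n + m)))) m" for m
    proof (cases m)
      case 0 then show ?thesis using 3 by simp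
    next
      case (Suc k)
      show ?thesis
      proof (cases "k < n")
        case True then show ?thesis using Suc l by simp
      next
        case False
        then show ?thesis using Suc n by (cases "k = n") auto
      qed
    qed
    then show ?thesis using that by blast
  qed (use that in blast)
qed

lemma absorb_map_simps:
  "f 0 \<Longrightarrow> absorb_map x N f = N 0 f"
  "absorb_map x N (case_nat False (\<lambda>_. True)) = x"
  "absorb_map x N (ones_block 0 t) = N 0 (case_nat False t)"
  "0 < n \<Longrightarrow> absorb_map x N (ones_block n t) = N n (case_nat False (case_nat False t))"
proof -
  have "(LEAST k. \<not> ones_block n t (Suc k)) = n" for n t
    by (rule Least_equality) (auto simp: not_less)
  moreover have "\<not> (\<forall>k. ones_block n t (Suc k))" for n t by auto
  ultimately show "absorb_map x N (ones_block 0 t) = N 0 (case_nat False t)"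
    "0 < n \<Longrightarrow> absorb_map x N (ones_block n t) = N n (case_nat False (case_nat False t))"
    unfolding absorb_map_def Let_def by auto
qed (auto simp: absorb_map_def)

lemma ones_block_0: "ones_block 0 t = case_nat False (case_nat False t)"
  by (auto simp: fun_eq_iff split: nat.splits)

text \<open>Continuity at 0 1^omega is the convergence of the copies to \<open>x\<close>; near any
  other point the map is some \<open>N n\<close> with the prefix changed. It is injective since all
  of \<open>N 0\<close> is used once, and of the later \<open>N n\<close> the cylinder 00.\<close>

lemma cantor_map_absorb:
  assumes N: "\<And>n. cantor_map X (N n)"
    and disj: "\<And>m n. m \<noteq> n \<Longrightarrow> range (N m) \<inter> range (N n) = {}"
    and x: "x \<in> topspace X" "\<And>n. x \<notin> range (N n)"
    and lim: "\<And>U. openin X U \<Longrightarrow> x \<in> U \<Longrightarrow> \<exists>k. \<forall>n\<ge>k. range (N n) \<subseteq> U"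
  shows "cantor_map X (absorb_map x N)"
  unfolding cantor_map_def
proof (intro conjI allI impI)
  \<comment> \<open>The prefix under which \<open>t\<close> is stored: \<open>N 0\<close> uses its
    whole half 0, the other copies give away only their quarter 00.\<close>
  define p where "p n = (if n = 0 then case_nat False else (\<lambda>t. case_nat False (case_nat False t)))" for n :: nat
  have p: "absorb_map x N (ones_block n s) = N n (p n s)" for n s
    by (simp add: p_def absorb_map_simps)
  have p0: "\<not> p n t 0" for n t by (simp add: p_def)
  have pinj: "s = t" if "p n s = p n t" for n s t
  proof (rule ext)
    fix m show "s m = t m"
      using fun_cong[OF that, of "if n = 0 then Suc m else Suc (Suc m)"] by (simp add: p_def split: if_splits)
  qed
  have inj: "s = t" if "N n s = N n t" for n s t
    using cantor_mapD(1)[OF N[of n]] that by (simp add: inj_eq)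
  have ne: "m = n" if "N m s = N n t" for m n s t
    using disj[of m n] rangeI[of "N m" s] rangeI[of "N n" t] that by auto
  have nx: "N n s \<noteq> x" "x \<noteq> N n s" for n s using x(2) by (metis rangeI)+
  show "inj (absorb_map x N)"
  proof (rule injI)
    fix f g assume eq: "absorb_map x N f = absorb_map x N g"
    \<comment> \<open>Points with first bit \<open>True\<close> go to the half 1 of
      \<open>N 0\<close>, whereas \<open>p n t\<close> always lies in the half 0.\<close>
    have one: "\<not> absorb_map x N f = N n (p n t)" if "f 0" for f n t
    proof
      assume "absorb_map x N f = N n (p n t)"
      then have e: "N 0 f = N n (p n t)" using that by (simp add: absorb_map_simps)
      then have "n = 0" using ne by metis
      then have "f = p n t" using e inj by metis
      then show False using p0 that by metis
    qed
    show "f = g"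
    proof (cases rule: cantor_cases[of f])
      case f: 1
      show ?thesis
      proof (cases rule: cantor_cases[of g])
        case 1 then show ?thesis using f eq inj by (metis absorb_map_simps(1))
      next
        case 2 then show ?thesis using f eq nx by (metis absorb_map_simps(1,2))
      next
        case (3 n t) then show ?thesis using one[of f] f eq p by metis
      qed
    next
      case f: 2
      show ?thesis
      proof (cases rule: cantor_cases[of g])
        case 1 then show ?thesis using f eq nx by (metis absorb_map_simps(1,2))
      next
        case 2 then show ?thesis using f by simp
      next
        case (3 n t) then show ?thesis using f eq p nx by (metis absorb_map_simps(2))
      qed
    next
      case f: (3 n t)
      show ?thesis
      proof (cases rule: cantor_cases[of g])
        case 1 then show ?thesis using one f eq p by metis
      next
        case 2 then show ?thesis using f eq p nx by (metis absorb_map_simps(2))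
      next
        case (3 n' t')
        then have e: "N n (p n t) = N n' (p n' t')" using f eq p by metis
        then have "n = n'" using ne by metis
        moreover have "t = t'" using e inj pinj calculation by metis
        ultimately show ?thesis using f 3 by simp
      qed
    qed
  qed
  show "range (absorb_map x N) \<subseteq> topspace X"
    using x(1) cantor_mapD(2)[OF N] by (auto simp: absorb_map_def Let_def)
  fix U f assume U: "openin X U \<and> absorb_map x N f \<in> U"
  show "\<exists>n. \<forall>g. (\<forall>m<n. g m = f m) \<longrightarrow> absorb_map x N g \<in> U"
  proof (cases rule: cantor_cases[of f])
    case 1
    then obtain n where n: "\<And>g. (\<forall>m<n. g m = f m) \<Longrightarrow> N 0 g \<in> U"
      using cantor_mapD(3)[OF N, of U 0 f] U by (auto simp: absorb_map_simps)
    have "absorb_map x N g \<in> U" if "\<forall>m<Suc n. g m = f m" for g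
      using n[of g] that 1 by (auto simp: absorb_map_simps)
    then show ?thesis by blast
  next
    case 2
    then have "x \<in> U" using U by (simp add: absorb_map_simps)
    then obtain k where "\<forall>n\<ge>k. range (N n) \<subseteq> U" using lim U by blast
    then have k: "n \<ge> k \<Longrightarrow> range (N n) \<subseteq> U" for n by blast
    \<comment> \<open>Agreement with 0 1^omega on \<open>k + 3\<close> bits forces a block of at
      least \<open>k + 2\<close> ones, hence an index that is positive and beyond
      \<open>k\<close>.\<close>
    have "absorb_map x N g \<in> U" if g: "\<forall>m<k+3. g m = f m" for g
    proof (cases rule: cantor_cases[of g])
      case 1
      then show ?thesis using g[rule_format, of 0] 2 by simp
    next
      case c: 2
      then show ?thesis using U 2 by simp
    next
      case (3 n t)
      have "n \<ge> k + 2"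
      proof (rule ccontr)
        assume "\<not> n \<ge> k + 2"
        then show False using g[rule_format, of "Suc n"] 3 2 by simp
      qed
      then show ?thesis using 3 k[of n] by (auto simp: absorb_map_simps)
    qed
    then show ?thesis by blast
  next
    case (3 n t)
    obtain k where k: "\<And>g. (\<forall>m<k. g m = p n t m) \<Longrightarrow> N n g \<in> U"
      using cantor_mapD(3)[OF N, of U n "p n t"] U 3 p by auto
    \<comment> \<open>The prefix 0 1^n 0 takes \<open>n + 2\<close> bits; what remains fixes at
      least \<open>k\<close> bits of \<open>t\<close>.\<close>
    have "absorb_map x N g \<in> U" if g: "\<forall>m<n+k+3. g m = f m" for g
    proof (cases rule: cantor_cases[of g])
      case 1
      then show ?thesis using g[rule_format, of 0] 3 by simp
    next
      case 2
      then show ?thesis using g[rule_format, of "Suc n"] 3 by simp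
    next
      case g3: (3 n' t')
      have "n' = n"
      proof (rule ccontr)
        assume "n' \<noteq> n"
        then consider "n' < n" | "n < n'" by linarith
        then show False
        proof cases
          case 1 then show False using g[rule_format, of "Suc n'"] 3 g3 by simp
        next
          case 2 then show False using g[rule_format, of "Suc n"] 3 g3 by simp
        qed
      qed
      have "t' m = t m" if "m < k" for m
        using g[rule_format, of "Suc (Suc n + m)"] that 3 g3 \<open>n' = n\<close> by simp
      then have "p n t' m = p n t m" if "m < k" for m
        using that by (auto simp: p_def split: nat.splits)
      then show ?thesis using k[of "p n t'"] g3 \<open>n' = n\<close> p by simp
    qed
    then show ?thesis by blast
  qed
qed


text \<open>Membership depends only on the tail. The instances are the whole space and
  \<open>many_ones\<close>.\<close>

definition tail_set :: "(nat \<Rightarrow> bool) set \<Rightarrow> bool" where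
  "tail_set R \<longleftrightarrow> (\<forall>b f. case_nat b f \<in> R \<longleftrightarrow> f \<in> R)"

lemma tail_set_ones_block: "tail_set R \<Longrightarrow> ones_block n t \<in> R \<longleftrightarrow> t \<in> R"
proof (induction n arbitrary: t)
  case 0
  then show ?case by (simp add: ones_block_0 tail_set_def)
next
  case (Suc n)
  have "ones_block (Suc n) t = case_nat False (case_nat True (\<lambda>m. ones_block n t (Suc m)))"
    by (auto simp: fun_eq_iff split: nat.splits)
  moreover have "ones_block n t = case_nat False (\<lambda>m. ones_block n t (Suc m))"
    by (auto simp: fun_eq_iff split: nat.splits)
  ultimately show ?case using Suc by (metis tail_set_def)
qed

text \<open>
  The leftover points \<open>E\<close> of a family of disjoint copies \<open>N i\<close> of the Cantor space can be
  absorbed, if each of them is the limit of a sequence of copies of its own: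
  the copy \<open>J (x, 0)\<close> receives \<open>x\<close> together with a part of each \<open>J (x, n)\<close>, whose
  remainder is still homeomorphic to \<open>T\<close>.
\<close>

lemma partitionable_absorb:
  fixes X :: "'a topology" and N :: "'i \<Rightarrow> (nat \<Rightarrow> bool) \<Rightarrow> 'a" and J :: "'a \<times> nat \<Rightarrow> 'i"
  defines "E \<equiv> \<lambda>I T. topspace X - (\<Union>i\<in>I. N i ` T)"
  assumes X: "Hausdorff_space X"
    and N: "\<And>i. i \<in> I \<Longrightarrow> cantor_map X (N i)"
    and disj: "\<And>i j. i \<in> I \<Longrightarrow> j \<in> I \<Longrightarrow> i \<noteq> j \<Longrightarrow> range (N i) \<inter> range (N j) = {}"
    and R: "tail_set R" "(\<lambda>_. True) \<in> R"
    and T: "\<And>f. case_nat False f \<in> T \<longleftrightarrow> f \<in> R"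
    and J: "inj_on J (E I T \<times> UNIV)" "J ` (E I T \<times> UNIV) \<subseteq> I"
    and nx: "\<And>x n. x \<in> E I T \<Longrightarrow> x \<notin> range (N (J (x, n)))"
    and lim: "\<And>x U. x \<in> E I T \<Longrightarrow> openin X U \<Longrightarrow> x \<in> U \<Longrightarrow> \<exists>k. \<forall>n\<ge>k. range (N (J (x, n))) \<subseteq> U"
  shows "partitionable X (subtopology cantor_space T)"
proof -
  define F where "F = E I T"
  \<comment> \<open>\<open>P\<close> is the cylinder 00, which \<open>J (x, n)\<close> cedes to
    \<open>x\<close> for \<open>n > 0\<close>. The copies in \<open>L\<close> vanish into some
    \<open>A x\<close>, those in \<open>Q\<close> lose \<open>P\<close>.\<close>
  define P where "P = {f. \<not> f 0 \<and> \<not> f (Suc (0::nat))}"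
  define A where "A x = absorb_map x (\<lambda>n. N (J (x, n)))" for x
  define L where "L = J ` (F \<times> {0})"
  define Q where "Q = J ` (F \<times> {0<..})"
  have JI: "J (x, n) \<in> I" if "x \<in> F" for x n using J(2) that by (auto simp: F_def)
  have Jinj: "J (x, m) = J (y, n) \<longleftrightarrow> x = y \<and> m = n" if "x \<in> F" "y \<in> F" for x y m n
    using inj_on_eq_iff[OF J(1), of "(x, m)" "(y, n)"] that by (auto simp: F_def)
  have FX: "x \<in> topspace X" if "x \<in> F" for x using that by (auto simp: F_def E_def)
  have FN: "x \<noteq> N i t" "N i t \<noteq> x" if "x \<in> F" "i \<in> I" "t \<in> T" for x i t
    using that by (auto simp: F_def E_def)
  have Neq: "N i s = N j t \<longleftrightarrow> i = j \<and> s = t" if "i \<in> I" "j \<in> I" for i j s t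
  proof
    assume e: "N i s = N j t"
    then have "range (N i) \<inter> range (N j) \<noteq> {}" by (metis disjoint_iff rangeI)
    then have "i = j" using disj that by blast
    then show "i = j \<and> s = t" using e cantor_mapD(1)[OF N[OF that(1)]] by (simp add: inj_eq)
  qed simp
  have cA: "cantor_map X (A x)" if "x \<in> F" for x
    unfolding A_def
  proof (rule cantor_map_absorb)
    show "cantor_map X (N (J (x, n)))" for n using N JI that by blast
    show "range (N (J (x, m))) \<inter> range (N (J (x, n))) = {}" if "m \<noteq> n" for m n
      using disj[OF JI JI] Jinj \<open>x \<in> F\<close> that by simp
    show "x \<in> topspace X" using FX that .
    show "x \<notin> range (N (J (x, n)))" for n using nx that by (auto simp: F_def)
    show "\<exists>k. \<forall>n\<ge>k. range (N (J (x, n))) \<subseteq> U" if "openin X U" "x \<in> U" for U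
      using lim \<open>x \<in> F\<close> that by (auto simp: F_def)
  qed
  have TP: "case_nat False (case_nat False t) \<in> T \<longleftrightarrow> t \<in> R" for t
    using T R(1) by (simp add: tail_set_def)
  have TB: "ones_block n t \<in> T \<longleftrightarrow> t \<in> R" for n t
  proof -
    have "ones_block n t = case_nat False (\<lambda>m. ones_block n t (Suc m))"
      by (auto simp: fun_eq_iff split: nat.splits)
    then show ?thesis using T R(1) tail_set_ones_block[OF R(1)] by (metis tail_set_def)
  qed
  \<comment> \<open>The constant sequence \<open>True\<close> lies in \<open>R\<close>, and this
    puts \<open>x\<close> itself into the new copy.\<close>
  have T1: "case_nat False (\<lambda>_. True) \<in> T" using T R(2) by simp
  have AT: "A x ` T = insert x (N (J (x, 0)) ` T \<union> (\<Union>n\<in>{0<..}. N (J (x, n)) ` (T \<inter> P)))" for x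
  proof (intro equalityI subsetI)
    fix p assume "p \<in> A x ` T"
    then obtain f where f: "f \<in> T" "p = A x f" by blast
    show "p \<in> insert x (N (J (x, 0)) ` T \<union> (\<Union>n\<in>{0<..}. N (J (x, n)) ` (T \<inter> P)))"
    proof (cases rule: cantor_cases[of f])
      case 1
      then show ?thesis using f by (simp add: A_def absorb_map_simps)
    next
      case 2
      then show ?thesis using f by (simp add: A_def absorb_map_simps)
    next
      case (3 n t)
      then have t: "t \<in> R" using f TB by simp
      show ?thesis
      proof (cases "n = 0")
        case True
        then have "p = N (J (x, 0)) (case_nat False t)" using f 3 by (simp add: A_def absorb_map_simps)
        then show ?thesis using T t by blast
      next
        case False
        then have "p = N (J (x, n)) (case_nat False (case_nat False t))"
          using f 3 by (simp add: A_def absorb_map_simps)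
        moreover have "case_nat False (case_nat False t) \<in> T \<inter> P" using TP t by (simp add: P_def)
        ultimately show ?thesis using False by blast
      qed
    qed
  next
    fix p assume "p \<in> insert x (N (J (x, 0)) ` T \<union> (\<Union>n\<in>{0<..}. N (J (x, n)) ` (T \<inter> P)))"
    then consider "p = x" | f where "f \<in> T" "p = N (J (x, 0)) f"
      | n f where "n > 0" "f \<in> T" "f \<in> P" "p = N (J (x, n)) f" by blast
    then show "p \<in> A x ` T"
    proof cases
      case 1
      then have "p = A x (case_nat False (\<lambda>_. True))" by (simp add: A_def absorb_map_simps)
      then show ?thesis using T1 by blast
    next
      case 2
      show ?thesis
      proof (cases "f 0")
        case True
        then have "p = A x f" using 2 by (simp add: A_def absorb_map_simps)
        then show ?thesis using 2 by blast
      next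
        case False
        define t where "t = (\<lambda>m. f (Suc m))"
        have f: "f = case_nat False t" using False by (auto simp: t_def fun_eq_iff split: nat.splits)
        then have "t \<in> R" using T 2 by metis
        then have "ones_block 0 t \<in> T" using TB by simp
        moreover have "p = A x (ones_block 0 t)" using 2 f by (simp add: A_def absorb_map_simps)
        ultimately show ?thesis by blast
      qed
    next
      case 3
      define t where "t = (\<lambda>m. f (Suc (Suc m)))"
      have f: "f = case_nat False (case_nat False t)"
        using 3(3) by (auto simp: t_def P_def fun_eq_iff split: nat.splits)
      then have "t \<in> R" using TP 3 by metis
      then have "ones_block n t \<in> T" using TB by simp
      moreover have "p = A x (ones_block n t)" using 3 f by (simp add: A_def absorb_map_simps)
      ultimately show ?thesis by blast
    qed
  qed
  \<comment> \<open>Tail invariance of \<open>R\<close> puts 0t and 01t into \<open>T\<close>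
    together, so that shrinking respects \<open>T\<close>.\<close>
  have shT: "shrink_map ` T = T - P"
  proof (intro equalityI subsetI)
    fix f assume "f \<in> shrink_map ` T"
    then obtain g where g: "g \<in> T" "f = shrink_map g" by blast
    show "f \<in> T - P"
    proof (cases "g 0")
      case True
      then show ?thesis using g by (simp add: shrink_map_def P_def)
    next
      case False
      define t where "t = (\<lambda>m. g (Suc m))"
      have "g = case_nat False t" using False by (auto simp: t_def fun_eq_iff split: nat.splits)
      then have "t \<in> R" using T g by metis
      then have "case_nat False (case_nat True t) \<in> T" using T R(1) by (simp add: tail_set_def)
      moreover have "f = case_nat False (case_nat True t)" using g False by (simp add: shrink_map_def t_def)
      ultimately show ?thesis by (simp add: P_def)
    qed
  next
    fix f assume f: "f \<in> T - P"
    show "f \<in> shrink_map ` T"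
    proof (cases "f 0")
      case True
      then have "f = shrink_map f" by (simp add: shrink_map_def)
      then show ?thesis using f by blast
    next
      case False
      define t where "t = (\<lambda>m. f (Suc (Suc m)))"
      have e: "f = case_nat False (case_nat True t)"
        using f False by (auto simp: t_def P_def fun_eq_iff split: nat.splits)
      then have "case_nat True t \<in> R" using T f by (metis DiffD1)
      then have "case_nat False t \<in> T" using T R(1) by (simp add: tail_set_def)
      moreover have "f = shrink_map (case_nat False t)" using e by (simp add: shrink_map_def)
      ultimately show ?thesis by blast
    qed
  qed
  \<comment> \<open>A member of the partition is either the copy built around a leftover point
    (\<open>Inl\<close>) or an old piece, diminished by \<open>P\<close> if its index lies in
    \<open>Q\<close> (\<open>Inr\<close>).\<close>
  define S where "S = case_sum (\<lambda>x. A x ` T) (\<lambda>i. N i ` (if i \<in> Q then T - P else T))"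
  have SL: "p \<in> S (Inl x) \<longleftrightarrow> p = x \<or> (\<exists>t\<in>T. p = N (J (x, 0)) t) \<or> (\<exists>n>0. \<exists>t\<in>T \<inter> P. p = N (J (x, n)) t)" for p x
    unfolding S_def sum.case AT by blast
  have SR: "p \<in> S (Inr i) \<longleftrightarrow> (\<exists>t\<in>T. (i \<in> Q \<longrightarrow> t \<notin> P) \<and> p = N i t)" for p i
    unfolding S_def sum.case by auto
  have iQ: "J (x, n) \<in> Q \<longleftrightarrow> n > 0" if "x \<in> F" for x n
    using that Jinj by (auto simp: Q_def)
  have IQ: "i \<in> Q \<Longrightarrow> \<exists>x n. x \<in> F \<and> n > 0 \<and> i = J (x, n)" for i by (auto simp: Q_def)
  have cov: "\<Union>(S ` (Inl ` F \<union> Inr ` (I - L))) = topspace X"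
  proof (intro equalityI subsetI)
    fix p assume "p \<in> \<Union>(S ` (Inl ` F \<union> Inr ` (I - L)))"
    then show "p \<in> topspace X"
      using FX JI cantor_mapD(2)[OF N] by (auto simp: SL SR)
  next
    fix p assume p: "p \<in> topspace X"
    show "p \<in> \<Union>(S ` (Inl ` F \<union> Inr ` (I - L)))"
    proof (cases "p \<in> F")
      case True
      then have "p \<in> S (Inl p)" by (simp add: SL)
      then show ?thesis using True by blast
    next
      case False
      then obtain i t where i: "i \<in> I" "t \<in> T" "p = N i t" using p by (auto simp: F_def E_def)
      consider "i \<in> L" | "i \<notin> L" "i \<in> Q" "t \<in> P" | "i \<notin> L" "i \<in> Q \<longrightarrow> t \<notin> P" by blast
      then show ?thesis
      proof cases
        case 1
        then obtain x where "x \<in> F" "i = J (x, 0)" by (auto simp: L_def)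
        then have "p \<in> S (Inl x)" using i by (auto simp: SL)
        then show ?thesis using \<open>x \<in> F\<close> by blast
      next
        case 2
        then obtain x n where "x \<in> F" "n > 0" "i = J (x, n)" using IQ by blast
        then have "p \<in> S (Inl x)" using i 2 by (auto simp: SL)
        then show ?thesis using \<open>x \<in> F\<close> by blast
      next
        case 3
        then have "p \<in> S (Inr i)" using i by (auto simp: SR)
        then show ?thesis using i 3 by blast
      qed
    qed
  qed
  have d1: "x = y" if xy: "x \<in> F" "y \<in> F" and p: "p \<in> S (Inl x)" "p \<in> S (Inl y)" for x y p
  proof -
    have c: "p = z \<or> (\<exists>n. \<exists>t\<in>T. p = N (J (z, n)) t)" if "p \<in> S (Inl z)" for z
      using that unfolding SL by blast
    show ?thesis
      using c[OF p(1)] c[OF p(2)] xy FN JI Neq Jinj by metis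
  qed
  have d2: False if h: "x \<in> F" "i \<in> I - L" "p \<in> S (Inl x)" "p \<in> S (Inr i)" for x i p
  proof -
    obtain t where t: "t \<in> T" "i \<in> Q \<longrightarrow> t \<notin> P" "p = N i t" using h(4) unfolding SR by blast
    consider "p = x" | s where "s \<in> T" "p = N (J (x, 0)) s" | n s where "n > 0" "s \<in> T \<inter> P" "p = N (J (x, n)) s"
      using h(3) unfolding SL by blast
    then show False
    proof cases
      case 1 then show False using FN h t by blast
    next
      case 2 then show False using Neq[of i "J (x, 0)" t s] JI h t by (auto simp: L_def)
    next
      case 3 then show False using Neq[of i "J (x, n)" t s] JI[of x n] h t iQ by auto
    qed
  qed
  have d3: "i = j" if "i \<in> I" "j \<in> I" "p \<in> S (Inr i)" "p \<in> S (Inr j)" for i j p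
    using that Neq unfolding SR by metis
  show ?thesis
  proof (rule partitionableI[OF cov])
    fix a b assume a: "a \<in> Inl ` F \<union> Inr ` (I - L)" and b: "b \<in> Inl ` F \<union> Inr ` (I - L)"
      and ab: "a \<noteq> b"
    have False if p: "p \<in> S a" "p \<in> S b" for p
      using a
    proof (elim UnE imageE)
      fix x assume x: "a = Inl x" "x \<in> F"
      show False
        using b
      proof (elim UnE imageE)
        fix y assume "b = Inl y" "y \<in> F"
        then show False using d1[of x y p] p x ab by simp
      next
        fix i assume "b = Inr i" "i \<in> I - L"
        then show False using d2[of x i p] p x by simp
      qed
    next
      fix i assume i: "a = Inr i" "i \<in> I - L"
      show False
        using b
      proof (elim UnE imageE)
        fix y assume "b = Inl y" "y \<in> F"
        then show False using d2[of y i p] p i by simp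
      next
        fix j assume "b = Inr j" "j \<in> I - L"
        then show False using d3[of i j p] p i ab by simp
      qed
    qed
    then show "S a \<inter> S b = {}" by blast
  next
    fix a assume a: "a \<in> Inl ` F \<union> Inr ` (I - L)"
    have "\<exists>h. cantor_map X h \<and> S a = h ` T"
    proof (cases a)
      case (Inl x)
      then show ?thesis using a cA[of x] by (auto simp: S_def)
    next
      case (Inr i)
      then have i: "i \<in> I" using a by auto
      show ?thesis
      proof (cases "i \<in> Q")
        case True
        then have "S a = N i ` (shrink_map ` T)" using Inr by (simp add: S_def shT)
        then have "S a = (N i \<circ> shrink_map) ` T" by (simp only: image_comp)
        then show ?thesis using cantor_map_shrink[OF N[OF i]] by blast
      next
        case False
        then have "S a = N i ` T" using Inr by (simp add: S_def)
        then show ?thesis using N[OF i] by blast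
      qed
    qed
    then obtain h where h: "cantor_map X h" "S a = h ` T" by blast
    show "subtopology X (S a) homeomorphic_space subtopology cantor_space T"
      unfolding h(2) by (rule cantor_map_homeomorphic_space[OF X h(1)])
  qed
qed

abbreviation cantor_set :: "(nat \<Rightarrow> bool) set" ("\<CC>") where
  "\<CC> \<equiv> UNIV"

subsection \<open>Cutting copies of the Cantor space into pieces\<close>

text \<open>Recursion along a well-order of \<open>I\<close> of least type: before each step fewer
  than \<open>|I|\<close> values are in use, so \<open>A i\<close> still has a fresh one.\<close>

lemma injective_choice:
  fixes A :: "'i \<Rightarrow> 'b set"
  assumes "\<And>i. i \<in> I \<Longrightarrow> |I| \<le>o |A i|"
  shows "\<exists>f. inj_on f I \<and> (\<forall>i\<in>I. f i \<in> A i)"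
proof -
  let ?r = "|I|"
  have wo: "Well_order ?r" by (rule card_of_Well_order)
  have lin: "Total ?r" "wf (?r - Id)" "antisym ?r" "Field ?r = I"
    using wo by (auto simp: well_order_on_def linear_order_on_def partial_order_on_def Field_card_of)
  define P where "P f x y \<longleftrightarrow> (x \<in> I \<longrightarrow> y \<in> A x \<and> y \<notin> f ` underS ?r x)" for f :: "'i \<Rightarrow> 'b" and x y
  have "\<exists>f. \<forall>x. P f x (f x)"
  proof (rule dependent_wf_choice[OF lin(2)])
    fix f g :: "'i \<Rightarrow> 'b" and x y assume fg: "\<And>z. (z, x) \<in> ?r - Id \<Longrightarrow> f z = g z"
    have "f ` underS ?r x = g ` underS ?r x"
      by (rule image_cong) (use fg in \<open>auto simp: underS_def\<close>)
    then show "P f x y = P g x y" by (simp add: P_def)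
  next
    fix x and f :: "'i \<Rightarrow> 'b"
    show "\<exists>y. P f x y"
    proof (cases "x \<in> I")
      case True
      have "|f ` underS ?r x| \<le>o |underS ?r x|" by (rule card_of_image)
      moreover have "|underS ?r x| <o ?r"
        by (rule card_of_underS) (use True in \<open>auto simp: card_of_card_order_on Field_card_of\<close>)
      ultimately have "|f ` underS ?r x| <o |A x|"
        using assms[OF True] ordLeq_ordLess_trans ordLess_ordLeq_trans by blast
      then have "\<not> A x \<subseteq> f ` underS ?r x"
        using card_of_mono1 not_ordLess_ordLeq by blast
      then show ?thesis by (auto simp: P_def)
    qed (simp add: P_def)
  qed
  then obtain f where f: "\<And>x. x \<in> I \<Longrightarrow> f x \<in> A x \<and> f x \<notin> f ` underS ?r x"
    by (auto simp: P_def)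
  have "inj_on f I"
  proof (rule inj_onI, rule ccontr)
    fix x y assume xy: "x \<in> I" "y \<in> I" "f x = f y" "x \<noteq> y"
    then have "x \<in> underS ?r y \<or> y \<in> underS ?r x"
      using lin(1,4) by (auto simp: total_on_def underS_def)
    then show False using f xy by (metis imageI)
  qed
  then show ?thesis using f by blast
qed

lemma not_card_le_iff_less: "\<not> |A| \<le>o |B| \<longleftrightarrow> |B| <o |A|"
  by (rule not_ordLeq_iff_ordLess[OF card_of_Well_order card_of_Well_order])

lemma not_card_less_iff_le: "\<not> |A| <o |B| \<longleftrightarrow> |B| \<le>o |A|"
  by (rule not_ordLess_iff_ordLeq[OF card_of_Well_order card_of_Well_order])

lemma continuum_eq: "continuum = |\<CC>|"
  by (simp add: cexp_def ctwo_def Field_card_of Field_natLeq Func_def)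

lemma infinite_cantor_set: "infinite \<CC>"
proof -
  have "inj (\<lambda>n m::nat. m = n)" by (auto simp: inj_def fun_eq_iff)
  then show ?thesis by (metis infinite_UNIV_nat finite_imageD finite_subset subset_UNIV)
qed

lemma nat_le_cantor_set: "|UNIV :: nat set| \<le>o |\<CC>|"
  using infinite_cantor_set by (simp add: infinite_iff_card_of_nat)

lemma card_Times_le:
  assumes "|A| \<le>o |Z|" "|B| \<le>o |Z|" "infinite Z"
  shows "|A \<times> B| \<le>o |Z|"
  by (rule card_of_Times_ordLeq_infinite_Field[OF _ assms(1,2)])
    (use assms(3) in \<open>simp_all add: card_of_card_order_on Field_card_of\<close>)

lemma card_Union_le:
  assumes "|I| \<le>o |Z|" "\<And>i. i \<in> I \<Longrightarrow> |A i| \<le>o |Z|" "infinite Z"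
  shows "|\<Union>i\<in>I. A i| \<le>o |Z|"
  using card_of_UNION_ordLeq_infinite[OF assms(3,1)] assms(2) by blast

lemma infinite_Times_cantor_set: "M \<noteq> {} \<Longrightarrow> infinite (M \<times> \<CC>)"
  using infinite_cantor_set finite_cartesian_productD2 by blast

lemma cantor_set_le_Times: "M \<noteq> {} \<Longrightarrow> |\<CC>| \<le>o |M \<times> \<CC>|"
  by (rule card_of_Times2)

lemma le_Times_cantor_set: "|M| \<le>o |M \<times> \<CC>|"
  by (rule card_of_Times1) simp

text \<open>Identifies the Cantor space with its square: the even bits will name a fibre, the odd
  bits a point in it.\<close>

definition "weave e c = (\<lambda>m::nat. if even m then e (m div 2) else c (m div 2) :: bool)"

lemma weave_eq_iff: "weave e c = weave e' c' \<longleftrightarrow> e = e' \<and> c = c'"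
proof
  assume w: "weave e c = weave e' c'"
  have "e m = e' m" "c m = c' m" for m
    using fun_cong[OF w, of "2 * m"] fun_cong[OF w, of "Suc (2 * m)"] by (simp_all add: weave_def)
  then show "e = e' \<and> c = c'" by auto
qed simp

lemma weave_surj: "\<exists>e c. f = weave e c"
  by (rule exI[of _ "\<lambda>m. f (2 * m)"], rule exI[of _ "\<lambda>m. f (Suc (2 * m))"])
    (auto simp: weave_def fun_eq_iff elim!: oddE evenE)

text \<open>
  The position of the last one among the even entries determines the label, so that each label is
  taken continuum many times in each cylinder.
\<close>

definition label :: "(nat \<Rightarrow> bool) \<Rightarrow> nat \<times> nat" where
  "label i = prod_decode (fst (prod_decode (Max {p. i (2 * p)})))"

text \<open>In the number decoded by \<open>label\<close> the second component is padding: the value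
  \<open>b\<close> moves the last even one past the first \<open>b\<close> bits without affecting
  the label. The odd bits from there on are free and supply continuum many sequences. Sequences with
  infinitely many even ones get an unspecified label, which does no harm.\<close>

lemma label_dense:
  "\<exists>\<phi>::(nat \<Rightarrow> bool) \<Rightarrow> (nat \<Rightarrow> bool). inj \<phi> \<and> (\<forall>c. (\<forall>m<b. \<phi> c m = i m) \<and> label (\<phi> c) = v)"
proof -
  define p where "p = prod_encode (prod_encode v, b)"
  have pb: "b \<le> p" unfolding p_def by (rule le_prod_encode_2)
  define \<phi> where "\<phi> c m = (if m < b then i m else if even m then m = 2 * p else c (m div 2 - b))" for c m
  have "inj \<phi>"
  proof (rule injI, rule ext)
    fix c d j assume "\<phi> c = \<phi> d"
    then have "\<phi> c (Suc (2 * (b + j))) = \<phi> d (Suc (2 * (b + j)))" by simp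
    then show "c j = d j" by (simp add: \<phi>_def)
  qed
  moreover have "label (\<phi> c) = v" for c
  proof -
    have "Max {q. \<phi> c (2 * q)} = p"
    proof (rule Max_eqI)
      have "{q. \<phi> c (2 * q)} \<subseteq> {..p}" using pb by (auto simp: \<phi>_def split: if_splits)
      then show "finite {q. \<phi> c (2 * q)}" using finite_subset by blast
    qed (use pb in \<open>auto simp: \<phi>_def split: if_splits\<close>)
    then show ?thesis by (simp add: label_def p_def)
  qed
  moreover have "\<forall>m<b. \<phi> c m = i m" for c by (simp add: \<phi>_def)
  ultimately show ?thesis by blast
qed

definition "append_seq s f = (\<lambda>m. if m < length s then s ! m else f (m - length s))"

lemma append_seq_inj: "append_seq s f = append_seq t g \<Longrightarrow> length s = length t \<Longrightarrow> s = t \<and> f = g"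
proof
  assume e: "append_seq s f = append_seq t g" and l: "length s = length t"
  show "s = t"
  proof (rule nth_equalityI[OF l])
    fix m assume "m < length s"
    then show "s ! m = t ! m" using fun_cong[OF e, of m] l by (simp add: append_seq_def)
  qed
  show "f = g"
  proof
    fix m show "f m = g m" using fun_cong[OF e, of "length s + m"] l by (simp add: append_seq_def)
  qed
qed

definition piece :: "('a set \<Rightarrow> (nat \<Rightarrow> bool) \<Rightarrow> 'a) \<Rightarrow> 'a set \<times> (nat \<Rightarrow> bool) \<times> bool list \<Rightarrow> (nat \<Rightarrow> bool) \<Rightarrow> 'a" where
  "piece h = (\<lambda>(M, i, s) f. h M (weave i (append_seq s f)))"

text \<open>The label of a fibre \<open>i\<close> has two roles: its second component is the length
  of the prefixes by which the fibre is cut, which makes the pieces small, and its first component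
  reserves them for one scale. All prefixes of that length occur, so the pieces still exhaust each
  copy.\<close>

definition pieces :: "'a set set \<Rightarrow> ('a set \<times> (nat \<Rightarrow> bool) \<times> bool list) set" where
  "pieces \<M> = {(M, i, s). M \<in> \<M> \<and> length s = snd (label i)}"

locale cantor_family =
  fixes X :: "'a topology" and \<M> :: "'a set set" and h :: "'a set \<Rightarrow> (nat \<Rightarrow> bool) \<Rightarrow> 'a"
  assumes Hausdorff: "Hausdorff_space X"
    and cmap: "\<And>M. M \<in> \<M> \<Longrightarrow> cantor_map X (h M)"
    and range_h: "\<And>M. M \<in> \<M> \<Longrightarrow> range (h M) = M"
    and disjoint: "disjoint \<M>"
begin

lemma piece_eq:
  assumes "\<iota> \<in> pieces \<M>" "\<kappa> \<in> pieces \<M>" "piece h \<iota> f = piece h \<kappa> g"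
  shows "\<iota> = \<kappa> \<and> f = g"
proof -
  obtain M i s where a: "\<iota> = (M, i, s)" "M \<in> \<M>" "length s = snd (label i)"
    using assms(1) by (auto simp: pieces_def)
  obtain N j t where b: "\<kappa> = (N, j, t)" "N \<in> \<M>" "length t = snd (label j)"
    using assms(2) by (auto simp: pieces_def)
  have e: "h M (weave i (append_seq s f)) = h N (weave j (append_seq t g))"
    using assms(3) a b by (simp add: piece_def)
  then have "M \<inter> N \<noteq> {}" using range_h a b by (metis disjoint_iff rangeI)
  then have "M = N" using disjoint a b by (auto simp: disjoint_def)
  then have "weave i (append_seq s f) = weave j (append_seq t g)"
    using e cantor_mapD(1)[OF cmap[OF a(2)]] by (simp add: inj_eq)
  then have "i = j" "append_seq s f = append_seq t g" by (simp_all add: weave_eq_iff)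
  then show ?thesis using append_seq_inj a b \<open>M = N\<close> by metis
qed

lemma cantor_map_piece:
  assumes "\<iota> \<in> pieces \<M>"
  shows "cantor_map X (piece h \<iota>)"
proof -
  obtain M i s where a: "\<iota> = (M, i, s)" "M \<in> \<M>" "length s = snd (label i)"
    using assms(1) by (auto simp: pieces_def)
  show ?thesis
    unfolding cantor_map_def
  proof (intro conjI allI impI)
    show "inj (piece h \<iota>)" using piece_eq[OF assms assms] by (auto simp: inj_def)
    show "range (piece h \<iota>) \<subseteq> topspace X"
      using cantor_mapD(2)[OF cmap[OF a(2)]] by (auto simp: a piece_def)
    fix U f assume U: "openin X U \<and> piece h \<iota> f \<in> U"
    let ?w = "\<lambda>f. weave i (append_seq s f)"
    obtain n where n: "\<forall>g. (\<forall>m<n. g m = ?w f m) \<longrightarrow> h M g \<in> U"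
      using cantor_mapD(3)[OF cmap[OF a(2)], of U "?w f"] U by (auto simp: a piece_def)
    have w: "?w g m = ?w f m" if "\<forall>m<n. g m = f m" "m < n" for g m
    proof -
      have "g (m div 2 - length s) = f (m div 2 - length s)" using that by simp
      then show ?thesis by (simp add: weave_def append_seq_def)
    qed
    have "piece h \<iota> g \<in> U" if "\<forall>m<n. g m = f m" for g
      unfolding a piece_def prod.case by (rule n[rule_format]) (rule w[OF that])
    then have "\<forall>g. (\<forall>m<n. g m = f m) \<longrightarrow> piece h \<iota> g \<in> U" by blast
    then show "\<exists>n. \<forall>g. (\<forall>m<n. g m = f m) \<longrightarrow> piece h \<iota> g \<in> U" ..
  qed
qed

lemma disjoint_piece:
  assumes "\<iota> \<in> pieces \<M>" "\<kappa> \<in> pieces \<M>" "\<iota> \<noteq> \<kappa>"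
  shows "range (piece h \<iota>) \<inter> range (piece h \<kappa>) = {}"
  using piece_eq[OF assms(1,2)] assms(3) by blast

lemma Union_piece: "(\<Union>\<iota>\<in>pieces \<M>. range (piece h \<iota>)) = \<Union>\<M>"
proof (intro equalityI subsetI)
  fix p assume "p \<in> (\<Union>\<iota>\<in>pieces \<M>. range (piece h \<iota>))"
  then obtain M i s f where "M \<in> \<M>" "p = h M (weave i (append_seq s f))"
    by (auto simp: pieces_def piece_def)
  then show "p \<in> \<Union>\<M>" using range_h by blast
next
  fix p assume "p \<in> \<Union>\<M>"
  then obtain M where M: "M \<in> \<M>" "p \<in> range (h M)" using range_h by blast
  then obtain i c where p: "p = h M (weave i c)" using weave_surj by (metis imageE)
  let ?n = "snd (label i)"
  have "c = append_seq (map c [0..<?n]) (\<lambda>m. c (m + ?n))" by (auto simp: append_seq_def fun_eq_iff)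
  then have "p = piece h (M, i, map c [0..<?n]) (\<lambda>m. c (m + ?n))" using p by (simp add: piece_def)
  moreover have "(M, i, map c [0..<?n]) \<in> pieces \<M>" using M by (simp add: pieces_def)
  ultimately show "p \<in> (\<Union>\<iota>\<in>pieces \<M>. range (piece h \<iota>))" by blast
qed

definition pieces_in :: "nat \<Rightarrow> 'a set \<Rightarrow> ('a set \<times> (nat \<Rightarrow> bool) \<times> bool list) set" where
  "pieces_in k U = {\<iota> \<in> pieces \<M>. fst (label (fst (snd \<iota>))) = k \<and> range (piece h \<iota>) \<subseteq> U}"

text \<open>A point of \<open>M\<close> in \<open>U\<close> stays in \<open>U\<close> as long as
  some \<open>b\<close> first bits are kept. Continuum many fibres with label \<open>(k, b)\<close>
  begin with those bits, and each has a piece whose prefix fixes the odd bits as well.\<close>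

lemma card_pieces_in:
  assumes U: "openin X U"
  shows "|{M \<in> \<M>. M \<inter> U \<noteq> {}} \<times> \<CC>| \<le>o |pieces_in k U|"
proof -
  have "\<exists>\<psi> :: (nat \<Rightarrow> bool) \<Rightarrow> _. inj \<psi> \<and> (\<forall>c. \<psi> c \<in> pieces_in k U \<and> fst (\<psi> c) = M)"
    if M: "M \<in> \<M>" "M \<inter> U \<noteq> {}" for M
  proof -
    have "range (h M) \<inter> U \<noteq> {}" using range_h M by simp
    then obtain f where "h M f \<in> U" by blast
    then obtain i d where f: "h M (weave i d) \<in> U" using weave_surj by metis
    obtain b where b: "\<forall>g. (\<forall>m<b. g m = weave i d m) \<longrightarrow> h M g \<in> U"
      using cantor_mapD(3)[OF cmap[OF M(1)] U f] by blast
    obtain \<phi> :: "(nat \<Rightarrow> bool) \<Rightarrow> (nat \<Rightarrow> bool)"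
      where \<phi>: "inj \<phi>" "\<And>c. (\<forall>m<b. \<phi> c m = i m) \<and> label (\<phi> c) = (k, b)"
      using label_dense[of b i "(k, b)"] by blast
    define \<psi> where "\<psi> c = (M, \<phi> c, map d [0..<b])" for c
    have "inj \<psi>" using \<phi>(1) by (auto simp: \<psi>_def inj_def)
    moreover have "\<psi> c \<in> pieces_in k U" for c
    proof -
      have "piece h (\<psi> c) g \<in> U" for g
      proof -
        have "weave (\<phi> c) (append_seq (map d [0..<b]) g) m = weave i d m" if "m < b" for m
          using that \<phi>(2)[of c] by (auto simp: weave_def append_seq_def)
        then show ?thesis unfolding \<psi>_def piece_def prod.case by (intro b[rule_format])
      qed
      then show ?thesis using M(1) \<phi>(2)[of c] by (auto simp: pieces_in_def pieces_def \<psi>_def)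
    qed
    moreover have "fst (\<psi> c) = M" for c by (simp add: \<psi>_def)
    ultimately show ?thesis by (intro exI[of _ \<psi>]) simp
  qed
  then have "\<forall>M\<in>{M \<in> \<M>. M \<inter> U \<noteq> {}}. \<exists>\<psi> :: (nat \<Rightarrow> bool) \<Rightarrow> _.
      inj \<psi> \<and> (\<forall>c. \<psi> c \<in> pieces_in k U \<and> fst (\<psi> c) = M)" by simp
  from bchoice[OF this] obtain \<psi> :: "_ \<Rightarrow> (nat \<Rightarrow> bool) \<Rightarrow> _"
    where \<psi>': "\<forall>M\<in>{M \<in> \<M>. M \<inter> U \<noteq> {}}. inj (\<psi> M) \<and> (\<forall>c. \<psi> M c \<in> pieces_in k U \<and> fst (\<psi> M c) = M)" ..
  then have \<psi>: "inj (\<psi> M) \<and> (\<forall>c. \<psi> M c \<in> pieces_in k U \<and> fst (\<psi> M c) = M)" if "M \<in> \<M>" "M \<inter> U \<noteq> {}" for M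
    using that by simp
  have "inj_on (\<lambda>(M, c). \<psi> M c) ({M \<in> \<M>. M \<inter> U \<noteq> {}} \<times> \<CC>)"
  proof (rule inj_onI, clarify)
    fix M c N d assume h: "M \<in> \<M>" "M \<inter> U \<noteq> {}" "N \<in> \<M>" "N \<inter> U \<noteq> {}" "\<psi> M c = \<psi> N d"
    then have "M = N" using \<psi> by metis
    moreover have "c = d" using \<psi>[OF h(1,2)] h(5) \<open>M = N\<close> by (auto simp: inj_def)
    ultimately show "M = N \<and> c = d" by simp
  qed
  then show ?thesis by (rule card_of_ordLeqI) (use \<psi> in auto)
qed

end

lemma first_countable_decreasing_base:
  assumes "first_countable X" "x \<in> topspace X"
  obtains B :: "nat \<Rightarrow> 'a set" where "\<And>n. openin X (B n)" "\<And>n. x \<in> B n"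
    "\<And>U. openin X U \<Longrightarrow> x \<in> U \<Longrightarrow> \<exists>k. \<forall>n\<ge>k. B n \<subseteq> U"
proof -
  obtain \<B> where B: "countable \<B>" "\<And>V. V \<in> \<B> \<Longrightarrow> openin X V"
     "\<And>U. openin X U \<Longrightarrow> x \<in> U \<Longrightarrow> \<exists>V\<in>\<B>. x \<in> V \<and> V \<subseteq> U"
    using assms unfolding first_countable_def by meson
  define \<C> where "\<C> = {V \<in> \<B>. x \<in> V}"
  have ne: "\<C> \<noteq> {}" using B(3)[of "topspace X"] assms(2) by (auto simp: \<C>_def)
  have co: "countable \<C>" using B(1) by (auto simp: \<C>_def intro: countable_subset)
  define V where "V = from_nat_into \<C>"
  have V: "openin X (V n) \<and> x \<in> V n" for n
    using from_nat_into[OF ne, of n] B(2) by (auto simp: V_def \<C>_def)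
  define W where "W n = (\<Inter>i\<le>n. V i)" for n
  show thesis
  proof (rule that[of W])
    show "openin X (W n)" for n unfolding W_def using V by (intro openin_INT2) auto
    show "x \<in> W n" for n unfolding W_def using V by blast
    fix U assume "openin X U" "x \<in> U"
    then obtain S where "S \<in> \<C>" "S \<subseteq> U" using B(3) by (auto simp: \<C>_def)
    then obtain k where "V k = S" unfolding V_def using from_nat_into_surj[OF co] by metis
    then have "W n \<subseteq> U" if "n \<ge> k" for n using that \<open>S \<subseteq> U\<close> by (auto simp: W_def)
    then show "\<exists>k. \<forall>n\<ge>k. W n \<subseteq> U" by blast
  qed
qed

text \<open>At most continuum many demands \<open>(x, n)\<close> face continuum many pieces each, by
  density and the absence of isolated points; so one injective choice, among the pieces with label
  0, is enough.\<close>

lemma (in cantor_family) partitionable_le_continuum: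
  assumes fc: "first_countable X" and iso: "no_isolated_points X" and card: "|topspace X| \<le>o |\<CC>|"
    and dense: "\<And>U. openin X U \<Longrightarrow> U \<noteq> {} \<Longrightarrow> U \<inter> \<Union>\<M> \<noteq> {}"
    and R: "tail_set R" "(\<lambda>_. True) \<in> R" and T: "\<And>f. case_nat False f \<in> T \<longleftrightarrow> f \<in> R"
  shows "partitionable X (subtopology cantor_space T)"
proof -
  define E where "E = topspace X - (\<Union>\<iota>\<in>pieces \<M>. piece h \<iota> ` T)"
  have "\<exists>B :: nat \<Rightarrow> 'a set. (\<forall>n. openin X (B n) \<and> x \<in> B n) \<and>
      (\<forall>U. openin X U \<longrightarrow> x \<in> U \<longrightarrow> (\<exists>k. \<forall>n\<ge>k. B n \<subseteq> U))" if "x \<in> topspace X" for x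
    using first_countable_decreasing_base[OF fc that] by metis
  then obtain B :: "'a \<Rightarrow> nat \<Rightarrow> 'a set"
    where B: "\<And>x n. x \<in> topspace X \<Longrightarrow> openin X (B x n) \<and> x \<in> B x n"
      "\<And>x U. x \<in> topspace X \<Longrightarrow> openin X U \<Longrightarrow> x \<in> U \<Longrightarrow> \<exists>k. \<forall>n\<ge>k. B x n \<subseteq> U"
    by metis
  \<comment> \<open>The point itself is cut out: if \<open>T\<close> is not the whole space, a
    leftover point may lie inside a piece, and that piece must not be assigned to it.\<close>
  define A where "A = (\<lambda>(x, n). pieces_in 0 (B x n - {x}))"
  have EX: "E \<subseteq> topspace X" by (auto simp: E_def)
  have "|E \<times> (UNIV :: nat set)| \<le>o |\<CC>|"
    by (rule card_Times_le[OF _ nat_le_cantor_set infinite_cantor_set])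
      (rule ordLeq_transitive[OF card_of_mono1[OF EX] card])
  moreover have "|\<CC>| \<le>o |A z|" if "z \<in> E \<times> UNIV" for z
  proof -
    obtain x n where z: "z = (x, n)" "x \<in> topspace X" using \<open>z \<in> _\<close> EX by auto
    let ?U = "B x n - {x}"
    have o: "openin X ?U" using B(1)[OF z(2), of n] Hausdorff z(2)
      by (intro openin_diff) (auto simp: closedin_Hausdorff_singleton)
    moreover have "?U \<noteq> {}"
    proof
      assume "?U = {}"
      then have "B x n = {x}" using B(1)[OF z(2), of n] by blast
      then show False using B(1)[OF z(2), of n] iso z(2) by (auto simp: no_isolated_points_def)
    qed
    ultimately have "{M \<in> \<M>. M \<inter> ?U \<noteq> {}} \<noteq> {}" using dense[of ?U] by blast
    then show ?thesis
      unfolding A_def z using ordLeq_transitive[OF cantor_set_le_Times card_pieces_in[OF o]] by simp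
  qed
  ultimately have "\<exists>J. inj_on J (E \<times> UNIV) \<and> (\<forall>z\<in>E \<times> UNIV. J z \<in> A z)"
    by (intro injective_choice) (metis ordLeq_transitive)
  then obtain J where J: "inj_on J (E \<times> UNIV)" "\<And>x n. x \<in> E \<Longrightarrow> J (x, n) \<in> pieces_in 0 (B x n - {x})"
    by (auto simp: A_def)
  show ?thesis
  proof (rule partitionable_absorb[OF Hausdorff, where I = "pieces \<M>" and N = "piece h" and J = J and R = R];
      (unfold E_def[symmetric])?)
    show "J ` (E \<times> UNIV) \<subseteq> pieces \<M>" using J(2) by (auto simp: pieces_in_def)
    show "x \<notin> range (piece h (J (x, n)))" if "x \<in> E" for x n
      using J(2)[OF that, of n] by (auto simp: pieces_in_def)
    show "\<exists>k. \<forall>n\<ge>k. range (piece h (J (x, n))) \<subseteq> U" if "x \<in> E" "openin X U" "x \<in> U" for x U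
    proof -
      have "x \<in> topspace X" using EX that(1) by blast
      then obtain k where "\<forall>n\<ge>k. B x n \<subseteq> U" using B(2) \<open>openin X U\<close> \<open>x \<in> U\<close> by blast
      moreover have "range (piece h (J (x, n))) \<subseteq> B x n" for n
        using J(2)[OF \<open>x \<in> E\<close>, of n] by (auto simp: pieces_in_def)
      ultimately have "\<forall>n\<ge>k. range (piece h (J (x, n))) \<subseteq> U" by (meson order_trans)
      then show ?thesis ..
    qed
  qed (use cantor_map_piece disjoint_piece J R T in auto)
qed

subsection \<open>Metrizable spaces\<close>

text \<open>The point \<open>x\<close> takes one target at each scale from \<open>k0 x\<close> on,
  at scale \<open>k\<close> among the pieces with label \<open>k\<close> in the ball of radius 2^-k.
  Labels keep the scales apart, so it remains to choose injectively at one scale, for the points of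
  \<open>G k\<close>.\<close>

lemma (in cantor_family) partitionable_metrizable:
  assumes met: "metrizable_space X"
    and dense: "\<And>U. openin X U \<Longrightarrow> U \<noteq> {} \<Longrightarrow> U \<inter> \<Union>\<M> \<noteq> {}"
    and small: "\<And>U. openin X U \<Longrightarrow> |U - \<Union>\<M>| \<le>o |{M \<in> \<M>. M \<inter> U \<noteq> {}} \<times> \<CC>|"
  shows "partitionable X cantor_space"
proof -
  obtain S d where "Metric_space S d" and Xd: "X = Metric_space.mtopology S d"
    using met unfolding metrizable_space_def by blast
  then interpret Metric_space S d by simp
  define E where "E = topspace X - \<Union>\<M>"
  have ES: "x \<in> S" if "x \<in> E" for x using that by (simp add: E_def Xd)
  have ball_open: "openin X (mball x r)" for x r by (simp add: Xd)
  \<comment> \<open>At radius 3 * 2^-k the size of the leftover around \<open>x\<close> is already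
    minimal. With the factor 3 this ball contains the ball of radius 2^-k around every point at
    distance below 2 * 2^-k.\<close>
  define G where "G k = {x \<in> E. \<forall>r>0. |E \<inter> mball x (3 * (1/2)^k)| \<le>o |E \<inter> mball x r|}" for k :: nat
  have half: "\<exists>k. 3 * (1/2::real)^k < r" if r: "r > 0" for r
  proof -
    obtain k where "(1/2::real)^k < r / 3" using real_arch_pow_inv[of "r/3" "1/2"] r by auto
    then show ?thesis by (intro exI[of _ k]) simp
  qed
  have half_mono: "(1/2::real)^l \<le> (1/2)^k" if "k \<le> l" for k l
    using that by (intro power_decreasing) auto
  have "\<exists>k0. \<forall>k\<ge>k0. x \<in> G k" if x: "x \<in> E" for x
  proof -
    \<comment> \<open>Cardinals are well-ordered, so some radius attains the least size, and all
      smaller radii share it.\<close>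
    let ?R = "(\<lambda>r. |E \<inter> mball x r| ) ` {0<..}"
    have "?R \<noteq> {}" by (auto intro: gt_ex)
    moreover have "\<forall>r\<in>?R. Well_order r" by (auto simp: card_of_Well_order)
    ultimately obtain r0 where r0: "r0 > 0" "\<And>r. r > 0 \<Longrightarrow> |E \<inter> mball x r0| \<le>o |E \<inter> mball x r|"
      using exists_minim_Well_order[of ?R] by auto
    obtain k0 where k0: "3 * (1/2::real)^k0 < r0" using half[OF r0(1)] by blast
    have "x \<in> G k" if k: "k \<ge> k0" for k
    proof -
      have "3 * (1/2)^k \<le> r0" using half_mono[OF k] k0 by linarith
      then have "mball x (3 * (1/2)^k) \<subseteq> mball x r0" by (rule mball_subset_concentric)
      then have "|E \<inter> mball x (3 * (1/2)^k)| \<le>o |E \<inter> mball x r0|" by (intro card_of_mono1) auto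
      then show ?thesis using r0(2) x unfolding G_def by (blast intro: ordLeq_transitive)
    qed
    then show ?thesis by blast
  qed
  then obtain k0 where k0: "\<And>x k. x \<in> E \<Longrightarrow> k \<ge> k0 x \<Longrightarrow> x \<in> G k" by metis
  text \<open>
    The relation of being closer than \<open>2\<epsilon>\<close> splits \<open>G k\<close> into components. Targets of different
    components are disjoint, and a component has at most as many points as there are
    targets for each of its points, so that a choice can be made in each component separately.
  \<close>
  have "\<exists>j. inj_on j (G k) \<and> (\<forall>x\<in>G k. j x \<in> pieces_in k (mball x ((1/2)^k)))" for k
  proof -
    define \<epsilon> where "\<epsilon> = (1/2::real)^k"
    have eps: "\<epsilon> > 0" by (simp add: \<epsilon>_def)
    define \<rho> where "\<rho> = {(x, y). x \<in> G k \<and> y \<in> G k \<and> d x y < 2 * \<epsilon>}"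
    define Q where "Q x = \<rho>\<^sup>* `` {x}" for x
    have GE: "x \<in> E" if "x \<in> G k" for x using that by (simp add: G_def)
    have symr: "sym \<rho>" by (auto simp: \<rho>_def sym_def commute)
    have near: "|E \<inter> mball y (3 * \<epsilon>)| \<le>o |E \<inter> mball x (3 * \<epsilon>)|" if "(x, y) \<in> \<rho>" for x y
    proof -
      have xy: "x \<in> G k" "y \<in> G k" "d x y < 2 * \<epsilon>" using that by (auto simp: \<rho>_def)
      then have inS: "x \<in> S" "y \<in> S" using GE ES by auto
      have "mball y \<epsilon> \<subseteq> mball x (3 * \<epsilon>)"
      proof
        fix z assume "z \<in> mball y \<epsilon>"
        then show "z \<in> mball x (3 * \<epsilon>)" using triangle[of x y z] xy(3) inS by auto
      qed
      then have "|E \<inter> mball y \<epsilon>| \<le>o |E \<inter> mball x (3 * \<epsilon>)|" by (intro card_of_mono1) auto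
      moreover have "|E \<inter> mball y (3 * \<epsilon>)| \<le>o |E \<inter> mball y \<epsilon>|"
        using xy(2) eps by (auto simp: G_def \<epsilon>_def)
      ultimately show ?thesis using ordLeq_transitive by blast
    qed
    have steps: "|E \<inter> mball y (3 * \<epsilon>)| \<le>o |E \<inter> mball x (3 * \<epsilon>)|" if "(x, y) \<in> \<rho>\<^sup>*" for x y
      using that
    proof induction
      case base show ?case by (rule card_of_mono1) simp
    next
      case (step y z) show ?case using ordLeq_transitive[OF near[OF step(2)] step(3)] .
    qed
    have syms: "(y, x) \<in> \<rho>\<^sup>*" if "(x, y) \<in> \<rho>\<^sup>*" for x y
      using that symr by (meson sym_rtrancl symD)
    have Qeq: "Q x = Q y" if "(x, y) \<in> \<rho>" for x y
    proof -
      have "(x, y) \<in> \<rho>\<^sup>*" "(y, x) \<in> \<rho>\<^sup>*" using that syms by blast+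
      then show ?thesis unfolding Q_def by (auto intro: rtrancl_trans)
    qed
    have QG: "y \<in> G k" if "x \<in> G k" "y \<in> Q x" for x y
    proof -
      have "(x, y) \<in> \<rho>\<^sup>*" using that by (simp add: Q_def)
      then show ?thesis using that(1) by (induction) (auto simp: \<rho>_def)
    qed
    have pos: "{M \<in> \<M>. M \<inter> mball y \<epsilon> \<noteq> {}} \<noteq> {}" if "y \<in> G k" for y
    proof -
      have "y \<in> mball y \<epsilon>" using ES GE that eps by simp
      then show ?thesis using dense[OF ball_open, of y \<epsilon>] by blast
    qed
    \<comment> \<open>The component is exhausted in countably many steps. Each step leads from a
      point to at most as many points as its large ball has leftover, and this number does not grow
      along the component.\<close>
    have cardQ: "|Q x| \<le>o |(E \<inter> mball x (3 * \<epsilon>)) \<times> \<CC>|" if x: "x \<in> G k" for x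
    proof -
      let ?Z = "(E \<inter> mball x (3 * \<epsilon>)) \<times> \<CC>"
      have "x \<in> E \<inter> mball x (3 * \<epsilon>)" using ES[OF GE[OF x]] GE[OF x] eps by simp
      then have ne: "E \<inter> mball x (3 * \<epsilon>) \<noteq> {}" by blast
      have inf: "infinite ?Z" by (rule infinite_Times_cantor_set[OF ne])
      have n: "|(\<rho> ^^ n) `` {x}| \<le>o |?Z|" for n
      proof (induction n)
        case 0
        have "finite ((\<rho> ^^ 0) `` {x})" by auto
        then show ?case using inf by (metis card_of_ordLeq_finite card_of_Well_order ordLeq_total)
      next
        case (Suc n)
        have "|\<Union>y\<in>(\<rho> ^^ n) `` {x}. \<rho> `` {y}| \<le>o |?Z|"
        proof (rule card_Union_le[OF Suc _ inf])
          fix y assume "y \<in> (\<rho> ^^ n) `` {x}"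
          then have "(x, y) \<in> \<rho>\<^sup>*" by (auto intro: relpow_imp_rtrancl)
          then have "|E \<inter> mball y (3 * \<epsilon>)| \<le>o |E \<inter> mball x (3 * \<epsilon>)|" by (rule steps)
          moreover have "\<rho> `` {y} \<subseteq> E \<inter> mball y (3 * \<epsilon>)" using GE ES eps by (force simp: \<rho>_def)
          ultimately show "|\<rho> `` {y}| \<le>o |?Z|"
            using card_of_mono1 le_Times_cantor_set ordLeq_transitive by metis
        qed
        moreover have "(\<rho> ^^ Suc n) `` {x} = (\<Union>y\<in>(\<rho> ^^ n) `` {x}. \<rho> `` {y})" by auto
        ultimately show ?case by simp
      qed
      have "Q x = (\<Union>n\<in>UNIV. (\<rho> ^^ n) `` {x})" unfolding Q_def by (auto simp: rtrancl_is_UN_relpow)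
      moreover have "|\<Union>n\<in>(UNIV::nat set). (\<rho> ^^ n) `` {x}| \<le>o |?Z|"
        by (rule card_Union_le[OF _ n inf]) (rule ordLeq_transitive[OF nat_le_cantor_set cantor_set_le_Times[OF ne]])
      ultimately show ?thesis by simp
    qed
    \<comment> \<open>The size is carried from \<open>x\<close> to \<open>y\<close> along the
      component, from the large to the small ball because \<open>y\<close> is in \<open>G k\<close>,
      and by \<open>small\<close> to the copies that meet this ball.\<close>
    have target: "|Q x| \<le>o |pieces_in k (mball y \<epsilon>)|" if x: "x \<in> G k" and y: "y \<in> Q x" for x y
    proof -
      let ?Z = "{M \<in> \<M>. M \<inter> mball y \<epsilon> \<noteq> {}} \<times> \<CC>"
      have yG: "y \<in> G k" using QG x y by blast
      have "|E \<inter> mball x (3 * \<epsilon>)| \<le>o |E \<inter> mball y (3 * \<epsilon>)|"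
        using steps syms y by (auto simp: Q_def)
      also have "|E \<inter> mball y (3 * \<epsilon>)| \<le>o |E \<inter> mball y \<epsilon>|" using yG eps by (auto simp: G_def \<epsilon>_def)
      also have "|E \<inter> mball y \<epsilon>| \<le>o |mball y \<epsilon> - \<Union>\<M>|" by (intro card_of_mono1) (auto simp: E_def)
      also have "|mball y \<epsilon> - \<Union>\<M>| \<le>o |?Z|" by (rule small[OF ball_open])
      finally have "|(E \<inter> mball x (3 * \<epsilon>)) \<times> \<CC>| \<le>o |?Z|"
        by (rule card_Times_le[OF _ cantor_set_le_Times[OF pos[OF yG]] infinite_Times_cantor_set[OF pos[OF yG]]])
      from ordLeq_transitive[OF this card_pieces_in[OF ball_open]] show ?thesis
        by (rule ordLeq_transitive[OF cardQ[OF x]])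
    qed
    \<comment> \<open>The choice is indexed by the component as a set, so that related points use
      the same function.\<close>
    have "\<forall>q. \<exists>j. q \<in> Q ` G k \<longrightarrow> inj_on j q \<and> (\<forall>y\<in>q. j y \<in> pieces_in k (mball y \<epsilon>))"
    proof
      fix q
      show "\<exists>j. q \<in> Q ` G k \<longrightarrow> inj_on j q \<and> (\<forall>y\<in>q. j y \<in> pieces_in k (mball y \<epsilon>))"
      proof (cases "q \<in> Q ` G k")
        case True
        then have "|q| \<le>o |pieces_in k (mball y \<epsilon>)|" if "y \<in> q" for y using target that by auto
        then show ?thesis using injective_choice[of q "\<lambda>y. pieces_in k (mball y \<epsilon>)"] by simp
      qed simp
    qed
    from choice[OF this] obtain j where j': "\<forall>q. q \<in> Q ` G k \<longrightarrow> inj_on (j q) q \<and> (\<forall>y\<in>q. j q y \<in> pieces_in k (mball y \<epsilon>))" ..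
    have Qx: "x \<in> Q x" for x by (simp add: Q_def)
    have j: "inj_on (j (Q x)) (Q x)" "j (Q x) x \<in> pieces_in k (mball x \<epsilon>)" if "x \<in> G k" for x
      using j' that Qx by blast+
    have "inj_on (\<lambda>x. j (Q x) x) (G k)"
    proof (rule inj_onI)
      fix x y assume xy: "x \<in> G k" "y \<in> G k" "j (Q x) x = j (Q y) y"
      \<comment> \<open>Points with a common target have balls that share a point of it. They are
        closer than \<open>2 * \<epsilon>\<close>, hence in one component, where the choice is
        injective.\<close>
      let ?p = "piece h (j (Q x) x) (\<lambda>_. False)"
      have "range (piece h (j (Q x) x)) \<subseteq> mball x \<epsilon>" "range (piece h (j (Q x) x)) \<subseteq> mball y \<epsilon>"
        using j(2)[OF xy(1)] j(2)[OF xy(2)] xy(3) unfolding pieces_in_def by auto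
      then have "?p \<in> mball x \<epsilon>" "?p \<in> mball y \<epsilon>" by blast+
      then have "d x y < 2 * \<epsilon>" using triangle'[of x ?p y] by auto
      then have r: "(x, y) \<in> \<rho>" using xy by (simp add: \<rho>_def)
      then have "y \<in> Q x" by (auto simp: Q_def)
      moreover have "j (Q x) x = j (Q x) y" using Qeq[OF r] xy(3) by simp
      ultimately show "x = y" using j(1)[OF xy(1)] Qx by (auto simp: inj_on_def)
    qed
    then show ?thesis using j(2) unfolding \<epsilon>_def by (intro exI[of _ "\<lambda>x. j (Q x) x"]) simp
  qed
  from choice[OF allI, of "\<lambda>k j. inj_on j (G k) \<and> (\<forall>x\<in>G k. j x \<in> pieces_in k (mball x ((1/2)^k)))", OF this]
  obtain j where j': "\<forall>k. inj_on (j k) (G k) \<and> (\<forall>x\<in>G k. j k x \<in> pieces_in k (mball x ((1/2)^k)))" ..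
  \<comment> \<open>The label of a target recovers the scale \<open>k0 x + n\<close>, so collisions
    could only occur within one scale.\<close>
  define J where "J = (\<lambda>(x, n). j (k0 x + n) x)"
  have J: "J (x, n) \<in> pieces_in (k0 x + n) (mball x ((1/2)^(k0 x + n)))" if "x \<in> E" for x n
    using j' k0[OF that, of "k0 x + n"] by (simp add: J_def)
  have inj: "inj_on J (E \<times> UNIV)"
  proof (rule inj_onI, clarify)
    fix x m y n assume e: "x \<in> E" "y \<in> E" "J (x, m) = J (y, n)"
    then have k: "k0 x + m = k0 y + n" using J[of x m] J[of y n] by (simp add: pieces_in_def)
    then have "x \<in> G (k0 y + n)" "y \<in> G (k0 y + n)" using k0 e by (metis le_add1)+
    then have "x = y" using j' e k by (auto simp: J_def inj_on_def)
    then show "x = y \<and> m = n" using k by simp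
  qed
  have UN: "(\<Union>\<iota>\<in>pieces \<M>. piece h \<iota> ` UNIV) = \<Union>\<M>" by (rule Union_piece)
  have "partitionable X (subtopology cantor_space UNIV)"
  proof (rule partitionable_absorb[OF Hausdorff, where I = "pieces \<M>" and N = "piece h" and J = J and R = UNIV];
      (unfold UN E_def[symmetric])?)
    show "inj_on J (E \<times> UNIV)" by (rule inj)
    show "J ` (E \<times> UNIV) \<subseteq> pieces \<M>" using J by (auto simp: pieces_in_def)
    show "x \<notin> range (piece h (J (x, n)))" if "x \<in> E" for x n
    proof -
      have "range (piece h (J (x, n))) \<subseteq> \<Union>\<M>"
        using J[OF that, of n] UN by (auto simp: pieces_in_def)
      then show ?thesis using that by (auto simp: E_def)
    qed
    show "\<exists>k. \<forall>n\<ge>k. range (piece h (J (x, n))) \<subseteq> U" if x: "x \<in> E" and U: "openin X U" "x \<in> U" for x U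
    proof -
      obtain r where r: "r > 0" "mball x r \<subseteq> U" using U by (auto simp: Xd openin_mtopology)
      obtain k where k: "3 * (1/2::real)^k < r" using half[OF r(1)] by blast
      have "range (piece h (J (x, n))) \<subseteq> U" if "n \<ge> k" for n
      proof -
        have "(1/2::real)^(k0 x + n) \<le> r"
          using half_mono[of k "k0 x + n"] that k zero_less_power[of "1/2::real" k] by linarith
        then have "mball x ((1/2)^(k0 x + n)) \<subseteq> U" using mball_subset_concentric r(2) by blast
        then show ?thesis using J[OF x, of n] by (auto simp: pieces_in_def)
      qed
      then show ?thesis by blast
    qed
  qed (use cantor_map_piece disjoint_piece in \<open>auto simp: tail_set_def\<close>)
  then show ?thesis by simp
qed

section \<open>Maximal families of disjoint Cantor sets\<close>

definition cantor_copy :: "'a topology \<Rightarrow> 'a set \<Rightarrow> bool" where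
  "cantor_copy X K \<longleftrightarrow> (\<exists>h. cantor_map X h \<and> range h = K)"

lemma cantor_copy_nonempty: "cantor_copy X K \<Longrightarrow> K \<noteq> {}"
  by (auto simp: cantor_copy_def)

text \<open>A sufficiently small cylinder around a point of \<open>U\<close> is mapped into
  \<open>U\<close>, and a cylinder is a Cantor space.\<close>

lemma cantor_copy_small:
  assumes "cantor_copy X K" "openin X U" "K \<inter> U \<noteq> {}"
  shows "\<exists>L. cantor_copy X L \<and> L \<subseteq> U"
proof -
  obtain h f where h: "cantor_map X h" "h f \<in> U" using assms by (auto simp: cantor_copy_def)
  obtain n where n: "\<forall>g. (\<forall>m<n. g m = f m) \<longrightarrow> h g \<in> U" using cantor_mapD(3)[OF h(1) assms(2) h(2)] by blast
  let ?s = "map f [0..<n]"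
  have "cantor_map X (\<lambda>g. h (append_seq ?s g))"
    unfolding cantor_map_def
  proof (intro conjI allI impI)
    show "inj (\<lambda>g. h (append_seq ?s g))"
    proof (rule injI)
      fix g g' assume "h (append_seq ?s g) = h (append_seq ?s g')"
      then have "append_seq ?s g = append_seq ?s g'" using cantor_mapD(1)[OF h(1)] by (simp add: inj_eq)
      then show "g = g'" using append_seq_inj by blast
    qed
    show "range (\<lambda>g. h (append_seq ?s g)) \<subseteq> topspace X" using cantor_mapD(2)[OF h(1)] by auto
    fix V g assume V: "openin X V \<and> h (append_seq ?s g) \<in> V"
    then obtain k where k: "\<forall>g'. (\<forall>m<k. g' m = append_seq ?s g m) \<longrightarrow> h g' \<in> V"
      using cantor_mapD(3)[OF h(1)] by blast
    have "h (append_seq ?s g') \<in> V" if "\<forall>m<k. g' m = g m" for g'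
      by (rule k[rule_format]) (use that in \<open>simp add: append_seq_def\<close>)
    then show "\<exists>k. \<forall>g'. (\<forall>m<k. g' m = g m) \<longrightarrow> h (append_seq ?s g') \<in> V" by blast
  qed
  moreover have "h (append_seq ?s g) \<in> U" for g
    by (rule n[rule_format]) (simp add: append_seq_def)
  ultimately show ?thesis unfolding cantor_copy_def by blast
qed

lemma cantor_family_choice:
  assumes "Hausdorff_space X" "disjoint \<M>" "\<And>M. M \<in> \<M> \<Longrightarrow> cantor_copy X M"
  shows "\<exists>h. cantor_family X \<M> h"
proof -
  have "\<forall>M\<in>\<M>. \<exists>h. cantor_map X h \<and> range h = M" using assms(3) by (simp add: cantor_copy_def)
  from bchoice[OF this] obtain h where "\<forall>M\<in>\<M>. cantor_map X (h M) \<and> range (h M) = M" ..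
  then have "cantor_family X \<M> h" by unfold_locales (use assms in auto)
  then show ?thesis by (rule exI[of "cantor_family X \<M>" h])
qed

text \<open>Zorn's lemma. The initial family matters for complete spaces, where it is chosen with
  care and then enlarged in order to become dense.\<close>

lemma maximal_cantor_family:
  assumes "disjoint \<M>" "\<And>M. M \<in> \<M> \<Longrightarrow> cantor_copy X M"
  obtains \<N> where "\<M> \<subseteq> \<N>" "disjoint \<N>" "\<And>M. M \<in> \<N> \<Longrightarrow> cantor_copy X M"
    "\<And>K. cantor_copy X K \<Longrightarrow> K \<inter> \<Union>\<N> \<noteq> {}"
proof -
  define A where "A = {\<N>. \<M> \<subseteq> \<N> \<and> disjoint \<N> \<and> (\<forall>M\<in>\<N>. cantor_copy X M)}"
  have "\<exists>N\<in>A. \<forall>Z\<in>A. N \<subseteq> Z \<longrightarrow> Z = N"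
  proof (rule subset_Zorn_nonempty)
    show "A \<noteq> {}" using assms by (auto simp: A_def)
    fix \<C> assume c: "\<C> \<noteq> {}" "subset.chain A \<C>"
    have "disjoint (\<Union>\<C>)"
    proof (rule disjointI)
      fix a b assume ab: "a \<in> \<Union>\<C>" "b \<in> \<Union>\<C>" "a \<noteq> b"
      then obtain P Q where PQ: "P \<in> \<C>" "Q \<in> \<C>" "a \<in> P" "b \<in> Q" by blast
      then have "P \<subseteq> Q \<or> Q \<subseteq> P" using c(2) by (auto simp: subset.chain_def)
      then obtain N where "N \<in> \<C>" "a \<in> N" "b \<in> N" using PQ by blast
      moreover have "disjoint N" using c(2) \<open>N \<in> \<C>\<close> by (auto simp: subset.chain_def A_def)
      ultimately show "a \<inter> b = {}" using ab by (auto simp: disjoint_def)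
    qed
    then show "\<Union>\<C> \<in> A" using c unfolding subset.chain_def A_def by blast
  qed
  then obtain \<N> where N: "\<N> \<in> A" "\<And>Z. Z \<in> A \<Longrightarrow> \<N> \<subseteq> Z \<Longrightarrow> Z = \<N>" by blast
  have "K \<inter> \<Union>\<N> \<noteq> {}" if K: "cantor_copy X K" for K
  proof
    assume d: "K \<inter> \<Union>\<N> = {}"
    then have "insert K \<N> \<in> A" using N(1) K by (auto simp: A_def disjoint_def)
    then have "K \<in> \<N>" using N(2)[of "insert K \<N>"] by blast
    then show False using d cantor_copy_nonempty[OF K] by blast
  qed
  moreover have "\<M> \<subseteq> \<N>" "disjoint \<N>" "\<forall>M\<in>\<N>. cantor_copy X M" using N(1) by (simp_all add: A_def)
  ultimately show thesis by (intro that[of \<N>]) simp_all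
qed

lemma dense_cantor_family:
  assumes "\<And>U. openin X U \<Longrightarrow> U \<noteq> {} \<Longrightarrow> \<exists>K. cantor_copy X K \<and> K \<subseteq> U"
    and "\<And>K. cantor_copy X K \<Longrightarrow> K \<inter> \<Union>\<N> \<noteq> {}" and "openin X U" "U \<noteq> {}"
  shows "U \<inter> \<Union>\<N> \<noteq> {}"
proof -
  obtain K where "cantor_copy X K" "K \<subseteq> U" using assms(1)[OF assms(3,4)] by blast
  then show ?thesis using assms(2)[of K] by blast
qed

section \<open>Countable powers of the successors of the continuum\<close>

definition seqs :: "'q set \<Rightarrow> (nat \<Rightarrow> 'q) set" where
  "seqs Q = {f. range f \<subseteq> Q}"

lemma seqs_mono:
  assumes "|P| \<le>o |Q|"
  shows "|seqs P| \<le>o |seqs Q|"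
proof -
  obtain f where f: "inj_on f P" "f ` P \<subseteq> Q" using assms unfolding card_of_ordLeq[symmetric] by blast
  show ?thesis
  proof (rule card_of_ordLeqI[where f = "\<lambda>s. f \<circ> s"])
    show "inj_on ((\<circ>) f) (seqs P)"
    proof (rule inj_onI, rule ext)
      fix s t n assume st: "s \<in> seqs P" "t \<in> seqs P" "f \<circ> s = f \<circ> t"
      then have "f (s n) = f (t n)" by (metis comp_apply)
      moreover have "s n \<in> P" "t n \<in> P" using st(1,2) by (auto simp: seqs_def)
      ultimately show "s n = t n" using f(1) by (simp add: inj_on_eq_iff)
    qed
  qed (use f(2) in \<open>auto simp: seqs_def\<close>)
qed

lemma seqs_cantor_set: "|seqs \<CC>| \<le>o |\<CC>|"
proof (rule card_of_ordLeqI[where f = "\<lambda>s m. s (fst (prod_decode m)) (snd (prod_decode m))"])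
  show "inj_on (\<lambda>s m. s (fst (prod_decode m)) (snd (prod_decode m))) (seqs \<CC>)"
  proof (rule inj_onI, rule ext, rule ext)
    fix s t :: "nat \<Rightarrow> nat \<Rightarrow> bool" and i j
    assume "(\<lambda>m. s (fst (prod_decode m)) (snd (prod_decode m))) = (\<lambda>m. t (fst (prod_decode m)) (snd (prod_decode m)))"
    from fun_cong[OF this, of "prod_encode (i, j)"] show "s i j = t i j" by simp
  qed
qed simp

text \<open>
  Hausdorff's recursion formula: the range of a sequence in a successor cardinal is bounded.
\<close>

lemma seqs_continuum_succ:
  "is_continuum_succ n (s :: 'a rel) \<Longrightarrow> Card_order s \<and> infinite (Field s) \<and> |seqs (Field s)| \<le>o s"
proof (induction n arbitrary: s)
  case 0
  then have s: "s =o |\<CC>|" by (simp add: continuum_eq)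
  have co: "Card_order s" using s card_of_Card_order Card_order_ordIso2 ordIso_symmetric by blast
  have f: "|Field s| =o s" using co by (rule card_of_Field_ordIso)
  have fc: "|Field s| =o |\<CC>|" using ordIso_transitive[OF f s] .
  have "infinite (Field s)" using card_of_ordIso_finite[OF fc] infinite_cantor_set by blast
  moreover have "|seqs (Field s)| \<le>o |\<CC>|"
    using ordLeq_transitive[OF seqs_mono seqs_cantor_set] fc ordIso_imp_ordLeq by blast
  ultimately show ?case using co s ordLeq_ordIso_trans ordIso_symmetric by blast
next
  case (Suc n)
  then obtain s0 :: "'a rel" where s0: "is_continuum_succ n s0" and s: "s =o cardSuc s0" by auto
  have IH: "Card_order s0" "infinite (Field s0)" "|seqs (Field s0)| \<le>o s0" using Suc.IH[OF s0] by auto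
  define r where "r = cardSuc s0"
  have cr: "Card_order r" unfolding r_def using IH(1) by (rule cardSuc_Card_order)
  have ir: "infinite (Field r)" unfolding r_def using cardSuc_finite[OF IH(1)] IH(2) by simp
  have fr: "|Field r| \<le>o r" using cr card_of_Field_ordIso ordIso_imp_ordLeq by blast
  have wo: "Well_order r" using cr card_order_on_well_order_on by blast
  \<comment> \<open>Initial segments of the successor have size at most \<open>s0\<close>, whose
    countable power does not grow by induction.\<close>
  have under: "|seqs (underS r i)| \<le>o r" if i: "i \<in> Field r" for i
  proof -
    have "|underS r i| <o r" by (rule card_of_underS[OF cr i])
    then have "|underS r i| \<le>o s0" unfolding r_def using cardSuc_ordLeq_ordLess[OF IH(1) card_of_Card_order] by blast
    then have "|underS r i| \<le>o |Field s0|"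
      using card_of_Field_ordIso[OF IH(1)] ordLeq_ordIso_trans ordIso_symmetric by blast
    then have "|seqs (underS r i)| \<le>o s0" using seqs_mono IH(3) ordLeq_transitive by blast
    moreover have "s0 \<le>o r" unfolding r_def using IH(1) by (rule cardSuc_ordLeq)
    ultimately show ?thesis using ordLeq_transitive by blast
  qed
  \<comment> \<open>The successor of an infinite cardinal is regular, so the countable range of a
    sequence lies in one initial segment.\<close>
  have "seqs (Field r) \<subseteq> (\<Union>i\<in>Field r. seqs (underS r i))"
  proof
    fix f assume f: "f \<in> seqs (Field r)"
    have ch: "relChain r (\<lambda>i. underS r i)"
      unfolding relChain_def
    proof (intro allI impI)
      fix i j assume "(i, j) \<in> r"
      then show "underS r i \<subseteq> underS r j"
        using wo underS_incr[of r i j] by (auto simp: well_order_on_def linear_order_on_def partial_order_on_def preorder_on_def)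
    qed
    have "range f \<subseteq> (\<Union>i\<in>Field r. underS r i)"
    proof
      fix x assume "x \<in> range f"
      then have "x \<in> Field r" using f by (auto simp: seqs_def)
      then obtain b where "b \<in> Field r" "x \<noteq> b" "(x, b) \<in> r"
        using infinite_Card_order_limit[OF cr ir] by blast
      then show "x \<in> (\<Union>i\<in>Field r. underS r i)" by (auto simp: underS_def)
    qed
    moreover have "|range f| \<le>o s0"
    proof -
      have "|range f| \<le>o |UNIV :: nat set|" by (rule card_of_image)
      moreover have "|UNIV :: nat set| \<le>o |Field s0|" using IH(2) by (simp add: infinite_iff_card_of_nat)
      ultimately show ?thesis
        using card_of_Field_ordIso[OF IH(1)] ordLeq_ordIso_trans ordLeq_transitive by blast
    qed
    ultimately obtain i where "i \<in> Field r" "range f \<subseteq> underS r i"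
      using cardSuc_UNION[OF IH(1,2) ch[unfolded r_def]] unfolding r_def by blast
    then show "f \<in> (\<Union>i\<in>Field r. seqs (underS r i))" by (auto simp: seqs_def)
  qed
  then have "|seqs (Field r)| \<le>o |\<Union>i\<in>Field r. seqs (underS r i)|" by (rule card_of_mono1)
  moreover have "|\<Union>i\<in>Field r. seqs (underS r i)| \<le>o r"
    by (rule card_of_UNION_ordLeq_infinite_Field[OF ir cr fr]) (use under in blast)
  ultimately have sr: "|seqs (Field r)| \<le>o r" using ordLeq_transitive by blast
  have sr_iso: "s =o r" using s by (simp add: r_def)
  have co: "Card_order s" using Card_order_ordIso[OF cr sr_iso] .
  have fs: "|Field s| =o |Field r|" using sr_iso by (rule card_of_cong)
  have "infinite (Field s)" using card_of_ordIso_finite[OF fs] ir by blast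
  moreover have "|seqs (Field s)| \<le>o s"
    using seqs_mono[of "Field s" "Field r"] fs sr sr_iso
    by (meson ordIso_imp_ordLeq ordIso_symmetric ordLeq_transitive)
  ultimately show ?case using co by blast
qed

text \<open>If \<open>Q\<close> were smaller than \<open>A\<close>, it would lie below the supremum
  of the successors of the continuum and so have the size of one of them. Its countable power would
  then be no larger than \<open>Q\<close>, against \<open>AQ\<close>.\<close>

lemma card_le_seqs:
  fixes T A :: "'a set" and Q :: "'q set"
  assumes T: "card_le_continuum_succ_omega T" and A: "A \<subseteq> T"
    and c: "|\<CC>| \<le>o |Q|" and AQ: "|A| \<le>o |seqs Q|"
  shows "|A| \<le>o |Q|"
proof (rule ccontr)
  assume n: "\<not> |A| \<le>o |Q|"
  then have "|Q| \<le>o |A|" using ordLeq_total[OF card_of_Well_order card_of_Well_order] by blast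
  \<comment> \<open>\<open>Q\<close> lives in another type; its copy \<open>P\<close> can be
    compared with the cardinals over which \<open>card_le_continuum_succ_omega\<close>
    quantifies.\<close>
  then obtain P where P: "P \<subseteq> A" "|Q| =o |P|" using internalize_card_of_ordLeq2[of Q A] by blast
  have QP: "|Q| \<le>o |P|" and PQ: "|P| \<le>o |Q|" using P(2) ordIso_iff_ordLeq by blast+
  have "\<not> (\<forall>n. \<exists>s :: 'a rel. is_continuum_succ n s \<and> s \<le>o |P| )"
  proof
    assume "\<forall>n. \<exists>s :: 'a rel. is_continuum_succ n s \<and> s \<le>o |P|"
    then have "|T| \<le>o |P|"
      using T card_of_Card_order unfolding card_le_continuum_succ_omega_def by blast
    then show False using n card_of_mono1[OF A] PQ ordLeq_transitive by blast
  qed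
  then have ex: "\<exists>n. \<not> (\<exists>s :: 'a rel. is_continuum_succ n s \<and> s \<le>o |P| )" by simp
  \<comment> \<open>The first successor that is not below \<open>P\<close>; the one before it then
    has exactly the size of \<open>P\<close>.\<close>
  define k where "k = (LEAST n. \<not> (\<exists>s :: 'a rel. is_continuum_succ n s \<and> s \<le>o |P| ))"
  have k: "\<not> (\<exists>s :: 'a rel. is_continuum_succ k s \<and> s \<le>o |P| )"
    unfolding k_def using ex by (rule LeastI_ex)
  have k': "\<exists>s :: 'a rel. is_continuum_succ m s \<and> s \<le>o |P|" if "m < k" for m
    using not_less_Least[of m] that unfolding k_def by blast
  show False
  proof (cases k)
    case 0
    have "|\<CC>| \<le>o |P|" using c QP ordLeq_transitive by blast
    then obtain B where B: "B \<subseteq> P" "|\<CC>| =o |B|" using internalize_card_of_ordLeq2[of "\<CC>" P] by blast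
    have "is_continuum_succ 0 |B|" using B(2) by (simp add: continuum_eq ordIso_symmetric)
    then show False using k 0 card_of_mono1[OF B(1)] by blast
  next
    case (Suc m)
    then obtain s :: "'a rel" where s: "is_continuum_succ m s" "s \<le>o |P|" using k' by blast
    have sc: "Card_order s" "|seqs (Field s)| \<le>o s" using seqs_continuum_succ[OF s(1)] by auto
    have "\<not> s <o |P|"
    proof
      assume "s <o |P|"
      then have le: "cardSuc s \<le>o |P|" by (rule cardSuc_least[OF sc(1) card_of_Card_order])
      have f: "|Field (cardSuc s)| =o cardSuc s" using cardSuc_Card_order[OF sc(1)] by (rule card_of_Field_ordIso)
      have "|Field (cardSuc s)| \<le>o |P|" using ordIso_ordLeq_trans[OF f le] .
      \<comment> \<open>\<open>cardSuc\<close> leaves the type, so the successor is brought back as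
        the cardinal of a subset of \<open>P\<close>.\<close>
      then obtain B where B: "B \<subseteq> P" "|Field (cardSuc s)| =o |B|"
        using internalize_card_of_ordLeq2[of "Field (cardSuc s)" P] by blast
      have "|B| =o cardSuc s" using ordIso_transitive[OF ordIso_symmetric[OF B(2)] f] .
      then have "is_continuum_succ k |B|" using s(1) Suc by auto
      then show False using k card_of_mono1[OF B(1)] by blast
    qed
    then have "|P| \<le>o s"
      using not_ordLess_iff_ordLeq card_of_Well_order sc(1) card_order_on_well_order_on by blast
    then have "|Q| \<le>o s" using QP ordLeq_transitive by blast
    then have "|Q| \<le>o |Field s|" using card_of_Field_ordIso[OF sc(1)] ordIso_symmetric ordLeq_ordIso_trans by blast
    then have "|seqs Q| \<le>o s" using seqs_mono sc(2) ordLeq_transitive by blast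
    from ordLeq_transitive[OF this ordLeq_transitive[OF s(2) PQ]]
    have "|A| \<le>o |Q|" by (rule ordLeq_transitive[OF AQ])
    then show False using n by blast
  qed
qed

text \<open>Points of \<open>U\<close> are limits of points of the copies, each named by a pair
  \<open>(M, w)\<close>, and such a sequence determines its limit.\<close>

lemma (in cantor_family) card_le_seqs_of_dense:
  assumes met: "metrizable_space X"
    and dense: "\<And>U. openin X U \<Longrightarrow> U \<noteq> {} \<Longrightarrow> U \<inter> \<Union>\<M> \<noteq> {}"
    and U: "openin X U"
  shows "|U| \<le>o |seqs ({M \<in> \<M>. M \<inter> U \<noteq> {}} \<times> \<CC>)|"
proof -
  obtain S d where "Metric_space S d" and Xd: "X = Metric_space.mtopology S d"
    using met unfolding metrizable_space_def by blast
  then interpret Metric_space S d by simp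
  let ?Q = "{M \<in> \<M>. M \<inter> U \<noteq> {}} \<times> \<CC>"
  have US: "U \<subseteq> S" using U openin_subset[of X U] by (simp add: Xd)
  have "\<exists>z. z \<in> ?Q \<and> d y (h (fst z) (snd z)) < inverse (Suc n) \<and> h (fst z) (snd z) \<in> S" if y: "y \<in> U" for y and n :: nat
  proof -
    have o: "openin X (mball y (inverse (Suc n)) \<inter> U)" using U by (auto simp: Xd)
    have "y \<in> mball y (inverse (Suc n)) \<inter> U" using y US by auto
    then have "mball y (inverse (Suc n)) \<inter> U \<inter> \<Union>\<M> \<noteq> {}" using dense[OF o] by blast
    then obtain p M where p: "M \<in> \<M>" "p \<in> M" "p \<in> mball y (inverse (Suc n))" "p \<in> U" by blast
    then obtain w where "p = h M w" using range_h[OF p(1)] by blast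
    then show ?thesis using p by (intro exI[of _ "(M, w)"]) auto
  qed
  then have "\<forall>y. \<forall>n. \<exists>z. y \<in> U \<longrightarrow> z \<in> ?Q \<and> d y (h (fst z) (snd z)) < inverse (Suc n) \<and> h (fst z) (snd z) \<in> S"
    by blast
  from choice[OF allI, OF choice[OF spec[OF this]]]
  obtain \<sigma> where \<sigma>: "\<forall>y. \<forall>n. y \<in> U \<longrightarrow> \<sigma> y n \<in> ?Q \<and>
      d y (h (fst (\<sigma> y n)) (snd (\<sigma> y n))) < inverse (Suc n) \<and> h (fst (\<sigma> y n)) (snd (\<sigma> y n)) \<in> S" ..
  have "inj_on \<sigma> U"
  proof (rule inj_onI, rule ccontr)
    fix y z assume yz: "y \<in> U" "z \<in> U" "\<sigma> y = \<sigma> z" "y \<noteq> z"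
    then have "d y z > 0" using US by (intro mdist_pos_less) auto
    then have "d y z / 2 > 0" by simp
    then obtain n where n: "inverse (Suc n) < d y z / 2" using reals_Archimedean by metis
    let ?p = "h (fst (\<sigma> y n)) (snd (\<sigma> y n))"
    have "d y ?p < inverse (Suc n)" "d z ?p < inverse (Suc n)" "?p \<in> S" using \<sigma> yz by metis+
    then show False using triangle'[of y ?p z] US yz n by auto
  qed
  moreover have "\<sigma> y \<in> seqs ?Q" if "y \<in> U" for y
    unfolding seqs_def using \<sigma> that by blast
  ultimately show ?thesis by (rule card_of_ordLeqI)
qed

subsection \<open>Completely metrizable spaces\<close>

lemma half_power_less: "r > 0 \<Longrightarrow> \<exists>k. (1/2::real)^k < r"
  using real_arch_pow_inv[of r "1/2"] by simp

context Metric_space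
begin

lemma split_mball:
  assumes iso: "no_isolated_points mtopology" and c: "c \<in> M" "r > 0"
  shows "\<exists>c0 c1 \<rho>. c0 \<in> M \<and> c1 \<in> M \<and> \<rho> > 0 \<and> \<rho> \<le> r / 2 \<and> mcball c0 \<rho> \<subseteq> mcball c r \<and>
    mcball c1 \<rho> \<subseteq> mcball c r \<and> mcball c0 \<rho> \<inter> mcball c1 \<rho> = {}"
proof -
  have "mball c r \<noteq> {c}"
  proof
    assume "mball c r = {c}"
    then have "openin mtopology {c}" using openin_mball[of c r] by metis
    then show False using iso c by (auto simp: no_isolated_points_def)
  qed
  moreover have "c \<in> mball c r" using c by simp
  ultimately obtain y where y: "y \<in> mball c r" "y \<noteq> c" by blast
  then have yM: "y \<in> M" and pos: "0 < d c y" and lt: "d c y < r" using c by (auto intro: mdist_pos_less)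
  \<comment> \<open>The first bound makes the radii shrink, the second keeps the ball around
    \<open>y\<close> inside, the third separates it from the ball around \<open>c\<close>.\<close>
  define \<rho> where "\<rho> = min (r / 2) (min ((r - d c y)) (d c y / 3))"
  have \<rho>: "\<rho> > 0" "\<rho> \<le> r / 2" "\<rho> \<le> r - d c y" "\<rho> \<le> d c y / 3" using pos lt c by (auto simp: \<rho>_def min_def)
  have "mcball c \<rho> \<subseteq> mcball c r" using \<rho>(2) c by (intro mcball_subset_concentric) simp
  moreover have "mcball y \<rho> \<subseteq> mcball c r"
  proof
    fix z assume "z \<in> mcball y \<rho>"
    then show "z \<in> mcball c r" using triangle[of c y z] \<rho>(3) c yM by auto
  qed
  moreover have "mcball c \<rho> \<inter> mcball y \<rho> = {}"
  proof (rule ccontr)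
    assume "mcball c \<rho> \<inter> mcball y \<rho> \<noteq> {}"
    then obtain z where "z \<in> mcball c \<rho>" "z \<in> mcball y \<rho>" by blast
    then show False using triangle'[of c z y] \<rho>(4) pos by auto
  qed
  ultimately show ?thesis using c yM \<rho> by (intro exI[of _ c] exI[of _ y] exI[of _ \<rho>]) simp
qed

text \<open>A Cantor scheme of closed balls with radii at most R * 2^-n: completeness puts a point
  on each branch, and the disjointness of siblings makes the map injective.\<close>

lemma cantor_copy_in_open:
  assumes "mcomplete" and iso: "no_isolated_points mtopology" and U: "openin mtopology U" "U \<noteq> {}"
  shows "\<exists>K. cantor_copy mtopology K \<and> K \<subseteq> U"
proof -
  obtain x where x: "x \<in> U" using U(2) by blast
  then have xM: "x \<in> M" using openin_subset[OF U(1)] by auto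
  obtain r0 where r0: "r0 > 0" "mball x r0 \<subseteq> U" using U(1) x by (auto simp: openin_mtopology)
  define R where "R = r0 / 2"
  have R: "R > 0" "mcball x R \<subseteq> U"
    using r0 mcball_subset_mball_concentric[of R r0 x] by (auto simp: R_def)
  have "\<forall>z. \<exists>w. fst z \<in> M \<and> snd z > 0 \<longrightarrow> fst w \<in> M \<and> fst (snd w) \<in> M \<and> snd (snd w) > 0 \<and>
    snd (snd w) \<le> snd z / 2 \<and> mcball (fst w) (snd (snd w)) \<subseteq> mcball (fst z) (snd z) \<and>
    mcball (fst (snd w)) (snd (snd w)) \<subseteq> mcball (fst z) (snd z) \<and>
    mcball (fst w) (snd (snd w)) \<inter> mcball (fst (snd w)) (snd (snd w)) = {}"
    using split_mball[OF iso] by (metis fst_conv snd_conv)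
  from choice[OF this] obtain w where w: "\<And>z. fst z \<in> M \<Longrightarrow> snd z > 0 \<Longrightarrow>
    fst (w z) \<in> M \<and> fst (snd (w z)) \<in> M \<and> snd (snd (w z)) > 0 \<and>
    snd (snd (w z)) \<le> snd z / 2 \<and> mcball (fst (w z)) (snd (snd (w z))) \<subseteq> mcball (fst z) (snd z) \<and>
    mcball (fst (snd (w z))) (snd (snd (w z))) \<subseteq> mcball (fst z) (snd z) \<and>
    mcball (fst (w z)) (snd (snd (w z))) \<inter> mcball (fst (snd (w z))) (snd (snd (w z))) = {}" by blast
  define sp where "sp b z = (if b then fst (w z) else fst (snd (w z)), snd (snd (w z)))" for b :: bool and z
  define st where "st f n = rec_nat (x, R) (\<lambda>n z. sp (f n) z) n" for f :: "nat \<Rightarrow> bool" and n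
  have st0: "st f 0 = (x, R)" and stS: "st f (Suc n) = sp (f n) (st f n)" for f n by (simp_all add: st_def)
  define B where "B f n = mcball (fst (st f n)) (snd (st f n))" for f n
  have inv: "fst (st f n) \<in> M \<and> snd (st f n) > 0 \<and> snd (st f n) \<le> R * (1/2)^n" for f n
  proof (induction n)
    case 0 show ?case using xM R by (simp add: st0)
  next
    case (Suc n)
    then show ?case using w[of "st f n"] by (auto simp: stS sp_def)
  qed
  have Bsub: "B f (Suc n) \<subseteq> B f n" for f n
    using w[of "st f n"] inv[of f n] by (auto simp: B_def stS sp_def)
  have agree: "st g n = st f n" if "\<forall>m<n. g m = f m" for f g n
    using that by (induction n) (simp_all add: st0 stS)
  have small: "\<exists>n. R * (1/2)^n < e" if e: "e > 0" for e
  proof -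
    obtain n where "(1/2::real)^n < e / R" using half_power_less[of "e / R"] e R by auto
    then show ?thesis using R by (intro exI[of _ n]) (simp add: field_simps)
  qed
  have "\<exists>p. p \<in> (\<Inter>n. B f n)" for f
  proof -
    have "\<Inter>(range (B f)) \<noteq> {}"
    proof (rule assms(1)[unfolded mcomplete_nest, rule_format, of "B f"], intro conjI allI impI)
      show "closedin mtopology (B f n)" for n by (simp add: B_def)
      have "fst (st f n) \<in> B f n" for n using inv[of f n] by (simp add: B_def)
      then show "B f n \<noteq> {}" for n by blast
      show "decseq (B f)" using Bsub by (simp add: decseq_Suc_iff)
      fix e :: real assume "e > 0"
      then obtain n where n: "R * (1/2)^n < e" using small by blast
      have "B f n \<subseteq> mcball (fst (st f n)) e"
        unfolding B_def using inv[of f n] n by (intro mcball_subset_concentric) linarith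
      then show "\<exists>n a. B f n \<subseteq> mcball a e" by blast
    qed
    then show ?thesis by blast
  qed
  from choice[OF allI, OF this] obtain p where p: "\<forall>f. p f \<in> (\<Inter>n. B f n)" ..
  then have pB: "p f \<in> B f n" for f n by blast
  have "cantor_map mtopology p"
    unfolding cantor_map_def
  proof (intro conjI allI impI)
    show "inj p"
    proof (rule injI, rule ccontr)
      fix f g assume eq: "p f = p g" and "f \<noteq> g"
      then have ex: "\<exists>n. f n \<noteq> g n" by auto
      define n where "n = (LEAST n. f n \<noteq> g n)"
      have n: "f n \<noteq> g n" unfolding n_def using ex by (rule LeastI_ex)
      have "\<forall>m<n. g m = f m" using not_less_Least unfolding n_def by blast
      then have "st g n = st f n" by (rule agree)
      then have "B f (Suc n) \<inter> B g (Suc n) = {}"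
        using w[of "st f n"] inv[of f n] n by (cases "f n"; cases "g n") (auto simp: B_def stS sp_def)
      then show False using pB[of f "Suc n"] pB[of g "Suc n"] eq by auto
    qed
    show "range p \<subseteq> topspace mtopology" using pB by (auto simp: B_def)
    fix V f assume V: "openin mtopology V \<and> p f \<in> V"
    then obtain e where e: "e > 0" "mball (p f) e \<subseteq> V" by (auto simp: openin_mtopology)
    obtain n where n: "R * (1/2)^n < e / 2" using small[of "e / 2"] e by auto
    have "p g \<in> V" if "\<forall>m<n. g m = f m" for g
    proof -
      have "p g \<in> B f n" using pB[of g n] agree[OF that] by (simp add: B_def)
      moreover have "p f \<in> B f n" by (rule pB)
      ultimately have "p f \<in> M" "p g \<in> M" "d (p f) (p g) \<le> 2 * snd (st f n)"
        using triangle''[of "p f" "fst (st f n)" "p g"] by (auto simp: B_def)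
      then have "p g \<in> mball (p f) e" using inv[of f n] n by auto
      then show ?thesis using e by blast
    qed
    then show "\<exists>n. \<forall>g. (\<forall>m<n. g m = f m) \<longrightarrow> p g \<in> V" by blast
  qed
  moreover have "range p \<subseteq> U" using pB[of _ 0] R by (auto simp: B_def st0)
  ultimately show ?thesis unfolding cantor_copy_def by blast
qed

end

section \<open>Coding a complete metric space by a closed set of sequences\<close>

definition ini :: "(nat \<Rightarrow> 'k) \<Rightarrow> nat \<Rightarrow> 'k list" where
  "ini g n = map g [0..<n]"

lemma length_ini [simp]: "length (ini g n) = n"
  by (simp add: ini_def)

lemma ini_eq_iff: "ini g n = ini f m \<longleftrightarrow> n = m \<and> (\<forall>i<n. g i = f i)"
  by (auto simp: ini_def list_eq_iff_nth_eq)

definition tree :: "(nat \<Rightarrow> 'k) set \<Rightarrow> 'k list set" where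
  "tree F = {ini g n | g n. g \<in> F}"

text \<open>This is closedness in the product of countably many discrete spaces.\<close>

definition seq_closed :: "(nat \<Rightarrow> 'k) set \<Rightarrow> bool" where
  "seq_closed F \<longleftrightarrow> (\<forall>g. (\<forall>n. ini g n \<in> tree F) \<longrightarrow> g \<in> F)"

text \<open>\<open>W\<close> stands for a strict well-order. To be the first admissible centre
  excludes earlier ones, which is a closed condition on the point, and it limits the number of
  centres that an open set needs.\<close>

definition code_centre :: "('a \<times> 'a) set \<Rightarrow> 'a set \<Rightarrow> ('a \<Rightarrow> 'a \<Rightarrow> real) \<Rightarrow> nat \<Rightarrow> 'a \<Rightarrow> 'a" where
  "code_centre W S d n x = (SOME c. c \<in> S \<and> d c x < (1/2)^n \<and> (\<forall>c'\<in>S. (c', c) \<in> W \<longrightarrow> \<not> d c' x < (1/2)^n))"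

text \<open>
  A point is coded by the first centre \<open>c n\<close> of a ball of radius \<open>2\<^sup>-\<^sup>n\<close> around it, for each \<open>n\<close>.
  The second component is a finite certificate that the limit of the balls of a branch lies in
  the open ball around \<open>c n\<close>; it makes the set of codes closed.
\<close>

definition code :: "('a \<times> 'a) set \<Rightarrow> 'a set \<Rightarrow> ('a \<Rightarrow> 'a \<Rightarrow> real) \<Rightarrow> 'a \<Rightarrow> nat \<Rightarrow> 'a \<times> nat" where
  "code W S d x n = (let c = code_centre W S d in
     (c n x, LEAST m. d (c m x) (c n x) + (1/2)^m < (1/2)^n))"

lemma wf_total_exists: "\<exists>W. wf W \<and> total_on UNIV (W :: ('a \<times> 'a) set)"
proof -
  obtain r :: "('a \<times> 'a) set" where "well_order_on UNIV r" using well_order_on by blast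
  then show ?thesis
    by (intro exI[of _ "r - Id"])
      (auto simp: well_order_on_def linear_order_on_def total_on_def)
qed

context Metric_space
begin

context
  fixes W :: "('a \<times> 'a) set"
  assumes W: "wf W" "total_on UNIV W"
begin

abbreviation (input) "ctr \<equiv> code_centre W M d"

lemma code_centre:
  assumes x: "x \<in> M"
  shows "ctr n x \<in> M" "d (ctr n x) x < (1/2)^n"
    "c \<in> M \<Longrightarrow> (c, ctr n x) \<in> W \<Longrightarrow> \<not> d c x < (1/2)^n"
proof -
  define Q where "Q = {c \<in> M. d c x < (1/2)^n}"
  have "x \<in> Q" using x by (simp add: Q_def)
  then obtain c where c: "c \<in> Q" "\<And>c'. (c', c) \<in> W \<Longrightarrow> c' \<notin> Q"
    using W(1) unfolding wf_eq_minimal by metis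
  have "\<exists>c. c \<in> M \<and> d c x < (1/2)^n \<and> (\<forall>c'\<in>M. (c', c) \<in> W \<longrightarrow> \<not> d c' x < (1/2)^n)"
    using c by (intro exI[of _ c]) (auto simp: Q_def)
  from someI_ex[OF this]
  have "ctr n x \<in> M \<and> d (ctr n x) x < (1/2)^n \<and> (\<forall>c'\<in>M. (c', ctr n x) \<in> W \<longrightarrow> \<not> d c' x < (1/2)^n)"
    unfolding code_centre_def by simp
  then show "ctr n x \<in> M" "d (ctr n x) x < (1/2)^n"
    "c \<in> M \<Longrightarrow> (c, ctr n x) \<in> W \<Longrightarrow> \<not> d c x < (1/2)^n" for c by auto
qed

lemma code_centre_unique:
  assumes x: "x \<in> M" and c: "c \<in> M" "d c x < (1/2)^n" "\<And>c'. c' \<in> M \<Longrightarrow> (c', c) \<in> W \<Longrightarrow> \<not> d c' x < (1/2)^n"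
  shows "ctr n x = c"
proof (rule ccontr)
  assume "ctr n x \<noteq> c"
  then consider "(ctr n x, c) \<in> W" | "(c, ctr n x) \<in> W" using W(2) by (auto simp: total_on_def)
  then show False using code_centre[OF x] c by cases blast+
qed

text \<open>Equal entries mean a common centre. The estimate gives injectivity of the code, the
  Cauchy property in the proof of closedness, and later the continuity of decoding.\<close>

lemma code_close:
  assumes x: "x \<in> M" "y \<in> M" and eq: "code W M d x n = code W M d y n"
  shows "d x y < 2 * (1/2)^n"
proof -
  have "ctr n x = ctr n y" using eq by (simp add: code_def Let_def)
  then have "d (ctr n x) x < (1/2)^n" "d (ctr n x) y < (1/2)^n" "ctr n x \<in> M"
    using code_centre(1,2)[OF x(1), where n = n] code_centre(2)[OF x(2), where n = n] by auto
  then show ?thesis using triangle''[of x "ctr n x" y] x by auto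
qed

lemma inj_on_code: "inj_on (code W M d) M"
proof (rule inj_onI, rule ccontr)
  fix x y assume xy: "x \<in> M" "y \<in> M" "code W M d x = code W M d y" "x \<noteq> y"
  then have "0 < d x y" by (intro mdist_pos_less)
  then obtain k where "(1/2::real)^k < d x y / 2" using half_power_less[of "d x y / 2"] by auto
  moreover have "d x y < 2 * (1/2)^k" using xy by (intro code_close) auto
  ultimately show False by simp
qed

text \<open>Points whose codes follow the branch longer and longer form a Cauchy sequence. Its limit
  is in no ball around an earlier centre because balls are open. For the centre itself the limit
  gives only a non-strict inequality, which the certificate makes strict.\<close>

lemma seq_closed_code:
  assumes "mcomplete"
  shows "seq_closed (code W M d ` M)"
  unfolding seq_closed_def
proof (intro allI impI)
  fix g assume g: "\<forall>n. ini g n \<in> tree (code W M d ` M)"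
  have "\<exists>x. x \<in> M \<and> (\<forall>i<n. code W M d x i = g i)" for n
  proof -
    obtain x m where x: "x \<in> M" "ini g n = ini (code W M d x) m" using g unfolding tree_def by blast
    then show ?thesis by (intro exI[of _ x]) (simp add: ini_eq_iff)
  qed
  from choice[OF allI, OF this] obtain xs where "\<forall>n. xs n \<in> M \<and> (\<forall>i<n. code W M d (xs n) i = g i)" ..
  then have xs: "xs n \<in> M" "i < n \<Longrightarrow> code W M d (xs n) i = g i" for n i by auto
  have ctr_xs: "ctr i (xs n) = fst (g i)" if "i < n" for i n
    using xs(2)[OF that] by (simp add: code_def Let_def prod_eq_iff)
  have near: "d (xs m) (xs n) < 2 * (1/2)^i" if "i < m" "i < n" for i m n
    using that by (intro code_close xs(1)) (simp add: xs(2))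
  have "MCauchy xs"
    unfolding MCauchy_def
  proof (intro conjI allI impI)
    show "range xs \<subseteq> M" using xs(1) by blast
    fix e :: real assume e: "e > 0"
    then obtain k where k: "(1/2::real)^k < e / 2" using half_power_less[of "e / 2"] by auto
    have "d (xs m) (xs n) < e" if "Suc k \<le> m" "Suc k \<le> n" for m n
      using near[of k m n] that k by simp
    then show "\<exists>N. \<forall>n n'. N \<le> n \<longrightarrow> N \<le> n' \<longrightarrow> d (xs n) (xs n') < e" by blast
  qed
  then obtain x where lim: "limitin mtopology xs x sequentially"
    using assms unfolding mcomplete_def by blast
  then have xM: "x \<in> M" by (simp add: limitin_def)
  have ev: "\<exists>k\<ge>l. xs k \<in> V" if "openin mtopology V" "x \<in> V" for V l
  proof -
    have "eventually (\<lambda>k. xs k \<in> V) sequentially" using lim that by (simp add: limitin_def)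
    then have "eventually (\<lambda>k. xs k \<in> V \<and> l \<le> k) sequentially"
      by (rule eventually_conj) (rule eventually_ge_at_top)
    then show ?thesis using eventually_sequentially by auto
  qed
  have le: "d (fst (g i)) x \<le> (1/2)^i" and gM: "fst (g i) \<in> M" for i
  proof -
    show gM: "fst (g i) \<in> M" using ctr_xs[of i "Suc i"] code_centre(1)[OF xs(1)] by (metis lessI)
    show "d (fst (g i)) x \<le> (1/2)^i"
    proof (rule ccontr)
      assume "\<not> d (fst (g i)) x \<le> (1/2)^i"
      then have "x \<in> M - mcball (fst (g i)) ((1/2)^i)" using xM by simp
      moreover have "openin mtopology (M - mcball (fst (g i)) ((1/2)^i))"
        using closedin_mcball[of "fst (g i)" "(1/2)^i"] by (simp add: closedin_def)
      ultimately obtain k where k: "k \<ge> Suc i" "xs k \<in> M - mcball (fst (g i)) ((1/2)^i)" using ev by blast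
      then show False using code_centre(2)[OF xs(1), where n = i, of k] ctr_xs[of i k] gM xs(1) by auto
    qed
  qed
  \<comment> \<open>All the centres involved are read off from one point \<open>xs k\<close> with
    \<open>k\<close> beyond both indices.\<close>
  have cert: "d (fst (g m)) (fst (g n)) + (1/2)^m < (1/2)^n \<and>
      (\<forall>j<m. \<not> d (fst (g j)) (fst (g n)) + (1/2)^j < (1/2)^n)" if m: "m = snd (g n)" for m n
  proof -
    define k where "k = Suc (max m n)"
    have mk: "m < k" "n < k" by (auto simp: k_def)
    let ?P = "\<lambda>m. d (ctr m (xs k)) (ctr n (xs k)) + (1/2)^m < (1/2)^n"
    have "snd (code W M d (xs k) n) = m" using xs(2)[OF mk(2)] m by simp
    then have mL: "m = (LEAST m. ?P m)" by (simp add: code_def Let_def)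
    \<comment> \<open>The point \<open>xs k\<close> lies strictly inside the ball around its
      \<open>n\<close>-th centre, so the ball around its \<open>m\<close>-th centre fits in for
      large \<open>m\<close>.\<close>
    have exP: "\<exists>m. ?P m"
    proof -
      have ar: "a + p < q" if "a < p + b" "p < (q - b) / 2" for a b p q :: real
        using that by (simp add: field_simps)
      let ?c = "ctr n (xs k)"
      have c: "d ?c (xs k) < (1/2)^n" "?c \<in> M" using code_centre[OF xs(1)] by auto
      then obtain m where m: "(1/2::real)^m < ((1/2)^n - d ?c (xs k)) / 2"
        using half_power_less[of "((1/2)^n - d ?c (xs k)) / 2"] by auto
      have "d (ctr m (xs k)) (xs k) < (1/2)^m" "ctr m (xs k) \<in> M" using code_centre[OF xs(1)] by auto
      then have "d (ctr m (xs k)) ?c < (1/2)^m + d ?c (xs k)"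
        using triangle'[of "ctr m (xs k)" "xs k" ?c] c xs(1)[of k] by auto
      then show ?thesis using ar[OF _ m] by (intro exI[of _ m]) simp
    qed
    have Pm: "?P m" unfolding mL by (rule LeastI_ex[OF exP])
    have "\<forall>j<m. \<not> ?P j" unfolding mL using not_less_Least by blast
    note Pm this
    then show ?thesis using ctr_xs[OF mk(1)] ctr_xs[OF mk(2)] ctr_xs[OF less_trans[OF _ mk(1)]] by simp
  qed
  have centre: "ctr n x = fst (g n)" for n
  proof (rule code_centre_unique[OF xM gM])
    \<comment> \<open>The certificate \<open>snd (g n)\<close> names a smaller ball well inside, and
      \<open>x\<close> lies at least in the closure of that one.\<close>
    show "d (fst (g n)) x < (1/2)^n"
      using triangle[OF gM gM xM, of n "snd (g n)"] cert[OF refl, of n] le[of "snd (g n)"]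
      by (auto simp: commute)
    fix c assume c: "c \<in> M" "(c, fst (g n)) \<in> W"
    show "\<not> d c x < (1/2)^n"
    proof
      assume "d c x < (1/2)^n"
      then have "x \<in> mball c ((1/2)^n)" using c xM by simp
      then obtain k where k: "k \<ge> Suc n" "xs k \<in> mball c ((1/2)^n)" using ev openin_mball by blast
      then show False using code_centre(3)[OF xs(1), where n = n and c = c, of k] ctr_xs[of n k] c by auto
    qed
  qed
  have "code W M d x n = g n" for n
  proof -
    have "(LEAST m. d (ctr m x) (ctr n x) + (1/2)^m < (1/2)^n) = snd (g n)"
      unfolding centre using cert[OF refl, of n] by (intro Least_equality) (auto simp: not_less[symmetric])
    then show ?thesis by (simp add: code_def Let_def centre prod_eq_iff)
  qed
  then show "g \<in> code W M d ` M" using xM by (intro image_eqI[of _ _ x]) auto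
qed

end

end

section \<open>Closed sets of sequences and their trees\<close>

lemma card_Un_le:
  assumes "|A| \<le>o |Z|" "|B| \<le>o |Z|" "infinite Z"
  shows "|A \<union> B| \<le>o |Z|"
proof -
  have "|UNIV :: bool set| \<le>o |UNIV :: nat set|"
    by (rule card_of_ordLeqI[where f = of_bool]) (auto simp: inj_def)
  then have "|UNIV :: bool set| \<le>o |Z|"
    using assms(3) ordLeq_transitive by (auto simp: infinite_iff_card_of_nat)
  then have "|\<Union>i\<in>UNIV. if i then A else B| \<le>o |Z|"
    by (rule card_Union_le[OF _ _ assms(3)]) (use assms in simp)
  then show ?thesis by (simp add: UNIV_bool Un_commute)
qed

lemma card_Times_nat_less:
  assumes "|A| <o |K|" "|UNIV :: nat set| <o |K|"
  shows "|A \<times> (UNIV :: nat set)| <o |K|"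
proof (cases "finite A")
  case True
  have "|A| \<le>o |UNIV :: nat set|"
    using countable_finite[OF True] by (auto simp: countable_def card_of_ordLeq[symmetric])
  then have "|A \<times> (UNIV :: nat set)| \<le>o |UNIV :: nat set|"
    by (intro card_Times_le) (simp_all add: card_of_mono1)
  then show ?thesis using assms(2) ordLeq_ordLess_trans by blast
next
  case False
  then have "|A \<times> (UNIV :: nat set)| \<le>o |A|"
    by (intro card_Times_le) (simp_all add: card_of_mono1 infinite_iff_card_of_nat)
  then show ?thesis using assms(1) ordLeq_ordLess_trans by blast
qed

lemma tree_mono: "F \<subseteq> G \<Longrightarrow> tree F \<subseteq> tree G"
  by (auto simp: tree_def)

lemma ini_in_tree: "g \<in> F \<Longrightarrow> ini g n \<in> tree F"
  by (auto simp: tree_def)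

lemma take_ini: "take m (ini g n) = ini g (min m n)"
  by (rule nth_equalityI) (simp_all add: ini_def)

lemma take_in_tree: "t \<in> tree F \<Longrightarrow> take m t \<in> tree F"
  unfolding tree_def using take_ini by blast

lemma tree_nonempty: "F \<noteq> {} \<Longrightarrow> tree F \<noteq> {}"
  by (auto simp: tree_def)

definition cyl :: "'k list \<Rightarrow> (nat \<Rightarrow> 'k) set" where
  "cyl s = {g. ini g (length s) = s}"

definition below :: "(nat \<Rightarrow> 'k) set \<Rightarrow> 'k list \<Rightarrow> 'k list set" where
  "below F s = {t \<in> tree F. length s < length t \<and> take (length s) t = s}"

lemma seq_closed_Int: "seq_closed F \<Longrightarrow> seq_closed G \<Longrightarrow> seq_closed (F \<inter> G)"
  unfolding seq_closed_def using tree_mono[of "F \<inter> G" F] tree_mono[of "F \<inter> G" G] by blast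

lemma seq_closed_cyl: "seq_closed (cyl s)"
  unfolding seq_closed_def
proof (intro allI impI)
  fix g assume "\<forall>n. ini g n \<in> tree (cyl s)"
  then obtain f m where f: "f \<in> cyl s" "ini g (length s) = ini f m" unfolding tree_def by blast
  then have "length (ini g (length s)) = length (ini f m)" by simp
  then have "m = length s" by simp
  then show "g \<in> cyl s" using f by (simp add: cyl_def)
qed

lemma seq_closed_Diff_cyl:
  assumes "seq_closed F"
  shows "seq_closed (F - (\<Union>s\<in>S. cyl s))"
  unfolding seq_closed_def
proof (intro allI impI)
  let ?F = "F - (\<Union>s\<in>S. cyl s)"
  fix g assume g: "\<forall>n. ini g n \<in> tree ?F"
  have "g \<notin> cyl s" if "s \<in> S" for s
  proof
    assume "g \<in> cyl s"
    then have "ini g (length s) = s" by (simp add: cyl_def)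
    then have "s \<in> tree ?F" using g[rule_format, of "length s"] by simp
    then obtain f m where f: "f \<in> ?F" "s = ini f m" unfolding tree_def by blast
    then have "f \<in> cyl s" by (simp add: cyl_def)
    then show False using f \<open>s \<in> S\<close> by blast
  qed
  moreover have "g \<in> F"
    using assms g tree_mono[of ?F F] unfolding seq_closed_def by blast
  ultimately show "g \<in> ?F" by blast
qed

text \<open>The continuous injections of the Cantor space into a countable product of discrete
  spaces.\<close>

definition seq_map :: "((nat \<Rightarrow> bool) \<Rightarrow> nat \<Rightarrow> 'k) \<Rightarrow> bool" where
  "seq_map e \<longleftrightarrow> inj e \<and> (\<forall>f n. \<exists>m. \<forall>g. (\<forall>i<m. g i = f i) \<longrightarrow> ini (e g) n = ini (e f) n)"

definition seq_copies :: "(nat \<Rightarrow> 'k) set \<Rightarrow> (nat \<Rightarrow> 'k) set set \<Rightarrow> bool" where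
  "seq_copies F \<M> \<longleftrightarrow> disjoint \<M> \<and> \<Union>\<M> \<subseteq> F \<and> (\<forall>M\<in>\<M>. \<exists>e. seq_map e \<and> range e = M)"

text \<open>
  Measuring each part of the leftover by its own tree, and not by a cardinal fixed in advance,
  makes the bound local: it is inherited by the trace of the leftover on any open set.
\<close>

definition good :: "(nat \<Rightarrow> 'k) set \<Rightarrow> bool" where
  "good F \<longleftrightarrow> (\<exists>\<M>. seq_copies F \<M> \<and> (\<forall>A\<subseteq>F - \<Union>\<M>. |A| \<le>o |tree A \<times> \<CC>| ))"

text \<open>Such a set has at most continuum many points, so the factor continuum in the bound
  allows the empty family.\<close>

lemma good_small:
  fixes F :: "(nat \<Rightarrow> 'k) set"
  assumes "|tree F| \<le>o |\<CC>|"
  shows "good F"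
proof -
  have "|F| \<le>o |seqs (tree F)|"
  proof (rule card_of_ordLeqI[where f = ini])
    show "inj_on ini F"
    proof (rule inj_onI, rule ext)
      fix f g :: "nat \<Rightarrow> 'k" and n assume "ini f = ini g"
      then have "ini f (Suc n) = ini g (Suc n)" by simp
      then show "f n = g n" by (simp add: ini_eq_iff)
    qed
  qed (auto simp: seqs_def ini_in_tree)
  also have "|seqs (tree F)| \<le>o |\<CC>|" by (rule ordLeq_transitive[OF seqs_mono[OF assms] seqs_cantor_set])
  finally have F: "|F| \<le>o |\<CC>|" .
  have "|A| \<le>o |tree A \<times> \<CC>|" if "A \<subseteq> F" for A
  proof (cases "A = {}")
    case False
    show ?thesis
      by (rule ordLeq_transitive[OF ordLeq_transitive[OF card_of_mono1[OF that] F]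
            cantor_set_le_Times[OF tree_nonempty[OF False]]])
  qed (simp add: card_of_empty)
  then show ?thesis unfolding good_def by (intro exI[of _ "{}"]) (simp add: seq_copies_def)
qed

text \<open>The minimal members of \<open>S\<close> have disjoint cylinders with the same union, so
  the families can be united. A leftover \<open>A\<close> meets the cylinder of \<open>s\<close>
  only if \<open>s\<close> is in \<open>tree A\<close>, which bounds the number of parts to be added
  up.\<close>

lemma good_Union_cyl:
  fixes B :: "(nat \<Rightarrow> 'k) set"
  assumes B0: "good (B - (\<Union>s\<in>S. cyl s))" and Bs: "\<And>s. s \<in> S \<Longrightarrow> good (B \<inter> cyl s)"
  shows "good B"
proof -
  define S' where "S' = {s \<in> S. \<forall>k<length s. take k s \<notin> S}"
  have UN: "(\<Union>s\<in>S. cyl s) = (\<Union>s\<in>S'. cyl s)"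
  proof (intro equalityI subsetI)
    fix g assume "g \<in> (\<Union>s\<in>S. cyl s)"
    then have ex: "\<exists>n. ini g n \<in> S" by (auto simp: cyl_def) metis
    define n where "n = (LEAST n. ini g n \<in> S)"
    have "ini g n \<in> S" unfolding n_def using ex by (rule LeastI_ex)
    moreover have "ini g k \<notin> S" if "k < n" for k using not_less_Least that unfolding n_def by blast
    ultimately have "ini g n \<in> S'" by (simp add: S'_def take_ini)
    moreover have "g \<in> cyl (ini g n)" by (simp add: cyl_def)
    ultimately show "g \<in> (\<Union>s\<in>S'. cyl s)" by blast
  qed (auto simp: S'_def)
  have uniq: "s = t" if "s \<in> S'" "t \<in> S'" "g \<in> cyl s" "g \<in> cyl t" for s t g
  proof -
    have st: "s = ini g (length s)" "t = ini g (length t)" using that by (simp_all add: cyl_def)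
    consider "length s < length t" | "length t < length s" | "length s = length t" by linarith
    then show ?thesis
    proof cases
      case 1
      then have "take (length s) t = s" using st by (metis take_ini min.absorb1 less_imp_le)
      then show ?thesis using that(1,2) 1 by (auto simp: S'_def)
    next
      case 2
      then have "take (length t) s = t" using st by (metis take_ini min.absorb1 less_imp_le)
      then show ?thesis using that(1,2) 2 by (auto simp: S'_def)
    next
      case 3 then show ?thesis using st by metis
    qed
  qed
  define B0 where "B0 = B - (\<Union>s\<in>S'. cyl s)"
  obtain \<M>0 where M0: "seq_copies B0 \<M>0" "\<And>A. A \<subseteq> B0 - \<Union>\<M>0 \<Longrightarrow> |A| \<le>o |tree A \<times> \<CC>|"
    using assms(1) unfolding good_def UN B0_def by blast
  have "\<forall>s\<in>S'. \<exists>\<M>. seq_copies (B \<inter> cyl s) \<M> \<and> (\<forall>A\<subseteq>B \<inter> cyl s - \<Union>\<M>. |A| \<le>o |tree A \<times> \<CC>| )"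
    using Bs unfolding good_def S'_def by simp
  from bchoice[OF this] obtain \<N>
    where N': "\<forall>s\<in>S'. seq_copies (B \<inter> cyl s) (\<N> s) \<and> (\<forall>A\<subseteq>B \<inter> cyl s - \<Union>(\<N> s). |A| \<le>o |tree A \<times> \<CC>| )" ..
  then have N: "seq_copies (B \<inter> cyl s) (\<N> s)"
      "A \<subseteq> B \<inter> cyl s - \<Union>(\<N> s) \<Longrightarrow> |A| \<le>o |tree A \<times> \<CC>|" if "s \<in> S'" for s A
    using that by blast+
  define \<M> where "\<M> = \<M>0 \<union> (\<Union>s\<in>S'. \<N> s)"
  have sub0: "P \<subseteq> B0" if "P \<in> \<M>0" for P using M0(1) that by (auto simp: seq_copies_def)
  have subN: "P \<subseteq> B \<inter> cyl s" if "P \<in> \<N> s" "s \<in> S'" for P s using N(1)[OF that(2)] that(1) unfolding seq_copies_def by blast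
  have dis0N: "P \<inter> Q = {}" if "P \<in> \<M>0" "Q \<in> \<N> s" "s \<in> S'" for P Q s
    using sub0[OF that(1)] subN[OF that(2,3)] that(3) by (auto simp: B0_def)
  have disNN: "P \<inter> Q = {}" if "P \<in> \<N> s" "s \<in> S'" "Q \<in> \<N> t" "t \<in> S'" "P \<noteq> Q" for P Q s t
  proof (cases "s = t")
    case True
    then show ?thesis using N(1)[OF that(2)] that unfolding seq_copies_def disjoint_def by blast
  next
    case False
    then show ?thesis using subN[OF that(1,2)] subN[OF that(3,4)] uniq[OF that(2,4)] by blast
  qed
  have "disjoint \<M>"
  proof (rule disjointI)
    fix P Q assume PQ: "P \<in> \<M>" "Q \<in> \<M>" "P \<noteq> Q"
    consider "P \<in> \<M>0" "Q \<in> \<M>0" | s where "P \<in> \<M>0" "Q \<in> \<N> s" "s \<in> S'" | s where "Q \<in> \<M>0" "P \<in> \<N> s" "s \<in> S'"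
      | s t where "P \<in> \<N> s" "s \<in> S'" "Q \<in> \<N> t" "t \<in> S'" using PQ unfolding \<M>_def by blast
    then show "P \<inter> Q = {}"
    proof cases
      case 1 then show ?thesis using M0(1) PQ(3) unfolding seq_copies_def disjoint_def by blast
    next
      case 2 then show ?thesis by (rule dis0N)
    next
      case 3 then show ?thesis using dis0N by blast
    next
      case 4 then show ?thesis using PQ(3) by (rule disNN)
    qed
  qed
  moreover have "\<exists>e. seq_map e \<and> range e = M" if "M \<in> \<M>" for M
  proof -
    consider "M \<in> \<M>0" | s where "M \<in> \<N> s" "s \<in> S'" using \<open>M \<in> \<M>\<close> unfolding \<M>_def by blast
    then show ?thesis
    proof cases
      case 1 then show ?thesis using M0(1) by (simp add: seq_copies_def)
    next
      case 2 then show ?thesis using N(1)[OF 2(2)] by (simp add: seq_copies_def)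
    qed
  qed
  moreover have "\<Union>\<M> \<subseteq> B" using sub0 subN unfolding \<M>_def B0_def by blast
  ultimately have sM: "seq_copies B \<M>" unfolding seq_copies_def by blast
  have "|A| \<le>o |tree A \<times> \<CC>|" if A: "A \<subseteq> B - \<Union>\<M>" for A
  proof (cases "A = {}")
    case False
    let ?Z = "tree A \<times> \<CC>"
    have inf: "infinite ?Z" by (rule infinite_Times_cantor_set[OF tree_nonempty[OF False]])
    have mono: "|tree A' \<times> \<CC>| \<le>o |?Z|" if "A' \<subseteq> A" for A'
      by (rule card_of_mono1) (use tree_mono[OF that] in auto)
    have 0: "|A \<inter> B0| \<le>o |?Z|"
      by (rule ordLeq_transitive[OF M0(2) mono]) (use A in \<open>auto simp: \<M>_def\<close>)
    have 1: "|\<Union>s\<in>S' \<inter> tree A. A \<inter> cyl s| \<le>o |?Z|"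
    proof (rule card_Union_le[OF _ _ inf])
      show "|S' \<inter> tree A| \<le>o |?Z|"
        by (rule ordLeq_transitive[OF card_of_mono1 le_Times_cantor_set]) auto
      fix s assume s: "s \<in> S' \<inter> tree A"
      show "|A \<inter> cyl s| \<le>o |?Z|"
        by (rule ordLeq_transitive[OF N(2) mono]) (use A s in \<open>auto simp: \<M>_def\<close>)
    qed
    have "A \<subseteq> (A \<inter> B0) \<union> (\<Union>s\<in>S' \<inter> tree A. A \<inter> cyl s)"
    proof
      fix g assume g: "g \<in> A"
      show "g \<in> (A \<inter> B0) \<union> (\<Union>s\<in>S' \<inter> tree A. A \<inter> cyl s)"
      proof (cases "g \<in> B0")
        case False
        then obtain s where s: "s \<in> S'" "g \<in> cyl s" using g A by (auto simp: B0_def)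
        then have "s \<in> tree A" using ini_in_tree[OF g, of "length s"] by (simp add: cyl_def)
        then show ?thesis using s g by blast
      qed (use g in blast)
    qed
    then have "|A| \<le>o |(A \<inter> B0) \<union> (\<Union>s\<in>S' \<inter> tree A. A \<inter> cyl s)|" by (rule card_of_mono1)
    also have "|(A \<inter> B0) \<union> (\<Union>s\<in>S' \<inter> tree A. A \<inter> cyl s)| \<le>o |?Z|"
      by (rule card_Un_le[OF 0 1 inf])
    finally show ?thesis .
  qed (simp add: card_of_empty)
  then show ?thesis using sM unfolding good_def by blast
qed

text \<open>A level with \<open>|K|\<close> nodes below \<open>s\<close> serves at once. Otherwise
  the nodes below \<open>s\<close> form countably many smaller levels \<open>L n\<close>. Then
  infinitely many nodes \<open>t n\<close> of one level \<open>m\<close> are refined,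
  \<open>t n\<close> to a level at least as large as \<open>L n\<close>; without such a level, fewer
  than \<open>|K|\<close> nodes would lie below \<open>t n\<close>.\<close>

lemma homogeneous_antichain:
  fixes F :: "(nat \<Rightarrow> 'k) set"
  defines "K \<equiv> tree F"
  assumes uncount: "|UNIV :: nat set| <o |K|"
    and hom: "\<And>s. s \<in> K \<Longrightarrow> |K| \<le>o |below F s|"
    and s: "s \<in> K"
  shows "\<exists>A. A \<subseteq> below F s \<and> (\<forall>g\<in>F \<inter> cyl s. \<exists>!t. t \<in> A \<and> g \<in> cyl t) \<and> |K| \<le>o |A|"
proof -
  define level where "level u n = {t \<in> below F u. length t = n}" for u n
  have lev: "level u n \<subseteq> below F u" for u n by (auto simp: level_def)
  have ini_level: "ini g n \<in> level u n" if "g \<in> F" "g \<in> cyl u" "length u < n" for g u n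
    using that ini_in_tree[OF that(1), of n] by (auto simp: level_def below_def cyl_def take_ini)
  have level_cyl: "t = ini g n" if "t \<in> level u n" "g \<in> cyl t" for t u n g
    using that by (auto simp: level_def cyl_def)
  have cyl_take: "g \<in> cyl u" if "t \<in> below F u" "g \<in> cyl t" for t u g
    using that take_ini[of "length u" g "length t"] by (auto simp: below_def cyl_def)
  show ?thesis
  proof (cases "\<exists>n>length s. |K| \<le>o |level s n|")
    case True
    then obtain n where n: "n > length s" "|K| \<le>o |level s n|" by blast
    have "\<exists>!t. t \<in> level s n \<and> g \<in> cyl t" if "g \<in> F \<inter> cyl s" for g
    proof (rule ex1I[of _ "ini g n"])
      show "ini g n \<in> level s n \<and> g \<in> cyl (ini g n)" using ini_level n(1) that by (simp add: cyl_def)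
    qed (use level_cyl in blast)
    then show ?thesis using n lev by (intro exI[of _ "level s n"]) blast
  next
    case False
    then have lt: "|level s n| <o |K|" if "n > length s" for n
      using that not_card_le_iff_less by blast
    define L where "L n = level s (Suc (length s + n))" for n
    have belowL: "below F s = (\<Union>n. L n)"
    proof (intro equalityI subsetI)
      fix t assume t: "t \<in> below F s"
      then have "t \<in> L (length t - Suc (length s))" by (auto simp: L_def level_def below_def)
      then show "t \<in> (\<Union>n. L n)" by blast
    qed (auto simp: L_def level_def)
    have "\<exists>n. infinite (L n)"
    proof (rule ccontr)
      assume "\<not> (\<exists>n. infinite (L n))"
      then have "countable (below F s)" unfolding belowL by (intro countable_UN) (auto intro: countable_finite)
      then have "|below F s| \<le>o |UNIV :: nat set|"
        by (auto simp: countable_def card_of_ordLeq[symmetric])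
      then have "|K| \<le>o |UNIV :: nat set|" using hom[OF s] ordLeq_transitive by blast
      then show False using uncount not_ordLess_ordLeq by blast
    qed
    then obtain m where m: "m > length s" "infinite (level s m)" unfolding L_def by (metis less_add_Suc1)
    obtain t :: "nat \<Rightarrow> 'k list" where t: "inj t" "range t \<subseteq> level s m"
      using infinite_countable_subset[OF m(2)] by blast
    have tK: "t n \<in> K" and lt_t: "length (t n) = m" for n
      using t(2) by (auto simp: level_def below_def K_def)
    have "\<exists>k>m. |L n| \<le>o |level (t n) k|" for n
    proof (rule ccontr)
      assume "\<not> (\<exists>k>m. |L n| \<le>o |level (t n) k| )"
      then have l: "|level (t n) k| <o |L n|" if "k > m" for k
        using that not_card_le_iff_less by blast
      have ne: "L n \<noteq> {}"
      proof -
        obtain g k where g: "g \<in> F" "s = ini g k" using s by (auto simp: K_def tree_def)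
        then have "ini g (Suc (length s + n)) \<in> L n" unfolding L_def by (intro ini_level) (auto simp: cyl_def)
        then show ?thesis by blast
      qed
      let ?Z = "L n \<times> (UNIV :: nat set)"
      have infZ: "infinite ?Z" using ne finite_cartesian_productD2 by blast
      have "below F (t n) = (\<Union>k\<in>{m<..}. level (t n) k)"
        by (auto simp: level_def below_def lt_t)
      moreover have "|\<Union>k\<in>{m<..}. level (t n) k| \<le>o |?Z|"
      proof (rule card_Union_le[OF _ _ infZ])
        have "|{m<..}| \<le>o |UNIV :: nat set|" by (rule card_of_mono1) simp
        then show "|{m<..}| \<le>o |?Z|" using card_of_Times2[OF ne] ordLeq_transitive by blast
        fix k assume "k \<in> {m<..}"
        then have "|level (t n) k| \<le>o |L n|" using l ordLess_imp_ordLeq by auto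
        then show "|level (t n) k| \<le>o |?Z|" by (rule ordLeq_transitive) (simp add: card_of_Times1)
      qed
      moreover have "|?Z| <o |K|"
        by (rule card_Times_nat_less[OF _ uncount]) (use lt in \<open>simp add: L_def\<close>)
      ultimately have "|below F (t n)| <o |K|" using ordLeq_ordLess_trans by metis
      then show False using hom[OF tK] not_ordLess_ordLeq by blast
    qed
    then obtain \<mu> where \<mu>: "\<And>n. \<mu> n > m" "\<And>n. |L n| \<le>o |level (t n) (\<mu> n)|" by metis
    define A where "A = (level s m - range t) \<union> (\<Union>n. level (t n) (\<mu> n))"
    have below_t: "v \<in> below F s" if "v \<in> below F (t n)" for v n
    proof -
      have "t n \<in> below F s" using t(2) lev by blast
      then have "take (length s) (t n) = s" "length s < length (t n)" by (auto simp: below_def)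
      then have "take (length s) (take (length (t n)) v) = s" using that by (simp add: below_def)
      then show ?thesis using that \<open>length s < length (t n)\<close> by (auto simp: below_def)
    qed
    have "A \<subseteq> below F s" using lev below_t unfolding A_def by blast
    moreover have "\<exists>!v. v \<in> A \<and> g \<in> cyl v" if g: "g \<in> F \<inter> cyl s" for g
    proof (cases "ini g m \<in> range t")
      case True
      then obtain n where n: "ini g m = t n" by auto
      then have gt: "g \<in> cyl (t n)" by (simp add: cyl_def lt_t)
      show ?thesis
      proof (rule ex1I[of _ "ini g (\<mu> n)"])
        show "ini g (\<mu> n) \<in> A \<and> g \<in> cyl (ini g (\<mu> n))"
          using ini_level[OF _ gt, of "\<mu> n"] g \<mu>(1) lt_t by (auto simp: A_def cyl_def)
        fix v assume v: "v \<in> A \<and> g \<in> cyl v"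
        then consider "v \<in> level s m" "v \<notin> range t" | k where "v \<in> level (t k) (\<mu> k)"
          unfolding A_def by blast
        then show "v = ini g (\<mu> n)"
        proof cases
          case 1
          then have "v = ini g m" using level_cyl v by blast
          then show ?thesis using 1 n by auto
        next
          case (2 k)
          then have "g \<in> cyl (t k)" using cyl_take v lev by blast
          then have "t k = t n" using n by (simp add: cyl_def lt_t)
          then have "k = n" using t(1) by (simp add: inj_eq)
          then show ?thesis using 2 v level_cyl by blast
        qed
      qed
    next
      case False
      show ?thesis
      proof (rule ex1I[of _ "ini g m"])
        show "ini g m \<in> A \<and> g \<in> cyl (ini g m)"
          using ini_level[of g s m] g m(1) False by (auto simp: A_def cyl_def)
        fix v assume v: "v \<in> A \<and> g \<in> cyl v"
        then consider "v \<in> level s m" | k where "v \<in> level (t k) (\<mu> k)"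
          unfolding A_def by blast
        then show "v = ini g m"
        proof cases
          case 1
          then show ?thesis using level_cyl v by blast
        next
          case (2 k)
          then have "g \<in> cyl (t k)" using cyl_take v lev by blast
          then show ?thesis using False by (auto simp: cyl_def lt_t)
        qed
      qed
    qed
    moreover have "|K| \<le>o |A|"
    proof -
      have "\<forall>n. \<exists>f. inj_on f (L n) \<and> f ` L n \<subseteq> level (t n) (\<mu> n)"
        using \<mu>(2) unfolding card_of_ordLeq[symmetric] by blast
      from choice[OF this] obtain f where f: "\<forall>n. inj_on (f n) (L n) \<and> f n ` L n \<subseteq> level (t n) (\<mu> n)" ..
      have "|K| \<le>o |\<Union>n. L n|" using hom[OF s] by (simp add: belowL)
      also have "|\<Union>n. L n| \<le>o |SIGMA n:UNIV. L n|" by (rule card_of_UNION_Sigma)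
      \<comment> \<open>The refinements of different nodes \<open>t n\<close> are disjoint, so their
        sizes add up.\<close>
      also have "|SIGMA n:UNIV. L n| \<le>o |A|"
      proof (rule card_of_ordLeqI[where f = "\<lambda>(n, u). f n u"])
        show "inj_on (\<lambda>(n, u). f n u) (SIGMA n:UNIV. L n)"
        proof (rule inj_onI, clarify)
          fix n u k v assume h: "u \<in> L n" "v \<in> L k" "f n u = f k v"
          then have "f n u \<in> level (t n) (\<mu> n)" "f n u \<in> level (t k) (\<mu> k)" using f by (blast, metis image_subset_iff)
          then have "t n = t k" by (auto simp: level_def below_def lt_t)
          then have "n = k" using t(1) by (simp add: inj_eq)
          then show "n = k \<and> u = v" using h f by (metis inj_on_eq_iff)
        qed
      qed (use f in \<open>auto simp: A_def\<close>)
      finally show ?thesis .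
    qed
    ultimately show ?thesis by (intro exI[of _ A]) simp
  qed
qed

text \<open>Each antichain \<open>A s\<close> has as many members as there are pairs in K x 2, so a
  sequence of pairs steers through nested nodes to a point of \<open>F\<close>, and every point is
  reached exactly once. With the first components fixed, the free bits trace out a Cantor
  set.\<close>

lemma good_homogeneous:
  fixes F :: "(nat \<Rightarrow> 'k) set"
  assumes closed: "seq_closed F" and uncount: "|UNIV :: nat set| <o |tree F|"
    and hom: "\<And>s. s \<in> tree F \<Longrightarrow> |tree F| \<le>o |below F s|"
  shows "good F"
proof -
  define K where "K = tree F"
  have inf: "infinite K"
    using ordLess_imp_ordLeq[OF uncount] by (simp add: infinite_iff_card_of_nat K_def)
  have Kne: "[] \<in> K"
  proof -
    obtain t where "t \<in> K" using inf by fastforce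
    then show ?thesis unfolding K_def using take_in_tree[of t F 0] by simp
  qed
  have "\<forall>s\<in>K. \<exists>A. A \<subseteq> below F s \<and> (\<forall>g\<in>F \<inter> cyl s. \<exists>!t. t \<in> A \<and> g \<in> cyl t) \<and> |K| \<le>o |A|"
    using homogeneous_antichain[OF uncount hom] unfolding K_def by simp
  from bchoice[OF this] obtain A where A:
    "\<forall>s\<in>K. A s \<subseteq> below F s \<and> (\<forall>g\<in>F \<inter> cyl s. \<exists>!t. t \<in> A s \<and> g \<in> cyl t) \<and> |K| \<le>o |A s|" ..
  have "\<exists>b. bij_betw b (K \<times> (UNIV :: bool set)) (A s)" if s: "s \<in> K" for s
  proof -
    have "|K \<times> (UNIV :: bool set)| \<le>o |K|"
    proof (rule card_Times_le[OF card_of_mono1[OF subset_refl] _ inf])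
      have "|UNIV :: bool set| \<le>o |UNIV :: nat set|"
        by (rule card_of_ordLeqI[where f = of_bool]) (auto simp: inj_def)
      then show "|UNIV :: bool set| \<le>o |K|" using inf ordLeq_transitive by (auto simp: infinite_iff_card_of_nat)
    qed
    then have 1: "|K \<times> (UNIV :: bool set)| \<le>o |A s|" using A s ordLeq_transitive by blast
    have "A s \<subseteq> K" using A s by (auto simp: below_def K_def)
    then have "|A s| \<le>o |K|" by (rule card_of_mono1)
    then have "|A s| \<le>o |K \<times> (UNIV :: bool set)|" by (rule ordLeq_transitive) (simp add: card_of_Times1)
    then show ?thesis using 1 unfolding card_of_ordIso by (simp add: ordIso_iff_ordLeq)
  qed
  then have "\<forall>s\<in>K. \<exists>b. bij_betw b (K \<times> (UNIV :: bool set)) (A s)" by blast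
  from bchoice[OF this] obtain b where b: "\<forall>s\<in>K. bij_betw (b s) (K \<times> (UNIV :: bool set)) (A s)" ..
  \<comment> \<open>The node reached after \<open>n\<close> choices. It has length at least
    \<open>n\<close>, so the first \<open>n\<close> choices determine \<open>n\<close> entries of
    the limit; this is the continuity of \<open>e\<close> below.\<close>
  define nd where "nd u n = rec_nat [] (\<lambda>n s. b s (u n)) n" for u :: "nat \<Rightarrow> 'k list \<times> bool" and n
  have nd0: "nd u 0 = []" and ndS: "nd u (Suc n) = b (nd u n) (u n)" for u n by (simp_all add: nd_def)
  define U where "U = {u :: nat \<Rightarrow> 'k list \<times> bool. \<forall>n. fst (u n) \<in> K}"
  have bA: "b s p \<in> A s" if "s \<in> K" "fst p \<in> K" for s p
    using bij_betw_apply[of "b s" "K \<times> UNIV" "A s" p] b that by (simp add: mem_Times_iff)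
  have AK: "t \<in> K" "length s < length t" "take (length s) t = s" if "s \<in> K" "t \<in> A s" for s t
    using A that by (auto simp: below_def K_def)
  have ndK: "nd u n \<in> K" if "u \<in> U" for u n
  proof (induction n)
    case (Suc n)
    then show ?case using AK(1)[OF Suc bA[OF Suc]] that by (simp add: ndS U_def)
  qed (simp add: nd0 Kne)
  have ndA: "nd u (Suc n) \<in> A (nd u n)" if "u \<in> U" for u n
    using bA[OF ndK[OF that]] that by (simp add: ndS U_def)
  have step: "length (nd u n) < length (nd u (Suc n))" "take (length (nd u n)) (nd u (Suc n)) = nd u n" if "u \<in> U" for u n
    using AK(2,3)[OF ndK[OF that] ndA[OF that]] by auto
  have len: "n \<le> length (nd u n)" if "u \<in> U" for u n
  proof (induction n)
    case (Suc n) then show ?case using step(1)[OF that, of n] by linarith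
  qed simp
  have pre: "length (nd u m) \<le> length (nd u n) \<and> take (length (nd u m)) (nd u n) = nd u m" if "u \<in> U" "m \<le> n" for u m n
    using that(2)
  proof (induction n)
    case (Suc n)
    show ?case
    proof (cases "m = Suc n")
      case False
      then have IH: "length (nd u m) \<le> length (nd u n)" "take (length (nd u m)) (nd u n) = nd u m"
        using Suc by auto
      have "take (length (nd u m)) (take (length (nd u n)) (nd u (Suc n))) = nd u m"
        using step(2)[OF that(1), of n] IH by simp
      then show ?thesis using IH(1) step(1)[OF that(1), of n] by (simp add: min_absorb1)
    qed simp
  qed simp
  \<comment> \<open>Entry \<open>i\<close> is read at stage \<open>Suc i\<close>, where the node is
    certainly longer than \<open>i\<close>.\<close>
  define lm where "lm u i = nd u (Suc i) ! i" for u i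
  have lm: "ini (lm u) (length (nd u n)) = nd u n" if "u \<in> U" for u n
  proof (rule nth_equalityI)
    fix i assume "i < length (ini (lm u) (length (nd u n)))"
    then have i: "i < length (nd u n)" by simp
    have i': "i < length (nd u (Suc i))" using len[OF that, of "Suc i"] by simp
    have "nd u (Suc i) ! i = nd u n ! i"
    proof (cases "Suc i \<le> n")
      case True
      then have "take (length (nd u (Suc i))) (nd u n) = nd u (Suc i)" using pre[OF that] by blast
      then show ?thesis using i' by (metis nth_take)
    next
      case False
      then have "take (length (nd u n)) (nd u (Suc i)) = nd u n" using pre[OF that, of n "Suc i"] by simp
      then show ?thesis using i by (metis nth_take)
    qed
    then show "ini (lm u) (length (nd u n)) ! i = nd u n ! i" using i by (simp add: ini_def lm_def)
  qed simp
  have lmF: "lm u \<in> F" if "u \<in> U" for u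
  proof -
    have "ini (lm u) n \<in> tree F" for n
    proof -
      have "ini (lm u) n = take n (ini (lm u) (length (nd u n)))"
        using len[OF that, of n] by (simp add: take_ini min_absorb1)
      then show ?thesis using take_in_tree ndK[OF that, of n] lm[OF that, of n] by (simp add: K_def)
    qed
    then show ?thesis using closed by (simp add: seq_closed_def)
  qed
  have lmc: "lm u \<in> cyl (nd u n)" if "u \<in> U" for u n using lm[OF that] by (simp add: cyl_def)
  \<comment> \<open>A point passes through only one member of each antichain, so the nodes agree
    stage by stage, and with them the choices.\<close>
  have lm_inj: "u = v" if uv: "u \<in> U" "v \<in> U" "lm u = lm v" for u v
  proof -
    have e: "nd u n = nd v n" for n
    proof (induction n)
      case (Suc n)
      have "\<exists>!t. t \<in> A (nd u n) \<and> lm u \<in> cyl t"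
        using A ndK[OF uv(1)] lmF[OF uv(1)] lmc[OF uv(1)] by blast
      moreover have "nd u (Suc n) \<in> A (nd u n) \<and> lm u \<in> cyl (nd u (Suc n))" using ndA[OF uv(1)] lmc[OF uv(1)] by blast
      moreover have "nd v (Suc n) \<in> A (nd u n) \<and> lm u \<in> cyl (nd v (Suc n))"
        using ndA[OF uv(2)] lmc[OF uv(2)] Suc uv(3) by simp
      ultimately show ?case by blast
    qed (simp add: nd0)
    have "u n = v n" for n
    proof -
      have "b (nd u n) (u n) = b (nd u n) (v n)" using e[of "Suc n"] e[of n] by (simp add: ndS)
      moreover have "inj_on (b (nd u n)) (K \<times> UNIV)" using b ndK[OF uv(1), of n] by (simp add: bij_betw_def)
      ultimately show ?thesis using uv(1,2) by (simp add: U_def inj_on_eq_iff mem_Times_iff)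
    qed
    then show ?thesis by blast
  qed
  have lm_surj: "\<exists>u\<in>U. lm u = g" if g: "g \<in> F" for g
  proof -
    \<comment> \<open>The point itself selects the member of each antichain that it passes
      through.\<close>
    define N where "N n = rec_nat [] (\<lambda>_ s. SOME t. t \<in> A s \<and> g \<in> cyl t) n" for n :: nat
    have NS: "N (Suc n) = (SOME t. t \<in> A (N n) \<and> g \<in> cyl t)" for n by (simp add: N_def)
    have NK: "N n \<in> K \<and> g \<in> cyl (N n)" for n
    proof (induction n)
      case 0 show ?case using Kne by (simp add: N_def cyl_def ini_def)
    next
      case (Suc n)
      then have "\<exists>t. t \<in> A (N n) \<and> g \<in> cyl t" using A g by blast
      from someI_ex[OF this] show ?case using AK(1) Suc unfolding NS by blast
    qed
    have NA: "N (Suc n) \<in> A (N n)" for n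
    proof -
      have "\<exists>t. t \<in> A (N n) \<and> g \<in> cyl t" using A g NK by blast
      from someI_ex[OF this] show ?thesis unfolding NS by blast
    qed
    define u where "u n = inv_into (K \<times> UNIV) (b (N n)) (N (Suc n))" for n
    have im: "N (Suc n) \<in> b (N n) ` (K \<times> UNIV)" for n
      using b NK[of n] NA[of n] by (simp add: bij_betw_def)
    have uU: "u \<in> U" unfolding U_def u_def using inv_into_into[OF im] by (auto simp: mem_Times_iff)
    have bu: "b (N n) (u n) = N (Suc n)" for n unfolding u_def by (rule f_inv_into_f[OF im])
    have nN: "nd u n = N n" for n by (induction n) (simp_all add: nd0 ndS bu, simp add: N_def)
    have "lm u i = g i" for i
    proof -
      have "ini (lm u) (length (nd u (Suc i))) = ini g (length (nd u (Suc i)))"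
        using lm[OF uU, of "Suc i"] NK[of "Suc i"] by (simp add: nN cyl_def)
      then show ?thesis using len[OF uU, of "Suc i"] by (simp add: ini_eq_iff)
    qed
    then show ?thesis using uU by blast
  qed
  define e where "e a f = lm (\<lambda>n. (a n, f n))" for a :: "nat \<Rightarrow> 'k list" and f :: "nat \<Rightarrow> bool"
  have eU: "(\<lambda>n. (a n, f n)) \<in> U" if "a \<in> seqs K" for a and f :: "nat \<Rightarrow> bool"
    using that by (auto simp: U_def seqs_def)
  have e_inj: "a = a' \<and> f = f'" if "a \<in> seqs K" "a' \<in> seqs K" "e a f = e a' f'" for a a' f f'
  proof -
    have "(\<lambda>n. (a n, f n)) = (\<lambda>n. (a' n, f' n))" using lm_inj eU that by (simp add: e_def)
    then show ?thesis by (metis ext prod.inject)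
  qed
  have nd_cong: "nd u n = nd v n" if "\<forall>i<n. u i = v i" for u v n
    using that by (induction n) (simp_all add: nd0 ndS)
  have e_map: "seq_map (e a)" if a: "a \<in> seqs K" for a
    unfolding seq_map_def
  proof (intro conjI allI)
    show "inj (e a)" using e_inj a by (auto simp: inj_def)
    fix f :: "nat \<Rightarrow> bool" and n
    have cong: "ini (e a g) n = ini (e a f) n" if "\<forall>i<n. g i = f i" for g
    proof -
      let ?u = "\<lambda>n. (a n, g n)" and ?v = "\<lambda>n. (a n, f n)"
      have "nd ?u n = nd ?v n" by (rule nd_cong) (use that in simp)
      then have "ini (lm ?u) (length (nd ?u n)) = ini (lm ?v) (length (nd ?u n))"
        using lm[OF eU[OF a]] by metis
      then show ?thesis using len[OF eU[OF a, of g], of n] by (simp add: ini_eq_iff e_def)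
    qed
    show "\<exists>m. \<forall>g. (\<forall>i<m. g i = f i) \<longrightarrow> ini (e a g) n = ini (e a f) n"
      by (intro exI[of _ n] allI impI) (rule cong)
  qed
  let ?\<M> = "(\<lambda>a. range (e a)) ` seqs K"
  have "disjoint ?\<M>"
  proof (rule disjointI)
    fix P Q assume "P \<in> ?\<M>" "Q \<in> ?\<M>" "P \<noteq> Q"
    then obtain a c where ac: "a \<in> seqs K" "P = range (e a)" "c \<in> seqs K" "Q = range (e c)" "a \<noteq> c" by blast
    then show "P \<inter> Q = {}" using e_inj[OF ac(1,3)] by blast
  qed
  moreover have UN: "\<Union>?\<M> = F"
  proof (intro equalityI subsetI)
    fix g assume "g \<in> \<Union>?\<M>"
    then show "g \<in> F" using lmF eU by (auto simp: e_def)
  next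
    fix g assume "g \<in> F"
    then obtain u where u: "u \<in> U" "lm u = g" using lm_surj by blast
    then have "(\<lambda>n. fst (u n)) \<in> seqs K" by (auto simp: seqs_def U_def)
    moreover have "g = e (\<lambda>n. fst (u n)) (\<lambda>n. snd (u n))" using u by (simp add: e_def)
    ultimately show "g \<in> \<Union>?\<M>" by blast
  qed
  ultimately have "seq_copies F ?\<M>" using e_map by (auto simp: seq_copies_def)
  moreover have "\<forall>A\<subseteq>F - \<Union>?\<M>. |A| \<le>o |tree A \<times> \<CC>|" unfolding UN by (auto simp: card_of_empty)
  ultimately show ?thesis unfolding good_def by blast
qed

lemma good_closed:
  fixes F :: "(nat \<Rightarrow> 'k) set"
  assumes "seq_closed F"
  shows "good F"
proof (rule ccontr)
  assume "\<not> good F"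
  let ?R = "(\<lambda>F :: (nat \<Rightarrow> 'k) set. |tree F| ) ` {F. seq_closed F \<and> \<not> good F}"
  have "?R \<noteq> {}" using assms \<open>\<not> good F\<close> by blast
  moreover have "\<forall>r\<in>?R. Well_order r" by (auto simp: card_of_Well_order)
  ultimately obtain r where r: "r \<in> ?R" "\<forall>r'\<in>?R. r \<le>o r'" using exists_minim_Well_order[of ?R] by blast
  then obtain G :: "(nat \<Rightarrow> 'k) set" where G: "seq_closed G" "\<not> good G" "r = |tree G|" by blast
  have min: "good B" if "seq_closed B" "|tree B| <o |tree G|" for B :: "(nat \<Rightarrow> 'k) set"
  proof (rule ccontr)
    assume "\<not> good B"
    then have "|tree G| \<le>o |tree B|" using r(2) G(3) that(1) by blast
    then show False using that(2) not_ordLess_ordLeq by blast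
  qed
  have large: "|\<CC>| <o |tree G|"
    using good_small G(2) not_card_le_iff_less by blast
  have infG: "infinite (tree G)"
    using ordLeq_transitive[OF nat_le_cantor_set ordLess_imp_ordLeq[OF large]] by (simp add: infinite_iff_card_of_nat)
  \<comment> \<open>All closed subsets are required to be good, because nodes with few descendants
    are shown to be in \<open>S\<close> by applying \<open>good_Union_cyl\<close> to an arbitrary
    closed \<open>B\<close>.\<close>
  define S where "S = {s. \<forall>B. seq_closed B \<and> B \<subseteq> G \<inter> cyl s \<longrightarrow> good B}"
  define H where "H = G - (\<Union>s\<in>S. cyl s)"
  have Hc: "seq_closed H" unfolding H_def by (rule seq_closed_Diff_cyl[OF G(1)])
  have tHG: "|tree H| \<le>o |tree G|" by (intro card_of_mono1 tree_mono) (auto simp: H_def)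
  have hom: "|tree H| \<le>o |below H s|" if s: "s \<in> tree H" for s
  proof (rule ccontr)
    assume "\<not> |tree H| \<le>o |below H s|"
    then have "|below H s| <o |tree H|"
      using not_card_le_iff_less by blast
    then have lt: "|below H s| <o |tree G|" using tHG ordLess_ordLeq_trans by blast
    have "s \<in> S"
      unfolding S_def
    proof (intro CollectI allI impI)
      fix B assume B: "seq_closed B \<and> B \<subseteq> G \<inter> cyl s"
      show "good B"
      proof (rule good_Union_cyl[where S = S])
        let ?B = "B - (\<Union>s\<in>S. cyl s)"
        \<comment> \<open>The remaining nodes are the finitely many initial segments of
          \<open>s\<close> and nodes of \<open>H\<close> below \<open>s\<close>; so this tree is
          smaller than that of \<open>G\<close>, and minimality applies.\<close>
        have sub: "tree ?B \<subseteq> (\<lambda>k. take k s) ` {..length s} \<union> below H s"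
        proof
          fix t assume t: "t \<in> tree ?B"
          then obtain g n where g: "g \<in> ?B" "t = ini g n" by (auto simp: tree_def)
          then have gs: "ini g (length s) = s" "g \<in> H" using B by (auto simp: cyl_def H_def)
          show "t \<in> (\<lambda>k. take k s) ` {..length s} \<union> below H s"
          proof (cases "n \<le> length s")
            case True
            then have "t = take n s" using g gs by (metis take_ini min.absorb1)
            then show ?thesis using True by blast
          next
            case False
            then have "t \<in> below H s"
              using g gs ini_in_tree[OF gs(2), of n] by (simp add: below_def take_ini)
            then show ?thesis by blast
          qed
        qed
        have "|(\<lambda>k. take k s) ` {..length s}| <o |tree G|"
        proof (rule ccontr)
          assume "\<not> |(\<lambda>k. take k s) ` {..length s}| <o |tree G|"
          then have "|tree G| \<le>o |(\<lambda>k. take k s) ` {..length s}|"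
            using not_card_less_iff_le by blast
          then show False using infG card_of_ordLeq_finite by blast
        qed
        then have "|(\<lambda>k. take k s) ` {..length s} \<union> below H s| <o |tree G|"
          using card_of_Un_ordLess_infinite[OF infG] lt by blast
        then have "|tree ?B| <o |tree G|" using card_of_mono1[OF sub] ordLeq_ordLess_trans by blast
        then show "good ?B" using min seq_closed_Diff_cyl B by blast
        show "good (B \<inter> cyl t)" if "t \<in> S" for t
        proof -
          have "seq_closed (B \<inter> cyl t)" using B seq_closed_Int seq_closed_cyl by blast
          moreover have "B \<inter> cyl t \<subseteq> G \<inter> cyl t" using B by blast
          ultimately show ?thesis using that unfolding S_def by blast
        qed
      qed
    qed
    moreover obtain g n where "g \<in> H" "s = ini g n" using s by (auto simp: tree_def)
    ultimately show False by (auto simp: H_def cyl_def)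
  qed
  have "good H"
  proof (cases "|tree H| \<le>o |\<CC>|")
    case True then show ?thesis by (rule good_small)
  next
    case False
    then have "|\<CC>| <o |tree H|" using not_card_le_iff_less by blast
    then have "|UNIV :: nat set| <o |tree H|" using nat_le_cantor_set ordLeq_ordLess_trans by blast
    then show ?thesis using good_homogeneous[OF Hc] hom by blast
  qed
  moreover have "good (G \<inter> cyl s)" if "s \<in> S" for s
  proof -
    have "seq_closed (G \<inter> cyl s)" using G(1) seq_closed_Int seq_closed_cyl by blast
    then show ?thesis using that unfolding S_def by blast
  qed
  ultimately have "good G" using good_Union_cyl[where S = S and B = G] unfolding H_def by blast
  then show False using G(2) by blast
qed

section \<open>From codes back to the space\<close>

lemma card_lists_le:
  assumes "|Q| \<le>o |Z|" "infinite Z"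
  shows "|lists Q| \<le>o |Z|"
proof -
  have n: "|{xs \<in> lists Q. length xs = n}| \<le>o |Z|" for n
  proof (induction n)
    case 0
    have "{xs \<in> lists Q. length xs = 0} = {[]}" by auto
    moreover have "Z \<noteq> {}" using assms(2) by auto
    ultimately show ?case by (simp add: card_of_singl_ordLeq)
  next
    case (Suc n)
    let ?N = "{xs \<in> lists Q. length xs = n}"
    have "{xs \<in> lists Q. length xs = Suc n} \<subseteq> (\<lambda>(x, xs). x # xs) ` (Q \<times> ?N)"
    proof
      fix xs assume "xs \<in> {xs \<in> lists Q. length xs = Suc n}"
      then show "xs \<in> (\<lambda>(x, xs). x # xs) ` (Q \<times> ?N)" by (cases xs) auto
    qed
    then have "|{xs \<in> lists Q. length xs = Suc n}| \<le>o |(\<lambda>(x, xs). x # xs) ` (Q \<times> ?N)|" by (rule card_of_mono1)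
    also have "|(\<lambda>(x, xs). x # xs) ` (Q \<times> ?N)| \<le>o |Q \<times> ?N|" by (rule card_of_image)
    also have "|Q \<times> ?N| \<le>o |Z|" by (rule card_Times_le[OF assms(1) Suc assms(2)])
    finally show ?case .
  qed
  have "|\<Union>n. {xs \<in> lists Q. length xs = n}| \<le>o |Z|"
    by (rule card_Union_le[OF _ n assms(2)]) (use assms(2) in \<open>simp add: infinite_iff_card_of_nat\<close>)
  moreover have "(\<Union>n. {xs \<in> lists Q. length xs = n}) = lists Q" by blast
  ultimately show ?thesis by simp
qed

text \<open>The family of codes is decoded and enlarged to a maximal, hence dense one. The bound in
  \<open>good\<close> survives this because it holds for every part of the leftover. It becomes the
  bound of \<open>partitionable_metrizable\<close> once the tree over an open set \<open>U\<close>
  is embedded into lists over the centres used in \<open>U\<close>.\<close>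

lemma partitionable_complete:
  assumes "completely_metrizable_space X" "no_isolated_points X"
  shows "partitionable X cantor_space"
proof -
  obtain M d where "Metric_space M d" and mc: "Metric_space.mcomplete M d" and X: "X = Metric_space.mtopology M d"
    using assms(1) unfolding completely_metrizable_space_def by blast
  then interpret Metric_space M d by simp
  have iso: "no_isolated_points mtopology" using assms(2) X by simp
  obtain W :: "('a \<times> 'a) set" where W: "wf W" "total_on UNIV W" using wf_total_exists by blast
  define c where "c = code W M d"
  define z where "z n = code_centre W M d n" for n
  have fst_c: "fst (c x n) = z n x" for x n by (simp add: c_def z_def code_def Let_def)
  note ctr = code_centre[OF W, folded z_def]
  have inj: "inj_on c M" unfolding c_def by (rule inj_on_code[OF W])
  have "good (c ` M)" using good_closed seq_closed_code[OF W mc] unfolding c_def by blast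
  then obtain \<N> where \<N>: "seq_copies (c ` M) \<N>" "\<And>A. A \<subseteq> c ` M - \<Union>\<N> \<Longrightarrow> |A| \<le>o |tree A \<times> \<CC>|"
    unfolding good_def by blast
  define i where "i = inv_into M c"
  have i: "i g \<in> M" "c (i g) = g" if "g \<in> c ` M" for g
    using that unfolding i_def by (rule inv_into_into, rule f_inv_into_f)
  have ic: "i (c x) = x" if "x \<in> M" for x unfolding i_def by (rule inv_into_f_f[OF inj that])
  define \<M>0 where "\<M>0 = (`) i ` \<N>"
  have Nsub: "N \<subseteq> c ` M" if "N \<in> \<N>" for N using \<N>(1) that by (auto simp: seq_copies_def)
  have "disjoint \<M>0"
  proof (rule disjointI)
    fix P Q assume PQ: "P \<in> \<M>0" "Q \<in> \<M>0" "P \<noteq> Q"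
    then obtain N N' where N: "N \<in> \<N>" "N' \<in> \<N>" "P = i ` N" "Q = i ` N'" "N \<noteq> N'" unfolding \<M>0_def by blast
    then have "N \<inter> N' = {}" using \<N>(1) by (simp add: seq_copies_def disjoint_def)
    have False if "p \<in> P" "p \<in> Q" for p
    proof -
      obtain g g' where "g \<in> N" "g' \<in> N'" "p = i g" "p = i g'" using \<open>p \<in> P\<close> \<open>p \<in> Q\<close> N by blast
      then have "g = g'" using i(2) Nsub N by (metis subsetD)
      then show False using \<open>g \<in> N\<close> \<open>g' \<in> N'\<close> \<open>N \<inter> N' = {}\<close> by blast
    qed
    then show "P \<inter> Q = {}" by blast
  qed
  moreover have "cantor_copy X P" if P: "P \<in> \<M>0" for P
  proof -
    obtain N where N: "N \<in> \<N>" "P = i ` N" using P unfolding \<M>0_def by blast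
    then obtain e where e: "seq_map e" "range e = N" using \<N>(1) unfolding seq_copies_def by blast
    have eM: "e f \<in> c ` M" for f using Nsub[OF N(1)] e(2) by blast
    have "cantor_map X (i \<circ> e)"
      unfolding cantor_map_def
    proof (intro conjI allI impI)
      show "inj (i \<circ> e)"
      proof (rule injI)
        fix f g assume "(i \<circ> e) f = (i \<circ> e) g"
        then have "e f = e g" using i(2)[OF eM] by (metis comp_apply)
        then show "f = g" using e(1) by (simp add: seq_map_def inj_eq)
      qed
      show "range (i \<circ> e) \<subseteq> topspace X" using i(1)[OF eM] by (auto simp: X)
      fix V f assume V: "openin X V \<and> (i \<circ> e) f \<in> V"
      then obtain r where r: "r > 0" "mball (i (e f)) r \<subseteq> V" by (auto simp: X openin_mtopology)
      obtain k where k: "(1/2::real)^k < r / 2" using half_power_less[of "r / 2"] r by auto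
      obtain m where m: "\<forall>g. (\<forall>j<m. g j = f j) \<longrightarrow> ini (e g) (Suc k) = ini (e f) (Suc k)"
        using e(1) unfolding seq_map_def by blast
      have "(i \<circ> e) g \<in> V" if "\<forall>j<m. g j = f j" for g
      proof -
        have "ini (e g) (Suc k) = ini (e f) (Suc k)" using m that by blast
        then have "e f k = e g k" by (simp add: ini_eq_iff)
        then have "c (i (e f)) k = c (i (e g)) k" by (simp add: i(2)[OF eM])
        then have "d (i (e f)) (i (e g)) < 2 * (1/2)^k"
          unfolding c_def by (intro code_close[OF W] i(1)[OF eM])
        then have "i (e g) \<in> mball (i (e f)) r" using k i(1)[OF eM] by simp
        then show ?thesis using r by auto
      qed
      then show "\<exists>m. \<forall>g. (\<forall>j<m. g j = f j) \<longrightarrow> (i \<circ> e) g \<in> V" by blast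
    qed
    moreover have "range (i \<circ> e) = P" using e(2) N(2) by auto
    ultimately show ?thesis unfolding cantor_copy_def by blast
  qed
  ultimately obtain \<M> where \<M>: "\<M>0 \<subseteq> \<M>" "disjoint \<M>" "\<And>P. P \<in> \<M> \<Longrightarrow> cantor_copy X P"
    and max: "\<And>K. cantor_copy X K \<Longrightarrow> K \<inter> \<Union>\<M> \<noteq> {}"
    by (rule maximal_cantor_family) blast+
  have haus: "Hausdorff_space X" unfolding X by (rule Hausdorff_space_mtopology)
  obtain h where "cantor_family X \<M> h" using cantor_family_choice[OF haus \<M>(2,3)] by blast
  then interpret cantor_family X \<M> h .
  have dense: "U \<inter> \<Union>\<M> \<noteq> {}" if "openin X U" "U \<noteq> {}" for U
  proof (rule dense_cantor_family[OF _ max that])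
    fix V assume "openin X V" "V \<noteq> {}"
    then show "\<exists>K. cantor_copy X K \<and> K \<subseteq> V" using cantor_copy_in_open[OF mc iso] unfolding X by blast
  qed
  have "|U - \<Union>\<M>| \<le>o |{N \<in> \<M>. N \<inter> U \<noteq> {}} \<times> \<CC>|" if U: "openin X U" for U
  proof (cases "U = {}")
    case True then show ?thesis by (simp add: card_of_empty)
  next
    case False
    let ?Z = "{N \<in> \<M>. N \<inter> U \<noteq> {}} \<times> \<CC>"
    have UM: "U \<subseteq> M" using openin_subset[OF U] by (simp add: X)
    have ne: "{N \<in> \<M>. N \<inter> U \<noteq> {}} \<noteq> {}" using dense[OF U False] by blast
    have inf: "infinite ?Z" by (rule infinite_Times_cantor_set[OF ne])
    have nat: "|UNIV :: nat set| \<le>o |?Z|" using inf by (simp add: infinite_iff_card_of_nat)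
    have refl: "|?Z| \<le>o |?Z|" by (simp add: card_of_mono1)
    \<comment> \<open>Each centre used in \<open>U\<close> gets a witness: a point of the family in
      \<open>U\<close> and a radius 1/(j+1), such that this ball lies within the ball of the centre
      and contains a point coded by the centre.\<close>
    have zU: "|z n ` U| \<le>o |?Z|" for n
    proof -
      have "\<exists>w. fst w \<in> ?Z \<and> (\<exists>y\<in>U. z n y = v \<and> y \<in> mball (h (fst (fst w)) (snd (fst w))) (inverse (Suc (snd w)))) \<and>
         mball (h (fst (fst w)) (snd (fst w))) (inverse (Suc (snd w))) \<subseteq> mball v ((1/2)^n)"
        if v: "v \<in> z n ` U" for v
      proof -
        obtain y where y: "y \<in> U" "v = z n y" using v by blast
        then have yM: "y \<in> M" using UM by blast
        have vM: "v \<in> M" and vy: "d v y < (1/2)^n" using ctr(1,2)[OF yM, of n] y by auto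
        obtain r where r: "r > 0" "mball y r \<subseteq> U" using U y by (auto simp: X openin_mtopology)
        \<comment> \<open>Half of the slack at \<open>y\<close>, as the distances from
          \<open>y\<close> to \<open>p\<close> and from \<open>p\<close> to \<open>x\<close> both
          have to fit in.\<close>
        define q where "q = min r (((1/2)^n - d v y) / 2)"
        have q: "q > 0" "q \<le> r" "2 * q \<le> (1/2)^n - d v y" using r vy by (auto simp: q_def min_def)
        obtain j where j: "inverse (real (Suc j)) < q" using reals_Archimedean[OF q(1)] by blast
        have jpos: "0 < inverse (real (Suc j))" by simp
        have "y \<in> mball y (inverse (Suc j))" using yM jpos by (simp del: of_nat_Suc)
        then have ne_ball: "mball y (inverse (Suc j)) \<noteq> {}" by blast
        have "openin X (mball y (inverse (Suc j)))" unfolding X by (rule openin_mball)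
        then have "mball y (inverse (Suc j)) \<inter> \<Union>\<M> \<noteq> {}" by (rule dense[OF _ ne_ball])
        then obtain N p where p: "N \<in> \<M>" "p \<in> N" "p \<in> mball y (inverse (Suc j))" by blast
        then obtain w where w: "p = h N w" using range_h[OF p(1)] by blast
        have "mball y (inverse (Suc j)) \<subseteq> mball y r" using j q by (intro mball_subset_concentric) linarith
        then have "p \<in> U" using p r by blast
        then have 1: "(N, w) \<in> ?Z" using p by auto
        have 2: "y \<in> mball p (inverse (Suc j))" using p(3) by (auto simp: commute)
        have 3: "mball p (inverse (Suc j)) \<subseteq> mball v ((1/2)^n)"
        proof
          fix x assume x: "x \<in> mball p (inverse (Suc j))"
          have "d v x \<le> d v y + d y p + d p x"
            using triangle[OF vM yM, of x] triangle[OF yM _, of p x] x p(3) by auto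
          then have "d v x < (1/2)^n" using x p(3) j q(3) by auto
          then show "x \<in> mball v ((1/2)^n)" using x vM by auto
        qed
        show ?thesis using 1 2 3 w y by (intro exI[of _ "((N, w), j)"]) auto
      qed
      then have "\<forall>v\<in>z n ` U. \<exists>w. fst w \<in> ?Z \<and> (\<exists>y\<in>U. z n y = v \<and> y \<in> mball (h (fst (fst w)) (snd (fst w))) (inverse (Suc (snd w)))) \<and>
         mball (h (fst (fst w)) (snd (fst w))) (inverse (Suc (snd w))) \<subseteq> mball v ((1/2)^n)" by blast
      from bchoice[OF this] obtain w where w: "\<forall>v\<in>z n ` U. fst (w v) \<in> ?Z \<and>
         (\<exists>y\<in>U. z n y = v \<and> y \<in> mball (h (fst (fst (w v))) (snd (fst (w v)))) (inverse (Suc (snd (w v))))) \<and>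
         mball (h (fst (fst (w v))) (snd (fst (w v)))) (inverse (Suc (snd (w v)))) \<subseteq> mball v ((1/2)^n)" ..
      \<comment> \<open>If an earlier centre had the same witness, the point coded by the later
        centre would lie in the ball of the earlier one.\<close>
      have no: False if vv: "v \<in> z n ` U" "v' \<in> z n ` U" "w v = w v'" "(v', v) \<in> W" for v v'
      proof -
        obtain y where y: "y \<in> U" "z n y = v" "y \<in> mball (h (fst (fst (w v))) (snd (fst (w v)))) (inverse (Suc (snd (w v))))"
          using w vv(1) by blast
        moreover have "mball (h (fst (fst (w v'))) (snd (fst (w v')))) (inverse (Suc (snd (w v')))) \<subseteq> mball v' ((1/2)^n)"
          using w vv(2) by blast
        ultimately have "y \<in> mball v' ((1/2)^n)" unfolding vv(3) by blast
        then show False using ctr(3)[of y v' n] y UM vv(4) by auto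
      qed
      have "inj_on w (z n ` U)"
      proof (rule inj_onI, rule ccontr)
        fix v v' assume v: "v \<in> z n ` U" "v' \<in> z n ` U" "w v = w v'" "v \<noteq> v'"
        then have "(v, v') \<in> W \<or> (v', v) \<in> W" using W(2) by (auto simp: total_on_def)
        then show False using no v by metis
      qed
      then have "|z n ` U| \<le>o |?Z \<times> (UNIV :: nat set)|"
      proof (rule card_of_ordLeqI)
        fix v assume "v \<in> z n ` U"
        then have "fst (w v) \<in> ?Z" using w by blast
        then show "w v \<in> ?Z \<times> UNIV" unfolding mem_Times_iff[of "w v"] by blast
      qed
      also have "|?Z \<times> (UNIV :: nat set)| \<le>o |?Z|" by (rule card_Times_le[OF refl nat inf])
      finally show ?thesis .
    qed
    let ?L = "(\<Union>n. z n ` U) \<times> (UNIV :: nat set)"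
    have "|\<Union>n. z n ` U| \<le>o |?Z|" by (rule card_Union_le[OF nat zU inf])
    then have "|?L| \<le>o |?Z|" by (rule card_Times_le[OF _ nat inf])
    then have lists: "|lists ?L| \<le>o |?Z|" by (rule card_lists_le[OF _ inf])
    define A where "A = c ` (U - \<Union>\<M>)"
    have "|U - \<Union>\<M>| \<le>o |A|"
      unfolding A_def by (rule card_of_ordLeqI[where f = c]) (use inj UM in \<open>auto intro: inj_on_subset\<close>)
    also have "|A| \<le>o |tree A \<times> \<CC>|"
    proof (rule \<N>(2))
      have "g \<notin> N" if "g \<in> A" "N \<in> \<N>" for g N
      proof
        assume "g \<in> N"
        obtain x where x: "x \<in> U - \<Union>\<M>" "g = c x" using \<open>g \<in> A\<close> by (auto simp: A_def)
        then have "i g = x" using ic UM by auto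
        then have "x \<in> i ` N" using \<open>g \<in> N\<close> by blast
        moreover have "i ` N \<in> \<M>" using \<open>N \<in> \<N>\<close> \<M>(1) by (auto simp: \<M>0_def)
        ultimately show False using x by blast
      qed
      moreover have "A \<subseteq> c ` M" using UM by (auto simp: A_def)
      ultimately show "A \<subseteq> c ` M - \<Union>\<N>" by blast
    qed
    also have "|tree A \<times> \<CC>| \<le>o |?Z|"
    proof (rule card_Times_le[OF _ cantor_set_le_Times[OF ne] inf])
      have "tree A \<subseteq> lists ?L"
      proof
        fix t assume "t \<in> tree A"
        then obtain x n where x: "x \<in> U" "t = ini (c x) n" by (auto simp: tree_def A_def)
        have "c x j \<in> ?L" for j using x(1) by (auto simp: mem_Times_iff fst_c)
        then show "t \<in> lists ?L" unfolding x(2) ini_def by (auto simp: in_lists_conv_set)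
      qed
      then show "|tree A| \<le>o |?Z|" by (rule ordLeq_transitive[OF card_of_mono1 lists])
    qed
    finally show ?thesis .
  qed
  then show ?thesis by (intro partitionable_metrizable assms(1) dense completely_metrizable_imp_metrizable_space) 
qed

subsection \<open>Zero-dimensional Polish spaces\<close>

definition clopen_base :: "'b topology \<Rightarrow> (nat \<Rightarrow> 'b set) \<Rightarrow> bool" where
  "clopen_base Y B \<longleftrightarrow> (\<forall>n. openin Y (B n) \<and> closedin Y (B n)) \<and>
     (\<forall>U y. openin Y U \<and> y \<in> U \<longrightarrow> (\<exists>n. y \<in> B n \<and> B n \<subseteq> U))"

lemma clopen_baseD:
  "clopen_base Y B \<Longrightarrow> openin Y U \<Longrightarrow> y \<in> U \<Longrightarrow> \<exists>n. y \<in> B n \<and> B n \<subseteq> U"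
  by (simp add: clopen_base_def)

lemma metrizable_separable_imp_second_countable:
  assumes "metrizable_space Y" "separable_space Y"
  shows "second_countable Y"
proof -
  obtain M d where "Metric_space M d" and Y: "Y = Metric_space.mtopology M d"
    using assms(1) unfolding metrizable_space_def by blast
  then interpret Metric_space M d by simp
  obtain Q where Q: "countable Q" "Q \<subseteq> M" "mtopology closure_of Q = M"
    using assms(2) unfolding separable_space_def Y by auto
  let ?B = "(\<lambda>(q, n::nat). mball q (inverse (Suc n))) ` (Q \<times> UNIV)"
  have "\<exists>V\<in>?B. y \<in> V \<and> V \<subseteq> U" if U: "openin mtopology U" "y \<in> U" for U y
  proof -
    have yM: "y \<in> M" using openin_subset[OF U(1)] U(2) by auto
    obtain r where r: "r > 0" "mball y r \<subseteq> U" using U by (auto simp: openin_mtopology)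
    obtain n where n: "inverse (real (Suc n)) < r / 2" using reals_Archimedean[of "r / 2"] r by auto
    have "y \<in> mball y (inverse (Suc n))" using yM by (simp del: of_nat_Suc)
    moreover have "y \<in> mtopology closure_of Q" using Q yM by simp
    ultimately obtain q where q: "q \<in> Q" "q \<in> mball y (inverse (Suc n))"
      unfolding in_closure_of using openin_mball by meson
    have "mball q (inverse (Suc n)) \<subseteq> mball y r"
    proof
      fix x assume "x \<in> mball q (inverse (Suc n))"
      then show "x \<in> mball y r" using triangle[of y q x] q n by (auto simp del: of_nat_Suc)
    qed
    moreover have "y \<in> mball q (inverse (Suc n))" using q by (auto simp: commute)
    ultimately show ?thesis using q r by blast
  qed
  then have "\<forall>U y. openin mtopology U \<and> y \<in> U \<longrightarrow> (\<exists>V\<in>?B. y \<in> V \<and> V \<subseteq> U)" by simp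
  moreover have "countable ?B" using Q(1) by simp
  moreover have "\<forall>V\<in>?B. openin mtopology V" by auto
  ultimately show ?thesis unfolding second_countable_def Y by (intro exI[of _ ?B] conjI)
qed

text \<open>The given clopen base may be uncountable. For each pair of members of a countable base
  one clopen set between them is kept if there is any, and these sets still form a base.\<close>

lemma clopen_base_exists:
  assumes "zero_dimensional_space Y" "second_countable Y"
  obtains B where "clopen_base Y B"
proof -
  from assms(1)[unfolded zero_dimensional_space_def]
  obtain \<V> where V0: "\<forall>V\<in>\<V>. openin Y V \<and> closedin Y V"
    "\<forall>U x. openin Y U \<and> x \<in> U \<longrightarrow> (\<exists>V\<in>\<V>. x \<in> V \<and> V \<subseteq> U)" by (elim exE conjE)
  have V: "openin Y V \<and> closedin Y V" if "V \<in> \<V>" for V using V0(1) that by simp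
  have V2: "\<exists>V\<in>\<V>. x \<in> V \<and> V \<subseteq> U" if "openin Y U" "x \<in> U" for U x using V0(2) that by simp
  from assms(2)[unfolded second_countable_def]
  obtain \<O> where O0: "countable \<O>" "\<forall>P\<in>\<O>. openin Y P"
    "\<forall>U x. openin Y U \<and> x \<in> U \<longrightarrow> (\<exists>P\<in>\<O>. x \<in> P \<and> P \<subseteq> U)" by (elim exE conjE)
  have O: "openin Y P" if "P \<in> \<O>" for P using O0(2) that by simp
  have O3: "\<exists>P\<in>\<O>. x \<in> P \<and> P \<subseteq> U" if "openin Y U" "x \<in> U" for U x using O0(3) that by simp
  define c where "c p = (if \<exists>V. openin Y V \<and> closedin Y V \<and> fst p \<subseteq> V \<and> V \<subseteq> snd p
    then SOME V. openin Y V \<and> closedin Y V \<and> fst p \<subseteq> V \<and> V \<subseteq> snd p else {})" for p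
  have c: "openin Y (c p) \<and> closedin Y (c p)" for p
    unfolding c_def by (auto intro: someI2)
  define \<C> where "\<C> = c ` (\<O> \<times> \<O>)"
  have "\<exists>W\<in>\<C>. x \<in> W \<and> W \<subseteq> U" if U: "openin Y U" "x \<in> U" for U x
  proof -
    obtain P where P: "P \<in> \<O>" "x \<in> P" "P \<subseteq> U" using O3[OF U] by blast
    obtain V where V': "V \<in> \<V>" "x \<in> V" "V \<subseteq> P" using V2[OF O[OF P(1)] P(2)] by blast
    obtain P' where P': "P' \<in> \<O>" "x \<in> P'" "P' \<subseteq> V" using O3[of V x] V[OF V'(1)] V'(2) by blast
    have ex: "\<exists>V. openin Y V \<and> closedin Y V \<and> fst (P', P) \<subseteq> V \<and> V \<subseteq> snd (P', P)"
      using V[OF V'(1)] V'(3) P'(3) by auto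
    have "fst (P', P) \<subseteq> c (P', P) \<and> c (P', P) \<subseteq> snd (P', P)"
      using someI_ex[OF ex] ex unfolding c_def by auto
    then have "x \<in> c (P', P)" "c (P', P) \<subseteq> U" using P P' by auto
    then show ?thesis using P P' unfolding \<C>_def by blast
  qed
  note base = this
  have ctb: "countable (insert {} \<C>)" unfolding \<C>_def using O0(1) by simp
  define B where "B = from_nat_into (insert {} \<C>)"
  have Bin: "B n \<in> insert {} \<C>" for n unfolding B_def by (rule from_nat_into) simp
  have "openin Y (B n) \<and> closedin Y (B n)" for n using Bin[of n] c by (auto simp: \<C>_def)
  moreover have "\<exists>n. x \<in> B n \<and> B n \<subseteq> U" if U: "openin Y U" "x \<in> U" for U x
  proof -
    obtain W where W: "W \<in> \<C>" "x \<in> W" "W \<subseteq> U" using base[OF U] by blast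
    then obtain n where "B n = W" unfolding B_def using from_nat_into_surj[OF ctb, of W] by blast
    then show ?thesis using W by blast
  qed
  ultimately show thesis by (intro that[of B]) (simp add: clopen_base_def)
qed

text \<open>Open coordinate sets make \<open>e\<close> continuous. The condition on initial segments
  makes the inverse continuous and, by the Hausdorff property, \<open>e\<close> injective.\<close>

lemma homeomorphic_cantor_subset:
  fixes e :: "'b \<Rightarrow> nat \<Rightarrow> bool"
  assumes haus: "Hausdorff_space Y"
    and open_e: "\<And>n b. openin Y {y \<in> topspace Y. e y n = b}"
    and base: "\<And>U y. openin Y U \<Longrightarrow> y \<in> U \<Longrightarrow> \<exists>n. \<forall>y'\<in>topspace Y. (\<forall>m<n. e y' m = e y m) \<longrightarrow> y' \<in> U"
  shows "Y homeomorphic_space subtopology cantor_space (e ` topspace Y)"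
proof -
  let ?E = "e ` topspace Y" and ?i = "inv_into (topspace Y) e"
  have inj: "inj_on e (topspace Y)"
  proof (rule inj_onI, rule ccontr)
    fix x y assume xy: "x \<in> topspace Y" "y \<in> topspace Y" "e x = e y" "x \<noteq> y"
    then obtain U where "openin Y U" "x \<in> U" "y \<notin> U"
      using haus unfolding Hausdorff_space_def disjnt_iff by metis
    then show False using base[of U x] xy by auto
  qed
  have comp: "continuous_map Y (discrete_topology UNIV) (\<lambda>y. e y n)" for n
    unfolding continuous_map_def
  proof (intro conjI allI impI)
    fix U :: "bool set"
    have "{y \<in> topspace Y. e y n \<in> U} = (\<Union>b\<in>U. {y \<in> topspace Y. e y n = b})" by blast
    then show "openin Y {y \<in> topspace Y. e y n \<in> U}" using open_e by auto
  qed simp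
  have "continuous_map Y cantor_space e"
    unfolding cantor_space_def continuous_map_componentwise_UNIV using comp by blast
  then have c1: "continuous_map Y (subtopology cantor_space ?E) e"
    by (simp add: continuous_map_in_subtopology)
  have c2: "continuous_map (subtopology cantor_space ?E) Y ?i"
    unfolding continuous_map_def
  proof (intro conjI allI impI)
    show "?i \<in> topspace (subtopology cantor_space ?E) \<rightarrow> topspace Y" by (auto simp: inv_into_into)
    fix U assume U: "openin Y U"
    \<comment> \<open>Sequences with an initial segment that forces membership in \<open>U\<close>:
      an open set that cuts out the image of \<open>U\<close> from the range of
      \<open>e\<close>.\<close>
    let ?S = "{f. \<exists>n. \<forall>y'\<in>topspace Y. (\<forall>m<n. e y' m = f m) \<longrightarrow> y' \<in> U}"
    have "openin cantor_space ?S"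
      unfolding openin_cantor_space
    proof
      fix f assume "f \<in> ?S"
      then obtain n where n: "\<forall>y'\<in>topspace Y. (\<forall>m<n. e y' m = f m) \<longrightarrow> y' \<in> U" by blast
      have "g \<in> ?S" if "\<forall>m<n. g m = f m" for g
        using n that by (intro CollectI exI[of _ n]) simp
      then show "\<exists>n. \<forall>g. (\<forall>m<n. g m = f m) \<longrightarrow> g \<in> ?S" by blast
    qed
    moreover have "{f \<in> topspace (subtopology cantor_space ?E). ?i f \<in> U} = ?S \<inter> ?E"
    proof -
      have "e y \<in> ?S \<longleftrightarrow> y \<in> U" if y: "y \<in> topspace Y" for y
      proof
        assume "e y \<in> ?S"
        then show "y \<in> U" using y by blast
      next
        assume "y \<in> U"
        from base[OF U this] show "e y \<in> ?S" by simp
      qed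
      then show ?thesis using inv_into_f_f[OF inj] by auto
    qed
    ultimately show "openin (subtopology cantor_space ?E) {f \<in> topspace (subtopology cantor_space ?E). ?i f \<in> U}"
      by (auto simp: openin_subtopology)
  qed
  have "homeomorphic_maps Y (subtopology cantor_space ?E) e ?i"
    unfolding homeomorphic_maps_def using c1 c2 inj by (auto simp: f_inv_into_f)
  then show ?thesis using homeomorphic_maps_imp_homeomorphic_space by blast
qed

text \<open>
  The states are the sets of the scheme themselves in the compact case, and positions in an
  enumerated partition in the nowhere compact case.
\<close>

lemma binary_scheme:
  fixes step :: "nat \<Rightarrow> bool \<Rightarrow> 's \<Rightarrow> 's" and S :: "'s \<Rightarrow> 'b set"
  assumes st: "\<And>f. st f 0 = s0" "\<And>f n. st f (Suc n) = step n (f n) (st f n)"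
    and op: "\<And>f n. openin Y (S (st f n))"
    and un: "\<And>f n. S (st f n) = S (step n True (st f n)) \<union> S (step n False (st f n))"
    and dis: "\<And>f n. S (step n True (st f n)) \<inter> S (step n False (st f n)) = {}"
  obtains e :: "'b \<Rightarrow> nat \<Rightarrow> bool"
  where "\<And>y f n. y \<in> S s0 \<Longrightarrow> y \<in> S (st f n) \<longleftrightarrow> (\<forall>m<n. e y m = f m)"
    "\<And>n b. openin Y {y \<in> S s0. e y n = b}"
proof -
  \<comment> \<open>Each point of \<open>S s0\<close> follows its own path: \<open>t y n\<close> is
    the state that contains it, and \<open>e y n\<close> tells whether it next moves to the side
    \<open>True\<close>.\<close>
  define t where "t y n = rec_nat s0 (\<lambda>n s. step n (y \<in> S (step n True s)) s) n" for y n
  define e where "e y n = (y \<in> S (step n True (t y n)))" for y n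
  have t0: "t y 0 = s0" and tS: "t y (Suc n) = step n (e y n) (t y n)" for y n
    by (simp_all add: t_def e_def)
  have ty: "t y n = st (e y) n" for y n by (induction n) (simp_all add: t0 tS st)
  have cong: "st f n = st g n" if "\<forall>m<n. f m = g m" for f g n
    using that by (induction n) (simp_all add: st)
  have mem: "y \<in> S (st (e y) n)" if "y \<in> S s0" for y n
  proof (induction n)
    case (Suc n)
    have "e y n = (y \<in> S (step n True (st (e y) n)))" using e_def[of y n] by (simp only: ty)
    then show ?case using Suc un[of "e y" n] by (cases "e y n") (auto simp: st)
  qed (simp add: st that)
  have iff: "y \<in> S (st f n) \<longleftrightarrow> (\<forall>m<n. e y m = f m)" if y: "y \<in> S s0" for y f n
  proof
    assume "\<forall>m<n. e y m = f m"
    then show "y \<in> S (st f n)" using mem[OF y] cong by metis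
  next
    show "y \<in> S (st f n) \<Longrightarrow> \<forall>m<n. e y m = f m"
    proof (induction n)
      case (Suc n)
      have "y \<in> S (st f n)" using Suc.prems un[of f n] by (cases "f n") (auto simp: st)
      then have IH: "\<forall>m<n. e y m = f m" by (rule Suc.IH)
      then have "st f n = t y n" unfolding ty by (intro cong) simp
      then have "e y n = (y \<in> S (step n True (st f n)))" by (simp add: e_def)
      moreover have "y \<in> S (step n (f n) (st f n))" using Suc.prems by (simp add: st)
      ultimately have "e y n = f n" using dis[of n f] by (cases "f n") auto
      then show ?case using IH by (simp add: less_Suc_eq)
    qed simp
  qed
  have sub: "S (st f n) \<subseteq> S s0" for f n
  proof (induction n)
    case (Suc n)
    then show ?case using un[of f n] by (cases "f n") (auto simp: st)
  qed (simp add: st)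
  have "{y \<in> S s0. e y n = b} = (\<Union>f\<in>{f. f n = b}. S (st f (Suc n)))" for n b
  proof (intro equalityI subsetI)
    fix y assume "y \<in> {y \<in> S s0. e y n = b}"
    then show "y \<in> (\<Union>f\<in>{f. f n = b}. S (st f (Suc n)))" using mem[of y "Suc n"] by blast
  next
    fix y assume "y \<in> (\<Union>f\<in>{f. f n = b}. S (st f (Suc n)))"
    then obtain f where f: "f n = b" "y \<in> S (st f (Suc n))" by blast
    then have "y \<in> S s0" using sub by blast
    then show "y \<in> {y \<in> S s0. e y n = b}" using iff[OF \<open>y \<in> S s0\<close>, where f = f and n = "Suc n"] f by simp
  qed
  then have "openin Y {y \<in> S s0. e y n = b}" for n b using op by auto
  then show thesis using that iff by blast
qed

text \<open>In effect \<open>e\<close> embeds \<open>C\<close> into the Cantor space, up to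
  injectivity, which follows in Hausdorff spaces. Open sets of \<open>Y\<close> suffice to say so
  since \<open>C\<close> is open in both uses.\<close>

definition charts :: "'b topology \<Rightarrow> 'b set \<Rightarrow> ('b \<Rightarrow> nat \<Rightarrow> bool) \<Rightarrow> bool" where
  "charts Y C e \<longleftrightarrow> (\<forall>n b. openin Y {y \<in> C. e y n = b}) \<and>
     (\<forall>U y. openin Y U \<and> y \<in> U \<and> y \<in> C \<longrightarrow> (\<exists>n. \<forall>y'\<in>C. (\<forall>m<n. e y' m = e y m) \<longrightarrow> y' \<in> U))"

lemma clopen_base_mem_eq: "clopen_base Y B \<Longrightarrow> openin Y {y \<in> topspace Y. (y \<in> B n) = b}"
proof (cases b)
  case True
  assume B: "clopen_base Y B"
  then have "{y \<in> topspace Y. (y \<in> B n) = b} = B n"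
    using True openin_subset[of Y "B n"] by (auto simp: clopen_base_def)
  then show ?thesis using B by (simp add: clopen_base_def)
next
  case False
  assume B: "clopen_base Y B"
  have "{y \<in> topspace Y. (y \<in> B n) = b} = topspace Y - B n" using False by auto
  then show ?thesis using B by (auto simp: clopen_base_def closedin_def)
qed

text \<open>Step \<open>n\<close> splits each set by \<open>B n\<close> if both parts are nonempty,
  otherwise by some clopen set, which exists because no point is isolated. So \<open>B n\<close> is
  decided after step \<open>n\<close>, which makes \<open>e\<close> generate the topology; no set
  becomes empty, so by compactness all binary sequences occur.\<close>

lemma charts_compact:
  assumes haus: "Hausdorff_space Y" and iso: "no_isolated_points Y" and B: "clopen_base Y B"
    and C: "openin Y C" "compactin Y C" "C \<noteq> {}"
  obtains e where "charts Y C e" "e ` C = UNIV"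
proof -
  define clo where "clo P \<longleftrightarrow> openin Y P \<and> closedin Y P \<and> P \<noteq> {}" for P
  have clB: "openin Y (B n)" "closedin Y (B n)" for n using B by (auto simp: clopen_base_def)
  have "\<exists>V. clo (P \<inter> V) \<and> clo (P - V) \<and> (P \<inter> B n = {} \<or> P \<subseteq> B n \<or> V = B n)" if P: "clo P" for P n
  proof (cases "P \<inter> B n = {} \<or> P \<subseteq> B n")
    case False
    then show ?thesis using P clB by (intro exI[of _ "B n"]) (auto simp: clo_def)
  next
    case True
    obtain x where x: "x \<in> P" using P by (auto simp: clo_def)
    have "P \<noteq> {x}" using iso P openin_subset[of Y P] x by (auto simp: no_isolated_points_def clo_def)
    then obtain y where y: "y \<in> P" "y \<noteq> x" using x by blast
    have "x \<in> topspace Y" "y \<in> topspace Y" using x y P openin_subset[of Y P] by (auto simp: clo_def)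
    then obtain U where U: "openin Y U" "x \<in> U" "y \<notin> U"
      using haus y(2) unfolding Hausdorff_space_def disjnt_iff by metis
    obtain k where "x \<in> B k" "B k \<subseteq> U" using clopen_baseD[OF B U(1,2)] by blast
    then show ?thesis using True P clB[of k] x y U by (intro exI[of _ "B k"]) (auto simp: clo_def)
  qed
  then have "\<forall>n P. \<exists>V. clo P \<longrightarrow> clo (P \<inter> V) \<and> clo (P - V) \<and> (P \<inter> B n = {} \<or> P \<subseteq> B n \<or> V = B n)" by blast
  then obtain V where V: "\<And>n P. clo P \<Longrightarrow> clo (P \<inter> V n P) \<and> clo (P - V n P) \<and> (P \<inter> B n = {} \<or> P \<subseteq> B n \<or> V n P = B n)"
    by metis
  define step where "step n b P = (if b then P \<inter> V n P else P - V n P)" for n b P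
  define st where "st f n = rec_nat C (\<lambda>n P. step n (f n) P) n" for f :: "nat \<Rightarrow> bool" and n
  have st: "st f 0 = C" "st f (Suc n) = step n (f n) (st f n)" for f n by (simp_all add: st_def)
  have closedC: "closedin Y C" using compactin_imp_closedin[OF haus C(2)] .
  have clo: "clo (st f n)" for f n
  proof (induction n)
    case (Suc n) then show ?case using V[OF Suc, of n] by (simp add: st step_def)
  qed (use C closedC in \<open>simp add: st clo_def\<close>)
  obtain e where e: "\<And>y f n. y \<in> C \<Longrightarrow> y \<in> st f n \<longleftrightarrow> (\<forall>m<n. e y m = f m)"
    "\<And>n b. openin Y {y \<in> C. e y n = b}"
  proof (rule binary_scheme[where S = "\<lambda>P. P" and st = st and ?s0.0 = C and step = step and Y = Y])
    show "openin Y (st f n)" for f n using clo by (simp add: clo_def)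
  qed (auto simp: st step_def)
  have "\<exists>n. \<forall>y'\<in>C. (\<forall>m<n. e y' m = e y m) \<longrightarrow> y' \<in> U" if U: "openin Y U" "y \<in> U" "y \<in> C" for U y
  proof -
    obtain k where k: "y \<in> B k" "B k \<subseteq> U" using clopen_baseD[OF B U(1,2)] by blast
    have y: "y \<in> st (e y) (Suc k)" using e(1)[OF U(3)] by simp
    then have yk: "y \<in> st (e y) k" by (auto simp: st step_def split: if_splits)
    have "st (e y) (Suc k) \<subseteq> B k"
      using V[OF clo[of "e y" k], of k] y yk k(1) by (auto simp: st step_def split: if_splits)
    then have "y' \<in> U" if "y' \<in> C" "\<forall>m<Suc k. e y' m = e y m" for y'
      using e(1)[OF that(1), of "e y" "Suc k"] that(2) k(2) by blast
    then show ?thesis by (intro exI[of _ "Suc k"]) blast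
  qed
  then have "charts Y C e" unfolding charts_def using e(2) by blast
  moreover have "e ` C = UNIV"
  proof -
    have "f \<in> e ` C" for f
    proof -
      have sub: "st f n \<subseteq> C" for n by (induction n) (auto simp: st step_def)
      have "(\<Inter>n. st f n) \<noteq> {}"
      proof (rule compact_space_imp_nest)
        show "compact_space (subtopology Y C)" using C(2) by (rule compact_space_subtopology)
        show "closedin (subtopology Y C) (st f n)" for n
          using clo[of f n] sub[of n] by (simp add: clo_def closedin_subset_topspace)
        show "st f n \<noteq> {}" for n using clo[of f n] by (simp add: clo_def)
        show "decseq (st f)" by (auto simp: decseq_Suc_iff st step_def)
      qed
      then obtain y where y: "\<And>n. y \<in> st f n" by blast
      then have yC: "y \<in> C" using sub by blast
      have "e y m = f m" for m using e(1)[OF yC, of f "Suc m"] y by simp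
      then show ?thesis using yC by (intro image_eqI[of _ _ y]) auto
    qed
    then show ?thesis by blast
  qed
  ultimately show thesis by (rule that)
qed

text \<open>A copy of the irrationals: the gaps between successive ones form an arbitrary sequence
  of natural numbers.\<close>

definition many_ones :: "(nat \<Rightarrow> bool) set" where
  "many_ones = {f. \<forall>n. \<exists>m\<ge>n. f m}"

lemma tail_set_many_ones: "tail_set many_ones"
  unfolding tail_set_def many_ones_def
proof (intro allI iffI CollectI)
  fix b and f :: "nat \<Rightarrow> bool" and n assume "case_nat b f \<in> {f. \<forall>n. \<exists>m\<ge>n. f m}"
  then obtain m where "m \<ge> Suc n" "case_nat b f m" by blast
  then show "\<exists>m\<ge>n. f m" by (cases m) auto
next
  fix b and f :: "nat \<Rightarrow> bool" and n assume "f \<in> {f. \<forall>n. \<exists>m\<ge>n. f m}"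
  then obtain m where "m \<ge> n" "f m" by blast
  then show "\<exists>m\<ge>n. case_nat b f m" by (intro exI[of _ "Suc m"]) simp
qed

text \<open>A cover without finite subcover is refined by small members of the base, which are then
  made disjoint. Infinitely many stay nonempty, as finitely many would give a finite
  subcover.\<close>

lemma (in Metric_space) infinite_clopen_partition:
  assumes B: "clopen_base mtopology B" and P: "closedin mtopology P" "\<not> compactin mtopology P"
    and P': "openin mtopology P" and r: "r > 0"
  shows "\<exists>D :: nat \<Rightarrow> 'a set. (\<Union>i. D i) = P \<and> (\<forall>i j. i \<noteq> j \<longrightarrow> D i \<inter> D j = {}) \<and>
    (\<forall>i. openin mtopology (D i) \<and> closedin mtopology (D i) \<and> D i \<noteq> {} \<and> (\<exists>a. D i \<subseteq> mcball a r))"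
proof -
  have PM: "P \<subseteq> M" using closedin_subset[OF P(1)] by simp
  have "\<exists>\<U>. ((\<forall>U\<in>\<U>. openin mtopology U) \<and> P \<subseteq> \<Union>\<U>) \<and> \<not> (\<exists>\<F>. finite \<F> \<and> \<F> \<subseteq> \<U> \<and> P \<subseteq> \<Union>\<F>)"
    using P(2) PM unfolding compactin_def by simp
  then obtain \<U> where U0: "\<forall>U\<in>\<U>. openin mtopology U" "P \<subseteq> \<Union>\<U>"
    "\<not> (\<exists>\<F>. finite \<F> \<and> \<F> \<subseteq> \<U> \<and> P \<subseteq> \<Union>\<F>)" by (elim exE conjE)
  have U: "openin mtopology U" if "U \<in> \<U>" for U using U0(1) that by simp
  have clB: "openin mtopology (B n)" "closedin mtopology (B n)" for n using B by (auto simp: clopen_base_def)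
  define W where "W = {n. B n \<subseteq> P \<and> (\<exists>u\<in>\<U>. B n \<subseteq> u) \<and> (\<exists>a. B n \<subseteq> mcball a r)}"
  define D where "D n = B n - (\<Union>m\<in>{m\<in>W. m < n}. B m)" for n
  define V where "V = {n \<in> W. D n \<noteq> {}}"
  have cov: "\<exists>n\<in>V. x \<in> D n" if x: "x \<in> P" for x
  proof -
    obtain u where u: "u \<in> \<U>" "x \<in> u" using U0(2) x by blast
    have xM: "x \<in> M" using x PM by blast
    have "openin mtopology (P \<inter> u \<inter> mball x r)" using P' U[OF u(1)] by auto
    moreover have "x \<in> P \<inter> u \<inter> mball x r" using x u xM r by simp
    ultimately obtain k where k: "x \<in> B k" "B k \<subseteq> P \<inter> u \<inter> mball x r"
      using clopen_baseD[OF B] by meson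
    then have "k \<in> W" using u mball_subset_mcball[of x r] unfolding W_def by blast
    then have ex: "\<exists>n. n \<in> W \<and> x \<in> B n" using k by blast
    define n where "n = (LEAST n. n \<in> W \<and> x \<in> B n)"
    have n: "n \<in> W" "x \<in> B n" using LeastI_ex[OF ex] unfolding n_def by auto
    have "x \<in> D n" using n not_less_Least[of _ "\<lambda>n. n \<in> W \<and> x \<in> B n"] unfolding D_def n_def by blast
    then show ?thesis using n unfolding V_def by blast
  qed
  have DB: "D n \<subseteq> B n" for n by (auto simp: D_def)
  have inf: "infinite V"
  proof
    assume fin: "finite V"
    have "\<forall>n\<in>V. \<exists>u. u \<in> \<U> \<and> B n \<subseteq> u" unfolding V_def W_def by blast
    from bchoice[OF this] obtain u where u: "\<forall>n\<in>V. u n \<in> \<U> \<and> B n \<subseteq> u n" ..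
    have "P \<subseteq> \<Union>(u ` V)" using cov DB u by blast
    then show False using U0(3) fin u by (meson finite_imageI image_subsetI)
  qed
  define E where "E i = D (enumerate V i)" for i
  have enV: "enumerate V i \<in> V" for i using enumerate_in_set[OF inf] .
  have disD: "D m \<inter> D n = {}" if "m \<in> W" "m < n" for m n
    using that by (auto simp: D_def)
  have "E i \<inter> E j = {}" if "i \<noteq> j" for i j
  proof -
    have "enumerate V i \<noteq> enumerate V j" using that strict_mono_enumerate[OF inf] by (simp add: strict_mono_eq)
    then consider "enumerate V i < enumerate V j" | "enumerate V j < enumerate V i" by linarith
    then show ?thesis using disD enV unfolding E_def V_def by cases blast+
  qed
  moreover have "(\<Union>i. E i) = P"
  proof (intro equalityI subsetI)
    fix x assume "x \<in> (\<Union>i. E i)"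
    then show "x \<in> P" using enV DB unfolding E_def V_def W_def by blast
  next
    fix x assume "x \<in> P"
    then obtain n where n: "n \<in> V" "x \<in> D n" using cov by blast
    then obtain i where "n = enumerate V i" using range_enumerate[OF inf] by blast
    then show "x \<in> (\<Union>i. E i)" using n by (auto simp: E_def)
  qed
  moreover have "openin mtopology (E i) \<and> closedin mtopology (E i) \<and> E i \<noteq> {} \<and> (\<exists>a. E i \<subseteq> mcball a r)" for i
  proof -
    have o: "openin mtopology (D n)" for n
      unfolding D_def by (intro openin_diff clB closedin_Union) (auto simp: clB)
    have c: "closedin mtopology (D n)" for n
      unfolding D_def by (intro closedin_diff clB openin_Union) (auto simp: clB)
    have "\<exists>a. B (enumerate V i) \<subseteq> mcball a r" using enV[of i] unfolding V_def W_def by blast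
    then show ?thesis using o c enV[of i] DB[of "enumerate V i"] unfolding E_def V_def by blast
  qed
  ultimately show ?thesis by (intro exI[of _ E]) blast
qed

text \<open>A piece of a partition is described by \<open>False\<close> until it is reached and then
  \<open>True\<close>, whereupon it is partitioned at a smaller scale. A point lies in some piece
  each time and so produces infinitely many ones. Conversely, infinitely many ones describe nested
  closed sets of vanishing size, and completeness provides a point.\<close>

lemma (in Metric_space) charts_nowhere_compact:
  assumes mc: "mcomplete" and B: "clopen_base mtopology B" and ne: "M \<noteq> {}"
    and nc: "\<And>P. openin mtopology P \<Longrightarrow> P \<noteq> {} \<Longrightarrow> \<not> compactin mtopology P"
  obtains e where "charts mtopology M e" "e ` M = many_ones"
proof -
  define clo where "clo P \<longleftrightarrow> openin mtopology P \<and> closedin mtopology P \<and> P \<noteq> {}" for P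
  have "\<exists>D :: nat \<Rightarrow> 'a set. clo P \<longrightarrow> (\<Union>i. D i) = P \<and> (\<forall>i j. i \<noteq> j \<longrightarrow> D i \<inter> D j = {}) \<and>
      (\<forall>i. clo (D i) \<and> (\<exists>a. D i \<subseteq> mcball a ((1/2)^k)))" for k :: nat and P
  proof (cases "clo P")
    case True
    then show ?thesis
      using infinite_clopen_partition[OF B, of P "(1/2)^k"] nc[of P] by (simp add: clo_def)
  qed simp
  then have "\<forall>k P. \<exists>D :: nat \<Rightarrow> 'a set. clo P \<longrightarrow> (\<Union>i. D i) = P \<and> (\<forall>i j. i \<noteq> j \<longrightarrow> D i \<inter> D j = {}) \<and>
      (\<forall>i. clo (D i) \<and> (\<exists>a. D i \<subseteq> mcball a ((1/2)^k)))" by blast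
  then obtain part :: "nat \<Rightarrow> 'a set \<Rightarrow> nat \<Rightarrow> 'a set" where
    part': "\<forall>k P. clo P \<longrightarrow> (\<Union>i. part k P i) = P \<and> (\<forall>i j. i \<noteq> j \<longrightarrow> part k P i \<inter> part k P j = {}) \<and>
      (\<forall>i. clo (part k P i) \<and> (\<exists>a. part k P i \<subseteq> mcball a ((1/2)^k)))" by metis
  have part: "(\<Union>i. part k P i) = P" "i \<noteq> j \<Longrightarrow> part k P i \<inter> part k P j = {}"
    "clo (part k P i)" "\<exists>a. part k P i \<subseteq> mcball a ((1/2)^k)" if "clo P" for k P i j
    using part' that by simp_all
  \<comment> \<open>A state consists of an enumerated partition and the number of its pieces already
    rejected.\<close>
  define S where "S s = (\<Union>j\<in>{snd s..}. fst s j)" for s :: "(nat \<Rightarrow> 'a set) \<times> nat"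
  define step where "step n b s = (if b then (part (Suc n) (fst s (snd s)), 0) else (fst s, Suc (snd s)))"
    for n and b :: bool and s :: "(nat \<Rightarrow> 'a set) \<times> nat"
  define s0 where "s0 = (part 0 M, 0::nat)"
  define st where "st f n = rec_nat s0 (\<lambda>n s. step n (f n) s) n" for f :: "nat \<Rightarrow> bool" and n
  have st: "st f 0 = s0" "st f (Suc n) = step n (f n) (st f n)" for f n by (simp_all add: st_def)
  have cloM: "clo M" using ne openin_topspace[of mtopology] closedin_topspace[of mtopology] by (simp add: clo_def)
  \<comment> \<open>The union is required to be closed because the set of a state arises from it by
    removing finitely many open pieces.\<close>
  define fam where "fam D \<longleftrightarrow> (\<forall>i j. i \<noteq> j \<longrightarrow> D i \<inter> D j = {}) \<and> (\<forall>i. clo (D i)) \<and>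
    closedin mtopology (\<Union>i. D i)" for D :: "nat \<Rightarrow> 'a set"
  have fam_part: "fam (part k P)" if "clo P" for k P
    using part[OF that] that unfolding fam_def by (simp add: clo_def)
  have fam: "fam (fst (st f n))" for f n
  proof (induction n)
    case (Suc n)
    then have "clo (fst (st f n) (snd (st f n)))" by (simp add: fam_def)
    then show ?case using Suc fam_part by (simp add: st step_def)
  qed (simp add: st s0_def fam_part cloM)
  have clo_st: "clo (fst (st f n) i)" for f n i using fam[of f n] by (simp add: fam_def)
  have dis_st: "fst (st f n) i \<inter> fst (st f n) j = {}" if "i \<noteq> j" for f n i j
    using fam[of f n] that by (simp add: fam_def)
  have ST: "S (step n True (st f n)) = fst (st f n) (snd (st f n))" for f n
    using part(1)[OF clo_st] by (simp add: S_def step_def)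
  have SF: "S (step n False (st f n)) = (\<Union>j\<in>{Suc (snd (st f n))..}. fst (st f n) j)" for f n
    by (simp add: S_def step_def)
  have SM: "S s0 = M" using part(1)[OF cloM] by (simp add: S_def s0_def)
  have split_atLeast: "{m..} = insert m {Suc m..}" for m :: nat by auto
  have un: "S (st f n) = S (step n True (st f n)) \<union> S (step n False (st f n))" for f n
    unfolding ST SF unfolding S_def split_atLeast[of "snd (st f n)"] by simp
  have dis: "S (step n True (st f n)) \<inter> S (step n False (st f n)) = {}" for f n
  proof -
    have "fst (st f n) (snd (st f n)) \<inter> fst (st f n) j = {}" if "j \<in> {Suc (snd (st f n))..}" for j
      using dis_st[of "snd (st f n)" j f n] that by simp
    then show ?thesis unfolding ST SF by blast
  qed
  have op: "openin mtopology (S (st f n))" for f n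
    unfolding S_def using clo_st by (intro openin_Union) (auto simp: clo_def)
  have cl: "closedin mtopology (S (st f n))" for f n
  proof -
    have "S (st f n) = (\<Union>i. fst (st f n) i) - (\<Union>i\<in>{..<snd (st f n)}. fst (st f n) i)" (is "_ = ?A - ?B")
    proof (intro equalityI subsetI)
      fix y assume "y \<in> S (st f n)"
      then obtain j where j: "j \<ge> snd (st f n)" "y \<in> fst (st f n) j" by (auto simp: S_def)
      have "y \<notin> fst (st f n) i" if "i < snd (st f n)" for i
        using dis_st[of i j f n] j that by auto
      then show "y \<in> ?A - ?B" using j by blast
    next
      fix y assume y: "y \<in> ?A - ?B"
      then obtain i where i: "y \<in> fst (st f n) i" by blast
      then have "i \<notin> {..<snd (st f n)}" using y by blast
      then show "y \<in> S (st f n)" unfolding S_def using i by (intro UN_I[of i]) simp_all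
    qed
    moreover have "openin mtopology ?B" using clo_st by (intro openin_Union) (auto simp: clo_def)
    ultimately show ?thesis using fam[of f n] by (simp add: fam_def closedin_diff)
  qed
  obtain e :: "'a \<Rightarrow> nat \<Rightarrow> bool" where e: "\<And>y f n. y \<in> M \<Longrightarrow> y \<in> S (st f n) \<longleftrightarrow> (\<forall>m<n. e y m = f m)"
    "\<And>n b. openin mtopology {y \<in> M. e y n = b}"
    by (rule binary_scheme[where S = S and st = st and ?s0.0 = s0 and step = step and Y = mtopology])
      (use st op un dis SM in auto)
  have small: "\<exists>a. fst (st f n) i \<subseteq> mcball a ((1/2)^m)" if "f m" "m < n" for f m n i
    using that(2)
  proof (induction n arbitrary: i)
    case (Suc n)
    show ?case
    proof (cases "f n")
      case True
      then have "fst (st f (Suc n)) = part (Suc n) (fst (st f n) (snd (st f n)))" by (simp add: st step_def)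
      then obtain a where a: "fst (st f (Suc n)) i \<subseteq> mcball a ((1/2)^Suc n)" using part(4)[OF clo_st] by metis
      have "(1/2::real)^Suc n \<le> (1/2)^m" using Suc.prems by (intro power_decreasing) auto
      then show ?thesis using a mcball_subset_concentric by blast
    next
      case False
      then have "m < n" using Suc.prems that(1) by (metis less_SucE)
      then show ?thesis using Suc.IH False by (simp add: st step_def)
    qed
  qed simp
  \<comment> \<open>Two ones are needed: the first introduces small pieces, a later one selects a
    single one of them.\<close>
  have small_S: "\<exists>n a. S (st f n) \<subseteq> mcball a r" if f: "f \<in> many_ones" and r: "r > 0" for f r
  proof -
    obtain k where k: "(1/2::real)^k < r" using half_power_less[OF r] by blast
    obtain m where m: "m \<ge> k" "f m" using f by (auto simp: many_ones_def)
    obtain n where n: "n \<ge> Suc m" "f n" using f unfolding many_ones_def by blast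
    obtain a where a: "fst (st f n) (snd (st f n)) \<subseteq> mcball a ((1/2)^m)" using small[of f m n] m n by auto
    have "(1/2::real)^m \<le> (1/2)^k" using m(1) by (intro power_decreasing) auto
    then have "mcball a ((1/2)^m) \<subseteq> mcball a r" using k by (intro mcball_subset_concentric) linarith
    moreover have "S (st f (Suc n)) = fst (st f n) (snd (st f n))" using ST[of n f] n(2) by (simp add: st)
    ultimately show ?thesis using a by blast
  qed
  \<comment> \<open>With only \<open>False\<close> from stage \<open>n\<close> on, the position
    would move past the piece that contains \<open>y\<close>.\<close>
  have many: "e y \<in> many_ones" if y: "y \<in> M" for y
  proof (rule ccontr)
    assume "e y \<notin> many_ones"
    then obtain n where n: "\<And>m. m \<ge> n \<Longrightarrow> \<not> e y m" by (auto simp: many_ones_def)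
    have it: "st (e y) (n + k) = (fst (st (e y) n), snd (st (e y) n) + k)" for k
      by (induction k) (simp_all add: st step_def n)
    have "y \<in> S (st (e y) n)" using e(1)[OF y] by simp
    then obtain j where j: "j \<ge> snd (st (e y) n)" "y \<in> fst (st (e y) n) j" by (auto simp: S_def)
    have "y \<in> S (st (e y) (n + Suc j))" using e(1)[OF y] by simp
    then obtain i where "i \<ge> snd (st (e y) n) + Suc j" "y \<in> fst (st (e y) n) i" unfolding it by (auto simp: S_def)
    then show False using dis_st[of i j "e y" n] j by auto
  qed
  have "\<exists>n. \<forall>y'\<in>M. (\<forall>m<n. e y' m = e y m) \<longrightarrow> y' \<in> U" if U: "openin mtopology U" "y \<in> U" "y \<in> M" for U y
  proof -
    obtain r where r: "r > 0" "mball y r \<subseteq> U" using U by (auto simp: openin_mtopology)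
    obtain n a where na: "S (st (e y) n) \<subseteq> mcball a (r / 3)" using small_S[OF many[OF U(3)], of "r / 3"] r by auto
    have y: "y \<in> S (st (e y) n)" using e(1)[OF U(3)] by simp
    have "y' \<in> U" if "y' \<in> M" "\<forall>m<n. e y' m = e y m" for y'
    proof -
      have "y' \<in> mcball a (r / 3)" "y \<in> mcball a (r / 3)" using e(1)[OF that(1), of "e y" n] that(2) na y by blast+
      then have "d y y' < r" using triangle''[of y a y'] r by auto
      then show ?thesis using r U(3) that(1) by auto
    qed
    then show ?thesis by blast
  qed
  then have "charts mtopology M e" unfolding charts_def using e(2) by blast
  moreover have "e ` M = many_ones"
  proof (intro equalityI subsetI)
    fix f assume f: "f \<in> many_ones"
    have "\<Inter>(range (\<lambda>n. S (st f n))) \<noteq> {}"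
    proof (rule mc[unfolded mcomplete_nest, rule_format, of "\<lambda>n. S (st f n)"], intro conjI allI impI)
      show "closedin mtopology (S (st f n))" for n by (rule cl)
      show "S (st f n) \<noteq> {}" for n using clo_st[of f n "snd (st f n)"] by (auto simp: S_def clo_def)
      have "S (st f (Suc n)) \<subseteq> S (st f n)" for n using un[of f n] by (cases "f n") (auto simp: st)
      then show "decseq (\<lambda>n. S (st f n))" by (simp add: decseq_Suc_iff)
      fix r :: real assume "r > 0"
      then show "\<exists>n a. S (st f n) \<subseteq> mcball a r" using small_S[OF f] by blast
    qed
    then obtain y where y: "\<And>n. y \<in> S (st f n)" by blast
    then have yM: "y \<in> M" using y[of 0] SM by (simp add: st)
    have "e y m = f m" for m using e(1)[OF yM, of f "Suc m"] y by simp
    then show "f \<in> e ` M" using yM by (intro image_eqI[of _ _ y]) auto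
  qed (use many in auto)
  ultimately show thesis by (rule that)
qed

text \<open>The chart occupies the half beginning with \<open>False\<close>; the rest of
  \<open>Y\<close> goes to the other half, with its memberships in the base as coordinates.\<close>

lemma homeomorphic_cantor_subset_of_charts:
  assumes haus: "Hausdorff_space Y" and B: "clopen_base Y B" and C: "openin Y C" "closedin Y C"
    and e: "charts Y C e"
  obtains T where "\<forall>f. case_nat False f \<in> T \<longleftrightarrow> f \<in> e ` C"
    "Y homeomorphic_space subtopology cantor_space T"
proof -
  have CY: "C \<subseteq> topspace Y" using openin_subset[OF C(1)] .
  define g where "g y = (if y \<in> C then case_nat False (e y) else case_nat True (\<lambda>n. y \<in> B n))" for y
  have e1: "openin Y {y \<in> C. e y n = b}" for n b using e unfolding charts_def by blast
  have e2: "\<exists>n. \<forall>y'\<in>C. (\<forall>m<n. e y' m = e y m) \<longrightarrow> y' \<in> U" if "openin Y U" "y \<in> U" "y \<in> C" for U y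
    using e that unfolding charts_def by simp
  have "openin Y {y \<in> topspace Y. g y n = b}" for n b
  proof (cases n)
    case 0
    then have "{y \<in> topspace Y. g y n = b} = (if b then topspace Y - C else C)" using CY by (auto simp: g_def)
    then show ?thesis using C by (simp add: closedin_def)
  next
    case (Suc m)
    then have "{y \<in> topspace Y. g y n = b} = {y \<in> C. e y m = b} \<union> ({y \<in> topspace Y. (y \<in> B m) = b} - C)"
      using CY by (auto simp: g_def)
    then show ?thesis using e1 clopen_base_mem_eq[OF B] C(2) by (simp add: openin_Un openin_diff)
  qed
  moreover have "\<exists>n. \<forall>y'\<in>topspace Y. (\<forall>m<n. g y' m = g y m) \<longrightarrow> y' \<in> U" if U: "openin Y U" "y \<in> U" for U y
  proof (cases "y \<in> C")
    case y: True
    obtain n where n: "\<forall>y'\<in>C. (\<forall>m<n. e y' m = e y m) \<longrightarrow> y' \<in> U" using e2[OF U y] ..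
    have "y' \<in> U" if y': "\<forall>m<Suc n. g y' m = g y m" for y'
    proof -
      have "y' \<in> C" using y'[rule_format, of 0] y by (simp add: g_def split: if_splits)
      moreover have "e y' m = e y m" if "m < n" for m
        using y'[rule_format, of "Suc m"] that y \<open>y' \<in> C\<close> by (simp add: g_def)
      ultimately show ?thesis using n by blast
    qed
    then show ?thesis by (intro exI[of _ "Suc n"]) blast
  next
    case y: False
    obtain k where k: "y \<in> B k" "B k \<subseteq> U" using clopen_baseD[OF B U] by blast
    have "y' \<in> U" if y': "\<forall>m<Suc (Suc k). g y' m = g y m" for y'
    proof -
      have "y' \<notin> C" using y'[rule_format, of 0] y by (simp add: g_def split: if_splits)
      then have "y' \<in> B k" using y'[rule_format, of "Suc k"] y k(1) by (simp add: g_def)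
      then show ?thesis using k by blast
    qed
    then show ?thesis by (intro exI[of _ "Suc (Suc k)"]) blast
  qed
  ultimately have hom: "Y homeomorphic_space subtopology cantor_space (g ` topspace Y)"
    by (intro homeomorphic_cantor_subset[OF haus])
  have "case_nat False f \<in> g ` topspace Y \<longleftrightarrow> f \<in> e ` C" for f
  proof
    assume "case_nat False f \<in> g ` topspace Y"
    then obtain y where y: "case_nat False f = g y" by blast
    have "y \<in> C" using fun_cong[OF y, of 0] by (simp add: g_def split: if_splits)
    moreover have "f m = e y m" for m using fun_cong[OF y, of "Suc m"] \<open>y \<in> C\<close> by (simp add: g_def)
    ultimately show "f \<in> e ` C" by (intro image_eqI[of _ _ y]) auto
  next
    assume "f \<in> e ` C"
    then obtain y where y: "y \<in> C" "f = e y" by blast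
    then have "case_nat False f = g y" by (simp add: g_def)
    then show "case_nat False f \<in> g ` topspace Y" using y(1) CY by blast
  qed
  then show thesis using that hom by blast
qed

text \<open>One compact open set yields a full \<open>R\<close>, whatever the rest of
  \<open>Y\<close> looks like. If there is none, the chart is defined on all of
  \<open>Y\<close>.\<close>

lemma zero_dimensional_polish_model:
  assumes "topspace Y \<noteq> {}" "zero_dimensional_space Y" "polish_space Y" "no_isolated_points Y"
  obtains R T where "tail_set R" "(\<lambda>_. True) \<in> R" "\<forall>f. case_nat False f \<in> T \<longleftrightarrow> f \<in> R"
    "Y homeomorphic_space subtopology cantor_space T"
proof -
  have cm: "completely_metrizable_space Y" and sep: "separable_space Y"
    using assms(3) by (auto simp: polish_space_def)
  have met: "metrizable_space Y" by (rule completely_metrizable_imp_metrizable_space[OF cm])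
  have haus: "Hausdorff_space Y" by (rule metrizable_imp_Hausdorff_space[OF met])
  obtain B where B: "clopen_base Y B"
    using clopen_base_exists[OF assms(2) metrizable_separable_imp_second_countable[OF met sep]] .
  show thesis
  proof (cases "\<exists>C. openin Y C \<and> compactin Y C \<and> C \<noteq> {}")
    case True
    then obtain C where C: "openin Y C" "compactin Y C" "C \<noteq> {}" by blast
    obtain e where e: "charts Y C e" "e ` C = UNIV" by (rule charts_compact[OF haus assms(4) B C])
    obtain T where T: "\<forall>f. case_nat False f \<in> T \<longleftrightarrow> f \<in> e ` C"
      "Y homeomorphic_space subtopology cantor_space T"
      by (rule homeomorphic_cantor_subset_of_charts[OF haus B C(1) compactin_imp_closedin[OF haus C(2)] e(1)])
    show thesis by (rule that[OF _ _ T(1)[unfolded e(2)] T(2)]) (simp_all add: tail_set_def)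
  next
    case False
    obtain M d where "Metric_space M d" "Metric_space.mcomplete M d" and Y: "Y = Metric_space.mtopology M d"
      using cm unfolding completely_metrizable_space_def by blast
    then interpret Metric_space M d by simp
    obtain e where e: "charts mtopology M e" "e ` M = many_ones"
      by (rule charts_nowhere_compact[OF \<open>mcomplete\<close> B[unfolded Y]]) (use False assms(1) in \<open>auto simp: Y\<close>)
    obtain T where T: "\<forall>f. case_nat False f \<in> T \<longleftrightarrow> f \<in> e ` M"
      "Y homeomorphic_space subtopology cantor_space T"
      by (rule homeomorphic_cantor_subset_of_charts[OF haus B _ _ e(1)[folded Y]])
        (use openin_topspace[of Y] closedin_topspace[of Y] in \<open>simp_all add: Y\<close>)
    show thesis
      by (rule that[OF tail_set_many_ones _ T(1)[unfolded e(2)] T(2)]) (simp add: many_ones_def, blast)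
  qed
qed

subsection \<open>Partitions and covers\<close>

lemma homeomorphic_space_sub:
  assumes "subtopology X A homeomorphic_space Y" "A \<subseteq> topspace X"
  obtains h where "inj_on h (topspace Y)" "h ` topspace Y = A"
    "\<And>Q Z. Q \<subseteq> topspace Y \<Longrightarrow> subtopology Y Q homeomorphic_space Z \<Longrightarrow> subtopology X (h ` Q) homeomorphic_space Z"
proof -
  obtain h where h: "homeomorphic_map Y (subtopology X A) h"
    using assms(1) homeomorphic_space homeomorphic_space_sym by blast
  have im: "h ` topspace Y = A" using homeomorphic_imp_surjective_map[OF h] assms(2) by (simp add: inf.absorb2)
  have "subtopology X (h ` Q) homeomorphic_space Z"
    if Q: "Q \<subseteq> topspace Y" "subtopology Y Q homeomorphic_space Z" for Q Z
  proof -
    have hQ: "h ` Q \<subseteq> A" using im Q(1) by blast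
    have "homeomorphic_map (subtopology Y Q) (subtopology (subtopology X A) (h ` Q)) h"
      by (rule homeomorphic_map_subtopologies[OF h]) (use Q(1) hQ assms(2) in \<open>auto simp: inf.absorb2\<close>)
    then have "subtopology Y Q homeomorphic_space subtopology X (h ` Q)"
      using hQ by (simp add: subtopology_subtopology inf.absorb2 homeomorphic_map_imp_homeomorphic_space)
    then show ?thesis using Q(2) homeomorphic_space_sym homeomorphic_space_trans by blast
  qed
  then show thesis using that[of h] homeomorphic_imp_injective_map[OF h] im by blast
qed

lemma coverable_trans:
  assumes "coverable X Y" "partitionable Y Z"
  shows "coverable X Z"
proof -
  obtain \<C> where C: "\<Union>\<C> = topspace X" "\<forall>A\<in>\<C>. subtopology X A homeomorphic_space Y"
    using assms(1) unfolding coverable_def by (elim exE conjE)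
  obtain \<Q> where Q: "\<Union>\<Q> = topspace Y" "disjoint \<Q>" "\<forall>Q\<in>\<Q>. subtopology Y Q homeomorphic_space Z"
    using assms(2) unfolding partitionable_def by (elim exE conjE)
  have ex: "\<exists>P. x \<in> P \<and> P \<subseteq> topspace X \<and> subtopology X P homeomorphic_space Z" if x: "x \<in> topspace X" for x
  proof -
    obtain A where A: "A \<in> \<C>" "x \<in> A" using x unfolding C(1)[symmetric] by blast
    have AX: "A \<subseteq> topspace X" using C(1) A by blast
    obtain h where h: "h ` topspace Y = A"
      "\<And>Q (Z :: 'c topology). Q \<subseteq> topspace Y \<Longrightarrow> subtopology Y Q homeomorphic_space Z \<Longrightarrow> subtopology X (h ` Q) homeomorphic_space Z"
      using homeomorphic_space_sub[OF C(2)[rule_format, OF A(1)] AX] by metis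
    obtain y where y: "y \<in> topspace Y" "x = h y" using A(2) h(1) by blast
    then obtain P where P: "P \<in> \<Q>" "y \<in> P" using Q(1) by blast
    then have "P \<subseteq> topspace Y" using Q(1) by blast
    then have "subtopology X (h ` P) homeomorphic_space Z" "h ` P \<subseteq> topspace X"
      using h Q(3) P(1) AX by blast+
    then show ?thesis using y P by blast
  qed
  show ?thesis
    unfolding coverable_def
    by (rule exI[of _ "{P. P \<subseteq> topspace X \<and> subtopology X P homeomorphic_space Z}"]) (use ex in blast)
qed

lemma partitionable_trans:
  fixes X :: "'a topology" and Y :: "'b topology" and Z :: "'c topology"
  assumes "partitionable X Y" "partitionable Y Z"
  shows "partitionable X Z"
proof -
  obtain \<P> where P: "\<Union>\<P> = topspace X" "disjoint \<P>" "\<forall>A\<in>\<P>. subtopology X A homeomorphic_space Y"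
    using assms(1) unfolding partitionable_def by (elim exE conjE)
  obtain \<Q> where Q: "\<Union>\<Q> = topspace Y" "disjoint \<Q>" "\<forall>Q\<in>\<Q>. subtopology Y Q homeomorphic_space Z"
    using assms(2) unfolding partitionable_def by (elim exE conjE)
  have "\<forall>A\<in>\<P>. \<exists>h. inj_on h (topspace Y) \<and> h ` topspace Y = A \<and>
    (\<forall>Q. Q \<subseteq> topspace Y \<longrightarrow> subtopology Y Q homeomorphic_space Z \<longrightarrow> subtopology X (h ` Q) homeomorphic_space Z)"
  proof
    fix A assume A: "A \<in> \<P>"
    have "A \<subseteq> topspace X" using A P(1) by blast
    from homeomorphic_space_sub[OF P(3)[rule_format, OF A] this]
    show "\<exists>h. inj_on h (topspace Y) \<and> h ` topspace Y = A \<and>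
      (\<forall>Q. Q \<subseteq> topspace Y \<longrightarrow> subtopology Y Q homeomorphic_space Z \<longrightarrow> subtopology X (h ` Q) homeomorphic_space Z)"
      by metis
  qed
  from bchoice[OF this] obtain h where h: "\<forall>A\<in>\<P>. inj_on (h A) (topspace Y) \<and> h A ` topspace Y = A \<and>
    (\<forall>Q. Q \<subseteq> topspace Y \<longrightarrow> subtopology Y Q homeomorphic_space Z \<longrightarrow> subtopology X (h A ` Q) homeomorphic_space Z)" ..
  have QY: "q \<subseteq> topspace Y" if "q \<in> \<Q>" for q using that Q(1) by blast
  have sub: "h A ` q \<subseteq> A" if "A \<in> \<P>" "q \<in> \<Q>" for A q using h that QY by blast
  show ?thesis
  proof (rule partitionableI[where S = "\<lambda>(A, q). h A ` q" and A = "\<P> \<times> \<Q>"])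
    have "(\<Union>q\<in>\<Q>. h A ` q) = A" if "A \<in> \<P>" for A
    proof -
      have "h A ` \<Union>\<Q> = A" using h that unfolding Q(1) by blast
      then show ?thesis by (simp only: image_Union)
    qed
    then show "\<Union>((\<lambda>(A, q). h A ` q) ` (\<P> \<times> \<Q>)) = topspace X" unfolding P(1)[symmetric] by fastforce
  next
    fix a b assume ab: "a \<in> \<P> \<times> \<Q>" "b \<in> \<P> \<times> \<Q>" "a \<noteq> b"
    obtain A q A' q' where eq: "a = (A, q)" "b = (A', q')" by (metis surj_pair)
    show "(\<lambda>(A, q). h A ` q) a \<inter> (\<lambda>(A, q). h A ` q) b = {}"
    proof (cases "A = A'")
      case True
      then have "q \<inter> q' = {}" using ab eq Q(2) by (auto simp: disjoint_def)
      moreover have "inj_on (h A) (topspace Y)" using h ab eq by simp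
      ultimately have "h A ` q \<inter> h A ` q' = {}"
        using inj_on_image_Int[of "h A" "topspace Y" q q'] QY ab eq by auto
      then show ?thesis using True eq by simp
    next
      case False
      then have "A \<inter> A' = {}" using ab eq P(2) by (auto simp: disjoint_def)
      then show ?thesis using sub[of A q] sub[of A' q'] ab eq by auto
    qed
  next
    fix a assume "a \<in> \<P> \<times> \<Q>"
    then show "subtopology X ((\<lambda>(A, q). h A ` q) a) homeomorphic_space Z"
      using h QY Q(3) by auto
  qed
qed

lemma partitionable_homeomorphic:
  "partitionable X Y \<Longrightarrow> Z homeomorphic_space Y \<Longrightarrow> partitionable X Z"
  unfolding partitionable_def by (meson homeomorphic_space_sym homeomorphic_space_trans)

lemma partitionable_imp_coverable: "partitionable X Y \<Longrightarrow> coverable X Y"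
proof -
  assume "partitionable X Y"
  then obtain \<P> where "\<Union>\<P> = topspace X" "disjoint \<P>" "\<forall>A\<in>\<P>. subtopology X A homeomorphic_space Y"
    unfolding partitionable_def by (elim exE conjE)
  then show "coverable X Y" unfolding coverable_def by (intro exI[of _ \<P>] conjI)
qed

lemma coverable_no_isolated_points:
  assumes "coverable X Y" "no_isolated_points Y"
  shows "no_isolated_points X"
  unfolding no_isolated_points_def
proof (intro ballI notI)
  fix x assume x: "x \<in> topspace X" "openin X {x}"
  then obtain A where A: "x \<in> A" "A \<subseteq> topspace X" "subtopology X A homeomorphic_space Y"
    using assms(1) unfolding coverable_def by blast
  then obtain h where h: "homeomorphic_map (subtopology X A) Y h" using homeomorphic_space by blast
  have "openin (subtopology X A) {x}" using x(2) A(1) by (auto simp: openin_subtopology intro: exI[of _ "{x}"])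
  then have "openin Y (h ` {x})"
    using homeomorphic_imp_open_map[OF h] unfolding open_map_def by blast
  moreover have "h x \<in> topspace Y"
    using homeomorphic_imp_surjective_map[OF h] A by auto
  ultimately show False using assms(2) by (simp add: no_isolated_points_def)
qed

lemma no_isolated_points_cantor_space: "no_isolated_points cantor_space"
  unfolding no_isolated_points_def
proof (intro ballI notI)
  fix f :: "nat \<Rightarrow> bool" assume "openin cantor_space {f}"
  then obtain n where n: "\<forall>g. (\<forall>m<n. g m = f m) \<longrightarrow> g = f" by (auto simp: openin_cantor_space)
  have "f(n := \<not> f n) = f" by (rule n[rule_format]) simp
  then show False by (metis fun_upd_same)
qed

lemma first_countable_cantor_space: "first_countable cantor_space"
  unfolding first_countable_def
proof
  fix f :: "nat \<Rightarrow> bool"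
  let ?B = "range (\<lambda>n. {g. \<forall>m<n. g m = f m})"
  have "openin cantor_space {g. \<forall>m<n. g m = f m}" for n
    unfolding openin_cantor_space by (intro ballI exI[of _ n]) auto
  then have "\<forall>V\<in>?B. openin cantor_space V" by blast
  moreover have "\<forall>U. openin cantor_space U \<and> f \<in> U \<longrightarrow> (\<exists>V\<in>?B. f \<in> V \<and> V \<subseteq> U)"
  proof (intro allI impI)
    fix U assume U: "openin cantor_space U \<and> f \<in> U"
    then obtain n where "\<forall>g. (\<forall>m<n. g m = f m) \<longrightarrow> g \<in> U" unfolding openin_cantor_space by blast
    then show "\<exists>V\<in>?B. f \<in> V \<and> V \<subseteq> U" by (intro bexI[of _ "{g. \<forall>m<n. g m = f m}"]) auto
  qed
  ultimately show "\<exists>\<B>. countable \<B> \<and> (\<forall>V\<in>\<B>. openin cantor_space V) \<and>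
      (\<forall>U. openin cantor_space U \<and> f \<in> U \<longrightarrow> (\<exists>V\<in>\<B>. f \<in> V \<and> V \<subseteq> U))"
    by (intro exI[of _ ?B] conjI) auto
qed

text \<open>Each point lies in a Cantor set, of which a small cylinder fits into any neighbourhood;
  so every maximal disjoint family is dense.\<close>

lemma dense_family_of_coverable:
  assumes "Hausdorff_space X" "coverable X cantor_space"
  obtains \<M> h where "cantor_family X \<M> h" "\<forall>U. openin X U \<longrightarrow> U \<noteq> {} \<longrightarrow> U \<inter> \<Union>\<M> \<noteq> {}"
proof -
  obtain \<M> where \<M>: "disjoint \<M>" "\<And>P. P \<in> \<M> \<Longrightarrow> cantor_copy X P"
    and max: "\<And>K. cantor_copy X K \<Longrightarrow> K \<inter> \<Union>\<M> \<noteq> {}"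
    by (rule maximal_cantor_family[of "{}" X]) (auto simp: disjoint_def)
  have small: "\<exists>K. cantor_copy X K \<and> K \<subseteq> U" if U: "openin X U" "U \<noteq> {}" for U
  proof -
    obtain x where x: "x \<in> U" using U(2) by blast
    then have "x \<in> topspace X" using openin_subset[OF U(1)] by blast
    then obtain A where A: "x \<in> A" "A \<subseteq> topspace X" "subtopology X A homeomorphic_space cantor_space"
      using assms(2) unfolding coverable_def by blast
    have "cantor_copy X A" unfolding cantor_copy_def
      by (rule homeomorphic_cantor_imp_cantor_map[OF A(3,2)])
    then show ?thesis using cantor_copy_small[OF _ U(1)] x A(1) by blast
  qed
  obtain h where "cantor_family X \<M> h" using cantor_family_choice[OF assms(1) \<M>] by blast
  then show thesis using that dense_cantor_family[OF small max] by blast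
qed

theorem theorem5p2:
  fixes Y :: "'b topology"
  assumes "topspace Y \<noteq> {}"
    and "zero_dimensional_space Y"
    and "polish_space Y"
    and "no_isolated_points Y"
  shows "partitionable cantor_space Y \<and> partitionable Y cantor_space \<and>
    (\<forall>X :: 'a topology. first_countable X \<and> Hausdorff_space X \<and> |topspace X| \<le>o continuum
        \<longrightarrow> (partitionable X Y \<longleftrightarrow> coverable X Y)) \<and>
    (\<forall>X :: 'a topology. metrizable_space X \<and> card_le_continuum_succ_omega (topspace X)
        \<longrightarrow> (partitionable X Y \<longleftrightarrow> coverable X Y)) \<and>
    (\<forall>X :: 'a topology. completely_metrizable_space X
        \<longrightarrow> (partitionable X Y \<longleftrightarrow> coverable X Y) \<and>
            (coverable X Y \<longleftrightarrow> no_isolated_points X))"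
proof -
  obtain R T where T': "tail_set R" "(\<lambda>_. True) \<in> R" "\<forall>f. case_nat False f \<in> T \<longleftrightarrow> f \<in> R"
    and hom: "Y homeomorphic_space subtopology cantor_space T"
    by (rule zero_dimensional_polish_model[OF assms])
  note T = T'(1,2) T'(3)[rule_format]
  \<comment> \<open>\<open>Y\<close> itself is completely metrizable without isolated
    points.\<close>
  have YC: "partitionable Y cantor_space"
    by (rule partitionable_complete) (use assms in \<open>auto simp: polish_space_def\<close>)
  have CY: "partitionable cantor_space Y"
  proof -
    \<comment> \<open>The whole space as its only copy forms a dense family.\<close>
    have "cantor_map cantor_space id"
      by (rule continuous_map_cantor_map) (auto simp: continuous_map_id)
    then interpret cantor_family cantor_space "{UNIV}" "\<lambda>_. id"
      by unfold_locales (auto simp: Hausdorff_cantor_space disjoint_def)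
    have "partitionable cantor_space (subtopology cantor_space T)"
      by (rule partitionable_le_continuum[OF first_countable_cantor_space no_isolated_points_cantor_space _ _ T])
        (auto simp: card_of_mono1)
    then show ?thesis using partitionable_homeomorphic hom by blast
  qed
  \<comment> \<open>Up to the continuum the points are absorbed directly into copies of
    \<open>Y\<close>, as in the Cantor space.\<close>
  have "partitionable X Y" if X: "first_countable X" "Hausdorff_space X" "|topspace X| \<le>o continuum"
    and cov: "coverable X Y" for X :: "'a topology"
  proof -
    obtain \<M> h where M': "cantor_family X \<M> h" "\<forall>U. openin X U \<longrightarrow> U \<noteq> {} \<longrightarrow> U \<inter> \<Union>\<M> \<noteq> {}"
      by (rule dense_family_of_coverable[OF X(2) coverable_trans[OF cov YC]])
    note M = M'(1) M'(2)[rule_format]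
    have "partitionable X (subtopology cantor_space T)"
      by (rule cantor_family.partitionable_le_continuum[OF M(1) X(1)
            coverable_no_isolated_points[OF cov assms(4)] _ M(2) T]) (use X(3) in \<open>auto simp: continuum_eq\<close>)
    then show ?thesis using partitionable_homeomorphic hom by blast
  qed
  moreover have "partitionable X Y" if X: "metrizable_space X" "card_le_continuum_succ_omega (topspace X)"
    and cov: "coverable X Y" for X :: "'a topology"
  proof -
    have haus: "Hausdorff_space X" by (rule metrizable_imp_Hausdorff_space[OF X(1)])
    obtain \<M> h where M': "cantor_family X \<M> h" "\<forall>U. openin X U \<longrightarrow> U \<noteq> {} \<longrightarrow> U \<inter> \<Union>\<M> \<noteq> {}"
      by (rule dense_family_of_coverable[OF haus coverable_trans[OF cov YC]])
    note M = M'(1) M'(2)[rule_format]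
    have "|U - \<Union>\<M>| \<le>o |{M \<in> \<M>. M \<inter> U \<noteq> {}} \<times> \<CC>|" if U: "openin X U" for U
    proof (cases "U = {}")
      case True then show ?thesis by (simp add: card_of_empty)
    next
      case False
      then have ne: "{M \<in> \<M>. M \<inter> U \<noteq> {}} \<noteq> {}" using M(2)[OF U] by blast
      \<comment> \<open>Density bounds \<open>U\<close> by a countable power, and the hypothesis on
        the size of \<open>X\<close> removes the power.\<close>
      have "|U| \<le>o |{M \<in> \<M>. M \<inter> U \<noteq> {}} \<times> \<CC>|"
        by (rule card_le_seqs[OF X(2) openin_subset[OF U] cantor_set_le_Times[OF ne]
              cantor_family.card_le_seqs_of_dense[OF M(1) X(1) M(2) U]])
      then show ?thesis by (rule ordLeq_transitive[OF card_of_mono1[OF Diff_subset]])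
    qed
    then have "partitionable X cantor_space"
      by (intro cantor_family.partitionable_metrizable[OF M(1) X(1) M(2)])
    \<comment> \<open>Here Cantor sets have absorbed the leftover; each of them is now cut into
      copies of \<open>Y\<close>.\<close>
    then show ?thesis using CY by (rule partitionable_trans)
  qed
  moreover have "partitionable X Y" if "completely_metrizable_space X" "no_isolated_points X" for X :: "'a topology"
    using partitionable_complete[OF that] CY by (rule partitionable_trans)
  ultimately show ?thesis
    using YC CY partitionable_imp_coverable coverable_no_isolated_points[OF _ assms(4)] by meson
qed

end
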